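(* There exists a deterministic, combinatorial, polynomial-time algorithm that achieves an approximation ratio of $4m+1$ for the coflow-level coflow scheduling problem in identical parallel networks with (arbitrary) release times, where $m$ is the number of network cores.
   Context: Identical parallel network: $m$ identical network cores, each an $N\times N$ non-blocking switch; the $i$-th input port of every core is connected to source server $i\in\mathcal{I}=\{1,\dots,N\}$ and the $j$-th output port of every core to destination server $j\in\mathcal{J}=\{1,\dots,N\}$. All links have unit capacity, so on each core, at any time, each input port and each output port transmits data of at most one flow, at rate at most 1; transmission may be preempted. A set $\mathcal{K}$ of $n$ coflows is given; coflow $k$ has a demand matrix $D^{(k)}=(d_{i,j,k})_{i,j=1}^N$ of nonnegative integers, where $d_{i,j,k}$ is the size (equivalently, transmission time) of flow $(i,j,k)$ from source $i$ to destination $j$, a release time $r_k\ge 0$ before which none of its flows may be transmitted, and a positive weight $w_k$. The completion time $C_k$ of coflow $k$ is the time at which the last of its flows finishes. In the coflow-level scheduling problem, all flows of a given coflow must be transmitted on one and the same core (chosen by the scheduler). The objective is to minimize $\sum_{k\in\mathcal{K}} w_k C_k$. An algorithm has approximation ratio $\rho$ if on every instance its schedule has objective at most $\rho$ times the optimum. *)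

theory Defs
  imports "HOL-Analysis.Analysis" "HOL-Computational_Algebra.Polynomial" "HOL-Library.Log_Nat"
begin

section \<open>Coflow-level scheduling in identical parallel networks\<close>

text \<open>
  Cores, ports and coflows are numbered from 0. Release times and weights are rational because
  instances are inputs of an algorithm; schedules live in real time.
\<close>

record coflow_instance =
  cores :: nat
  ports :: nat
  coflows :: nat
  demand :: "nat \<Rightarrow> nat \<Rightarrow> nat \<Rightarrow> nat" \<comment> \<open>source, destination, coflow\<close>
  release :: "nat \<Rightarrow> rat"
  weight :: "nat \<Rightarrow> rat"

definition valid_instance :: "coflow_instance \<Rightarrow> bool" where
  "valid_instance I \<longleftrightarrow> cores I \<ge> 1 \<and> ports I \<ge> 1 \<and>
     (\<forall>k < coflows I. release I k \<ge> 0 \<and> weight I k > 0)"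

text \<open>
  The coflow-level constraint is built into the type: a schedule chooses one core per coflow,
  and \<open>rate S i j k t\<close> is the rate at which flow \<open>(i, j, k)\<close> is transmitted on
  that core at time \<open>t\<close>.
\<close>

record schedule =
  core :: "nat \<Rightarrow> nat"
  rate :: "nat \<Rightarrow> nat \<Rightarrow> nat \<Rightarrow> real \<Rightarrow> real"

definition sent :: "schedule \<Rightarrow> nat \<Rightarrow> nat \<Rightarrow> nat \<Rightarrow> real \<Rightarrow> real" where
  "sent S i j k T = integral {0..T} (rate S i j k)"

definition feasible :: "coflow_instance \<Rightarrow> schedule \<Rightarrow> bool" where
  "feasible I S \<longleftrightarrow>
     (\<forall>k < coflows I. core S k < cores I) \<and>
     (\<forall>i < ports I. \<forall>j < ports I. \<forall>k < coflows I.
        (\<forall>t. 0 \<le> rate S i j k t \<and> rate S i j k t \<le> 1) \<and>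
        (\<forall>t < real_of_rat (release I k). rate S i j k t = 0) \<and>
        (\<forall>T \<ge> 0. rate S i j k integrable_on {0..T}) \<and>
        (\<exists>T \<ge> 0. \<forall>T' \<ge> T. sent S i j k T' = real (demand I i j k))) \<and>
     (\<forall>i < ports I. \<forall>j < ports I. \<forall>j' < ports I. \<forall>k < coflows I. \<forall>k' < coflows I. \<forall>t.
        core S k = core S k' \<and> rate S i j k t > 0 \<and> rate S i j' k' t > 0
          \<longrightarrow> j = j' \<and> k = k') \<and>
     (\<forall>j < ports I. \<forall>i < ports I. \<forall>i' < ports I. \<forall>k < coflows I. \<forall>k' < coflows I. \<forall>t.
        core S k = core S k' \<and> rate S i j k t > 0 \<and> rate S i' j k' t > 0
          \<longrightarrow> i = i' \<and> k = k')"

text \<open>A flow of size 0 finishes when its coflow is released.\<close>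

definition flow_completion ::
  "coflow_instance \<Rightarrow> schedule \<Rightarrow> nat \<Rightarrow> nat \<Rightarrow> nat \<Rightarrow> real" where
  "flow_completion I S i j k =
     Inf {T. real_of_rat (release I k) \<le> T \<and> sent S i j k T = real (demand I i j k)}"

definition completion_time :: "coflow_instance \<Rightarrow> schedule \<Rightarrow> nat \<Rightarrow> real" where
  "completion_time I S k =
     Max ((\<lambda>(i, j). flow_completion I S i j k) ` ({..<ports I} \<times> {..<ports I}))"

definition objective :: "coflow_instance \<Rightarrow> schedule \<Rightarrow> real" where
  "objective I S = (\<Sum>k<coflows I. real_of_rat (weight I k) * completion_time I S k)"

definition optimum :: "coflow_instance \<Rightarrow> real" where
  "optimum I = Inf {objective I S |S. feasible I S}"


section \<open>Algorithms: a deterministic random access machine over the rationals\<close>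

text \<open>
  Structured programs over finitely many arrays of rationals; an array is addressed by rationals
  and a scalar variable is a single cell of an array. The only operations are the four arithmetic
  operations (division by 0 gives 0), comparison and access to cells. There is deliberately no
  rounding operation, which would not be an elementary operation for strong polynomiality.
\<close>

type_synonym memory = "nat \<Rightarrow> rat \<Rightarrow> rat"

datatype exp =
    Const rat
  | Cell nat exp
  | Add exp exp
  | Sub exp exp
  | Mul exp exp
  | Div exp exp

datatype prog =
    Skip
  | Assign nat exp exp \<comment> \<open>array, address, value\<close>
  | Seq prog prog
  | IfLess exp exp prog prog
  | WhileLess exp exp prog

fun val :: "exp \<Rightarrow> memory \<Rightarrow> rat" where
  "val (Const q) s = q"
| "val (Cell a e) s = s a (val e s)"
| "val (Add e f) s = val e s + val f s"
| "val (Sub e f) s = val e s - val f s"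
| "val (Mul e f) s = val e s * val f s"
| "val (Div e f) s = val e s / val f s"

text \<open>Length of the binary encoding of a reduced fraction (with a sign bit).\<close>

definition rat_bits :: "rat \<Rightarrow> nat" where
  "rat_bits q = 1 + floorlog 2 (nat \<bar>fst (quotient_of q)\<bar>) + floorlog 2 (nat (snd (quotient_of q)))"

fun exp_ops :: "exp \<Rightarrow> nat" where
  "exp_ops (Const q) = 1"
| "exp_ops (Cell a e) = 1 + exp_ops e"
| "exp_ops (Add e f) = 1 + exp_ops e + exp_ops f"
| "exp_ops (Sub e f) = 1 + exp_ops e + exp_ops f"
| "exp_ops (Mul e f) = 1 + exp_ops e + exp_ops f"
| "exp_ops (Div e f) = 1 + exp_ops e + exp_ops f"

text \<open>
  Logarithmic cost criterion: every operation is charged the length of its result, and (through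
  the recursive calls) of its operands and addresses.
\<close>

fun exp_bits :: "exp \<Rightarrow> memory \<Rightarrow> nat" where
  "exp_bits (Const q) s = rat_bits q"
| "exp_bits (Cell a e) s = rat_bits (val (Cell a e) s) + exp_bits e s"
| "exp_bits (Add e f) s = rat_bits (val (Add e f) s) + exp_bits e s + exp_bits f s"
| "exp_bits (Sub e f) s = rat_bits (val (Sub e f) s) + exp_bits e s + exp_bits f s"
| "exp_bits (Mul e f) s = rat_bits (val (Mul e f) s) + exp_bits e s + exp_bits f s"
| "exp_bits (Div e f) s = rat_bits (val (Div e f) s) + exp_bits e s + exp_bits f s"

text \<open>
  \<open>exec c s u b t\<close>: started in \<open>s\<close>, program \<open>c\<close> halts in \<open>t\<close> after \<open>u\<close> elementary
  operations, at logarithmic cost \<open>b\<close>.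
\<close>

inductive exec :: "prog \<Rightarrow> memory \<Rightarrow> nat \<Rightarrow> nat \<Rightarrow> memory \<Rightarrow> bool" where
  Skip: "exec Skip s 1 1 s"
| Assign: "exec (Assign a e f) s (1 + exp_ops e + exp_ops f) (1 + exp_bits e s + exp_bits f s)
             (s(a := (s a)(val e s := val f s)))"
| Seq: "exec c s u b s' \<Longrightarrow> exec d s' u' b' t \<Longrightarrow> exec (Seq c d) s (u + u') (b + b') t"
| IfTrue: "val e s < val f s \<Longrightarrow> exec c s u b t \<Longrightarrow>
    exec (IfLess e f c d) s (1 + exp_ops e + exp_ops f + u) (1 + exp_bits e s + exp_bits f s + b) t"
| IfFalse: "\<not> val e s < val f s \<Longrightarrow> exec d s u b t \<Longrightarrow>
    exec (IfLess e f c d) s (1 + exp_ops e + exp_ops f + u) (1 + exp_bits e s + exp_bits f s + b) t"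
| WhileFalse: "\<not> val e s < val f s \<Longrightarrow>
    exec (WhileLess e f c) s (1 + exp_ops e + exp_ops f) (1 + exp_bits e s + exp_bits f s) s"
| WhileTrue: "val e s < val f s \<Longrightarrow> exec c s u b s' \<Longrightarrow> exec (WhileLess e f c) s' u' b' t \<Longrightarrow>
    exec (WhileLess e f c) s (1 + exp_ops e + exp_ops f + u + u')
      (1 + exp_bits e s + exp_bits f s + b + b') t"

inductive_cases exec_SkipE: "exec Skip s u b t"
inductive_cases exec_AssignE: "exec (Assign a e f) s u b t"
inductive_cases exec_SeqE: "exec (Seq c d) s u b t"
inductive_cases exec_IfE: "exec (IfLess e f c d) s u b t"
inductive_cases exec_WhileE: "exec (WhileLess e f c) s u b t"

lemma exec_deterministic:
  "exec c s u b t \<Longrightarrow> exec c s u' b' t' \<Longrightarrow> u' = u \<and> b' = b \<and> t' = t"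
proof (induction arbitrary: u' b' t' rule: exec.induct)
  case Skip
  then show ?case by (auto elim: exec_SkipE)
next
  case Assign
  then show ?case by (auto elim: exec_AssignE)
next
  case (Seq c s u b s' d v b2 t)
  from Seq.prems obtain u1 b1 s1 u2 b3 where
    "exec c s u1 b1 s1" "exec d s1 u2 b3 t'" "u' = u1 + u2" "b' = b1 + b3"
    by (blast elim: exec_SeqE)
  with Seq.IH(1)[of u1 b1 s1] Seq.IH(2)[of u2 b3 t'] show ?case by simp
next
  case (IfTrue e s f c u b t d)
  from IfTrue.prems IfTrue.hyps(1) obtain u1 b1 where
    "exec c s u1 b1 t'" "u' = 1 + exp_ops e + exp_ops f + u1"
      "b' = 1 + exp_bits e s + exp_bits f s + b1"
    by (auto elim!: exec_IfE)
  with IfTrue.IH[of u1 b1 t'] show ?case by simp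
next
  case (IfFalse e s f d u b t c)
  from IfFalse.prems IfFalse.hyps(1) obtain u1 b1 where
    "exec d s u1 b1 t'" "u' = 1 + exp_ops e + exp_ops f + u1"
      "b' = 1 + exp_bits e s + exp_bits f s + b1"
    by (auto elim!: exec_IfE)
  with IfFalse.IH[of u1 b1 t'] show ?case by simp
next
  case (WhileFalse e s f c)
  then show ?case by (auto elim: exec_WhileE)
next
  case (WhileTrue e s f c u b s' v b2 t)
  from WhileTrue.prems WhileTrue.hyps(1) obtain u1 b1 s1 u2 b3 where
    "exec c s u1 b1 s1" "exec (WhileLess e f c) s1 u2 b3 t'"
      "u' = Suc (exp_ops e + exp_ops f + u1 + u2)"
      "b' = Suc (exp_bits e s + exp_bits f s + b1 + b3)"
    by (blast elim: exec_WhileE)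
  with WhileTrue.IH(1)[of u1 b1 s1] WhileTrue.IH(2)[of u2 b3 t'] show ?case by simp
qed


section \<open>Approximation algorithms for coflow-level scheduling\<close>

text \<open>
  Input: array 0 holds the numbers of cores, ports and coflows; array 1 holds the demand matrices
  one after the other, row by row; array 2 the release times; array 3 the weights.
  All other cells are 0.
\<close>

definition encode :: "coflow_instance \<Rightarrow> memory" where
  "encode I = (\<lambda>_ _. 0)
     (0 := (\<lambda>_. 0)(0 := of_nat (cores I), 1 := of_nat (ports I), 2 := of_nat (coflows I)),
      1 := (\<lambda>q. \<Sum>k<coflows I. \<Sum>i<ports I. \<Sum>j<ports I.
              if q = of_nat ((k * ports I + i) * ports I + j) then of_nat (demand I i j k) else 0),
      2 := (\<lambda>q. \<Sum>k<coflows I. if q = of_nat k then release I k else 0),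
      3 := (\<lambda>q. \<Sum>k<coflows I. if q = of_nat k then weight I k else 0))"

definition input_count :: "coflow_instance \<Rightarrow> nat" where
  "input_count I = 3 + coflows I * ports I * ports I + 2 * coflows I"

definition input_bits :: "coflow_instance \<Rightarrow> nat" where
  "input_bits I =
     rat_bits (of_nat (cores I)) + rat_bits (of_nat (ports I)) + rat_bits (of_nat (coflows I)) +
     (\<Sum>k<coflows I. \<Sum>i<ports I. \<Sum>j<ports I. rat_bits (of_nat (demand I i j k))) +
     (\<Sum>k<coflows I. rat_bits (release I k) + rat_bits (weight I k))"

text \<open>
  Output: array 4 holds the core of each coflow and cell 0 of array 5 the number of transmission
  intervals. During the \<open>l\<close>-th interval, which is half-open with endpoints in arrays 9 and 10,
  the flow whose source, destination and coflow are in arrays 6, 7, 8 is transmitted at rate 1.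
\<close>

definition outputs :: "coflow_instance \<Rightarrow> memory \<Rightarrow> schedule \<Rightarrow> bool" where
  "outputs I s S \<longleftrightarrow>
     (\<forall>k < coflows I. s 4 (of_nat k) = of_nat (core S k)) \<and>
     (\<forall>i < ports I. \<forall>j < ports I. \<forall>k < coflows I. \<forall>t.
        rate S i j k t =
          (if \<exists>l::nat. of_nat l < s 5 0 \<and>
                s 6 (of_nat l) = of_nat i \<and> s 7 (of_nat l) = of_nat j \<and> s 8 (of_nat l) = of_nat k \<and>
                real_of_rat (s 9 (of_nat l)) \<le> t \<and> t < real_of_rat (s 10 (of_nat l))
           then 1 else 0))"

definition approximation_ratio :: "prog \<Rightarrow> (coflow_instance \<Rightarrow> real) \<Rightarrow> bool" where
  "approximation_ratio A \<rho> \<longleftrightarrow>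
     (\<forall>I. valid_instance I \<longrightarrow>
        (\<exists>u b s S. exec A (encode I) u b s \<and> outputs I s S \<and> feasible I S \<and>
           objective I S \<le> \<rho> I * optimum I))"

definition polynomial_time :: "prog \<Rightarrow> bool" where
  "polynomial_time A \<longleftrightarrow>
     (\<exists>p :: nat poly. \<forall>I. valid_instance I \<longrightarrow>
        (\<exists>u b s. exec A (encode I) u b s \<and> b \<le> poly p (input_bits I)))"

text \<open>
  `Combinatorial' (as opposed to solving linear programs numerically) is rendered by its usual
  quantitative content: the number of elementary operations is bounded by a polynomial in the
  number of input numbers, irrespective of their magnitude. Together with
  \<open>polynomial_time\<close> this is strong polynomiality.
\<close>

definition combinatorial :: "prog \<Rightarrow> bool" where
  "combinatorial A \<longleftrightarrow>
     (\<exists>p :: nat poly. \<forall>I. valid_instance I \<longrightarrow>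
        (\<exists>u b s. exec A (encode I) u b s \<and> u \<le> poly p (input_count I)))"

end

theory Submission imports Defs begin

text \<open>
  All coflows are transmitted on a single core. Let $L_p(U)$ be the total demand of the coflows in
  $U$ at port $p$. Since $m$ cores process at most $m$ units per time unit at a port, the completion
  times $C_k$ of any feasible schedule satisfy $L_p(U)^2 \le 2m \sum_{k \in U} L_p(\{k\}) C_k$.
  Build an order of the coflows from the last to the first position: take a port $p$ of maximal load
  in the set $U$ of the remaining coflows, let $k \in U$ minimise the ratio of residual weight and
  load at $p$, subtract this ratio times the loads at $p$ from the residual weights in $U$, and put
  $k$ last. This is a local-ratio argument: charging each subtracted part separately gives
  $\sum_k w_k \max_p L_p(\{1,\dots,k\}) \le 2m \sum_k w_k C_k$. Scheduling the flows greedily and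
  preemptively by priority in that order, flow $(i,j,k)$ waits after its release only while port $i$
  or port $j$ serves a flow of at least its priority, so that coflow $k$ is finished by
  $r_k + 2 \max_p L_p(\{1,\dots,k\})$. Together with $r_k \le C_k$ this yields the ratio $4m+1$.

  Numbers stay short because of common denominators: for the event times the product of the
  denominators of the release times, for the residual weights the product of the denominators of the
  weights and of one load for each coflow already placed.
\<close>

subsection \<open>Fractions with short numerator and denominator\<close>

definition fits :: "nat \<Rightarrow> rat \<Rightarrow> bool" where
  "fits h q \<longleftrightarrow> (\<exists>a b::int. q = of_int a / of_int b \<and> \<bar>a\<bar> \<le> 2 ^ h \<and> 0 < b \<and> b \<le> 2 ^ h)"

lemma fitsI: "q = of_int a / of_int b \<Longrightarrow> \<bar>a\<bar> \<le> 2 ^ h \<Longrightarrow> 0 < b \<Longrightarrow> b \<le> 2 ^ h \<Longrightarrow> fits h q"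
  unfolding fits_def by blast

lemma fitsE:
  assumes "fits h q"
  obtains a b :: int where "q = of_int a / of_int b" "\<bar>a\<bar> \<le> 2 ^ h" "0 < b" "b \<le> 2 ^ h"
  using assms unfolding fits_def by blast

lemma fits_mono:
  assumes "fits h q" "h \<le> h'"
  shows "fits h' q"
proof -
  obtain a b where "q = of_int a / of_int b" "\<bar>a\<bar> \<le> 2 ^ h" "0 < b" "b \<le> 2 ^ h"
    using assms(1) by (rule fitsE)
  moreover have "(2::int) ^ h \<le> 2 ^ h'" using assms(2) by (intro power_increasing) auto
  ultimately show ?thesis by (intro fitsI[of q a b]) linarith+
qed

lemma fits_of_nat: "x \<le> 2 ^ h \<Longrightarrow> fits h (of_nat x)"
  by (rule fitsI[of _ "int x" 1]) simp_all

lemma fits_0 [simp]: "fits h 0" and fits_1 [simp]: "fits h 1"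
  using fits_of_nat[of 0 h] fits_of_nat[of 1 h] by simp_all

lemma fits_mult:
  assumes "fits h p" "fits k q"
  shows "fits (h + k) (p * q)"
proof -
  obtain a b c d :: int where "p = of_int a / of_int b" "\<bar>a\<bar> \<le> 2 ^ h" "0 < b" "b \<le> 2 ^ h"
    "q = of_int c / of_int d" "\<bar>c\<bar> \<le> 2 ^ k" "0 < d" "d \<le> 2 ^ k"
    using assms by (elim fitsE)
  then show ?thesis
    by (intro fitsI[of _ "a * c" "b * d"]) (auto simp: abs_mult power_add intro!: mult_mono)
qed

lemma fits_inverse:
  assumes "fits h q"
  shows "fits h (inverse q)"
proof -
  obtain a b where q: "q = of_int a / of_int b" "\<bar>a\<bar> \<le> 2 ^ h" "0 < b" "b \<le> 2 ^ h"
    using assms by (rule fitsE)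
  consider (zero) "a = 0" | (pos) "a > 0" | (neg) "a < 0" by linarith
  then show ?thesis
  proof cases
    case zero
    with q show ?thesis by simp
  next
    case pos
    with q show ?thesis by (intro fitsI[of _ b a]) auto
  next
    case neg
    with q show ?thesis by (intro fitsI[of _ "- b" "- a"]) auto
  qed
qed

lemma fits_divide: "fits h p \<Longrightarrow> fits k q \<Longrightarrow> fits (h + k) (p / q)"
  using fits_mult[OF _ fits_inverse] by (simp add: divide_inverse)

lemma fits_uminus: "fits h q \<Longrightarrow> fits h (- q)"
  using fits_mult[of h q 0 "- 1"] fitsI[of "- 1" "- 1" 1 0] by simp

lemma fits_add:
  assumes "fits h p" "fits k q"
  shows "fits (h + k + 1) (p + q)"
proof -
  obtain a b c d :: int where p: "p = of_int a / of_int b" "\<bar>a\<bar> \<le> 2 ^ h" "0 < b" "b \<le> 2 ^ h"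
    and q: "q = of_int c / of_int d" "\<bar>c\<bar> \<le> 2 ^ k" "0 < d" "d \<le> 2 ^ k"
    using assms by (elim fitsE)
  have "\<bar>a\<bar> * d \<le> 2 ^ h * 2 ^ k" "\<bar>c\<bar> * b \<le> 2 ^ k * 2 ^ h" "b * d \<le> 2 ^ h * 2 ^ k"
    using p q by (auto intro!: mult_mono)
  moreover have "\<bar>a * d + c * b\<bar> \<le> \<bar>a\<bar> * d + \<bar>c\<bar> * b"
    using p q abs_triangle_ineq[of "a * d" "c * b"] by (simp add: abs_mult)
  moreover have "p + q = of_int (a * d + c * b) / of_int (b * d)"
    using p q by (simp add: field_simps)
  ultimately show ?thesis
    using p q by (intro fitsI[of _ "a * d + c * b" "b * d"]) (auto simp: power_add mult.commute)
qed

lemma fits_diff: "fits h p \<Longrightarrow> fits k q \<Longrightarrow> fits (h + k + 1) (p - q)"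
  using fits_add[OF _ fits_uminus] by simp

lemma fits_if_common_denominator:
  assumes "q * of_int D \<in> \<int>" "0 < D" "D \<le> 2 ^ h" "\<bar>q\<bar> \<le> 2 ^ k"
  shows "fits (h + k) q"
proof -
  obtain a where a: "q * of_int D = of_int a" using assms(1) Ints_cases by blast
  have "\<bar>q * of_int D\<bar> \<le> 2 ^ k * of_int D"
    using assms(2,4) by (simp add: abs_mult mult_right_mono)
  also have "\<dots> = of_int (2 ^ k * D)" by simp
  finally have "\<bar>a\<bar> \<le> 2 ^ k * D" unfolding a by linarith
  also have "\<dots> \<le> 2 ^ k * 2 ^ h" using assms by (intro mult_left_mono) auto
  finally have numerator: "\<bar>a\<bar> \<le> 2 ^ (h + k)" by (simp add: power_add mult.commute)
  have "(2::int) ^ h \<le> 2 ^ (h + k)" by (intro power_increasing) auto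
  then have "D \<le> 2 ^ (h + k)" using assms(3) by linarith
  then show ?thesis using a numerator assms by (intro fitsI[of _ a D]) (auto simp: field_simps)
qed

lemma quotient_of_le:
  assumes "q = of_int a / of_int b" "0 < b"
  shows "\<bar>fst (quotient_of q)\<bar> \<le> \<bar>a\<bar>" "snd (quotient_of q) \<le> b"
proof -
  obtain c d where quotient: "quotient_of q = (c, d)" by fastforce
  have pos: "d > 0" and coprime: "coprime c d" and fraction: "q = of_int c / of_int d"
    using quotient_of_denom_pos[OF quotient] quotient_of_coprime[OF quotient]
      quotient_of_div[OF quotient] by auto
  have "(of_int a :: rat) * of_int d = of_int c * of_int b"
    using assms pos fraction by (simp add: field_simps)
  then have cross: "a * d = c * b" by (metis of_int_eq_iff of_int_mult)
  have "d dvd b" using cross coprime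
    by (metis coprime_commute coprime_dvd_mult_right_iff dvd_triv_right)
  then show "snd (quotient_of q) \<le> b" using assms(2) quotient by (simp add: zdvd_imp_le)
  have "c dvd a" using cross coprime by (metis coprime_dvd_mult_left_iff dvd_triv_left)
  then show "\<bar>fst (quotient_of q)\<bar> \<le> \<bar>a\<bar>"
    using cross assms(2) quotient by (cases "a = 0") (auto simp: dvd_imp_le_int)
qed

lemma rat_bits_le_if_fits:
  assumes "fits h q"
  shows "rat_bits q \<le> 2 * h + 3"
proof -
  obtain a b where "q = of_int a / of_int b" "\<bar>a\<bar> \<le> 2 ^ h" "0 < b" "b \<le> 2 ^ h"
    using assms by (rule fitsE)
  then have "\<bar>fst (quotient_of q)\<bar> \<le> 2 ^ h" "snd (quotient_of q) \<le> 2 ^ h"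
    using quotient_of_le[of q a b] by linarith+
  moreover have "floorlog 2 (nat y) \<le> h + 1" if "y \<le> 2 ^ h" for y
  proof (rule floorlog_leI)
    have "nat y \<le> 2 ^ h" using that by (simp add: nat_le_iff)
    also have "(2::nat) ^ h < 2 ^ (h + 1)" by simp
    finally show "nat y < 2 ^ (h + 1)" .
  qed auto
  ultimately have "floorlog 2 (nat \<bar>fst (quotient_of q)\<bar>) \<le> h + 1"
    "floorlog 2 (nat (snd (quotient_of q))) \<le> h + 1" by blast+
  then show ?thesis unfolding rat_bits_def by linarith
qed

lemma quotient_of_less_two_power_rat_bits:
  "\<bar>fst (quotient_of q)\<bar> < 2 ^ rat_bits q" "snd (quotient_of q) < 2 ^ rat_bits q"
proof -
  have less: "x < 2 ^ k" if "floorlog 2 (nat x) \<le> k" "0 \<le> x" for x k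
    using floorlog_leD[OF that(1)] that(2) by (simp add: nat_less_iff)
  show "\<bar>fst (quotient_of q)\<bar> < 2 ^ rat_bits q" unfolding rat_bits_def by (rule less) auto
  show "snd (quotient_of q) < 2 ^ rat_bits q"
    unfolding rat_bits_def by (rule less) (auto simp: less_imp_le[OF quotient_of_denom_pos'])
qed

lemma quotient_of_fraction: "q = of_int (fst (quotient_of q)) / of_int (snd (quotient_of q))"
  by (rule quotient_of_div) simp

lemma fits_rat_bits: "fits (rat_bits q) q"
  by (rule fitsI[OF quotient_of_fraction])
    (use quotient_of_less_two_power_rat_bits[of q] quotient_of_denom_pos'[of q] in auto)

lemma rat_bits_ge_1: "1 \<le> rat_bits q"
  unfolding rat_bits_def by simp

lemma abs_less_two_power_rat_bits: "\<bar>q\<bar> < 2 ^ rat_bits q"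
proof -
  let ?a = "fst (quotient_of q)" and ?b = "snd (quotient_of q)"
  have "1 \<le> ?b" using quotient_of_denom_pos'[of q] by simp
  then have "\<bar>q\<bar> \<le> of_int \<bar>?a\<bar>"
    by (subst quotient_of_fraction)
      (simp add: divide_le_eq mult_left_le_one_le abs_divide mult_le_cancel_left1)
  also have "\<dots> < of_int (2 ^ rat_bits q)"
    using quotient_of_less_two_power_rat_bits(1)[of q] of_int_less_iff by blast
  finally show ?thesis by simp
qed

lemma nat_less_two_power_rat_bits: "x < 2 ^ rat_bits (of_nat x)"
proof -
  have "rat_of_nat x < of_nat (2 ^ rat_bits (of_nat x))"
    using abs_less_two_power_rat_bits[of "of_nat x"] by simp
  then show ?thesis by (simp only: of_nat_less_iff)
qed

lemma sum_less_two_power_sum: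
  fixes f g :: "'a \<Rightarrow> nat"
  assumes "finite A" "\<And>x. x \<in> A \<Longrightarrow> f x < 2 ^ g x"
  shows "sum f A < 2 ^ sum g A"
  using assms
proof (induction rule: finite_induct)
  case (insert x A)
  then have "Suc (f x) * Suc (sum f A) \<le> 2 ^ g x * 2 ^ sum g A"
    by (intro mult_le_mono) (auto simp: Suc_le_eq)
  then show ?case using insert.hyps by (simp add: power_add)
qed simp

lemma common_denominator:
  fixes f :: "'a \<Rightarrow> rat"
  assumes "finite A" "(\<Sum>x\<in>A. rat_bits (f x)) \<le> b"
  obtains D :: int where "0 < D" "D \<le> 2 ^ b" "\<And>x. x \<in> A \<Longrightarrow> f x * of_int D \<in> \<int>"
proof
  let ?num = "\<lambda>x. fst (quotient_of (f x))" and ?den = "\<lambda>x. snd (quotient_of (f x))"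
  let ?D = "\<Prod>x\<in>A. ?den x"
  show "0 < ?D" by (intro prod_pos) (simp add: quotient_of_denom_pos')
  have "?D \<le> (\<Prod>x\<in>A. 2 ^ rat_bits (f x))"
    by (intro prod_mono)
      (simp add: quotient_of_less_two_power_rat_bits less_imp_le quotient_of_denom_pos')
  also have "\<dots> = 2 ^ (\<Sum>x\<in>A. rat_bits (f x))" by (simp add: power_sum)
  also have "\<dots> \<le> 2 ^ b" using assms(2) by (intro power_increasing) auto
  finally show "?D \<le> 2 ^ b" .
  fix x assume x: "x \<in> A"
  have "f x * of_int (?den x) = of_int (?num x)"
    using quotient_of_denom_pos'[of "f x"] by (subst quotient_of_fraction) simp
  then have "f x * of_int ?D = of_int (?num x * (\<Prod>x\<in>A - {x}. ?den x))"
    by (simp only: prod.remove[OF assms(1) x] of_int_mult mult.assoc[symmetric])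
  then show "f x * of_int ?D \<in> \<int>" by (simp only: Ints_of_int)
qed


subsection \<open>A program logic with cost bounds\<close>

definition all_fit :: "nat \<Rightarrow> memory \<Rightarrow> bool" where
  "all_fit h s \<longleftrightarrow> (\<forall>a q. fits h (s a q))"

fun val_size :: "exp \<Rightarrow> nat" where
  "val_size (Const q) = rat_bits q"
| "val_size (Cell a e) = 1"
| "val_size (Add e f) = val_size e + val_size f + 1"
| "val_size (Sub e f) = val_size e + val_size f + 1"
| "val_size (Mul e f) = val_size e + val_size f"
| "val_size (Div e f) = val_size e + val_size f"

fun bits_factor :: "exp \<Rightarrow> nat" where
  "bits_factor (Const q) = rat_bits q"
| "bits_factor (Cell a e) = 5 + bits_factor e"
| "bits_factor (Add e f) = 2 * val_size (Add e f) + 3 + bits_factor e + bits_factor f"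
| "bits_factor (Sub e f) = 2 * val_size (Sub e f) + 3 + bits_factor e + bits_factor f"
| "bits_factor (Mul e f) = 2 * val_size (Mul e f) + 3 + bits_factor e + bits_factor f"
| "bits_factor (Div e f) = 2 * val_size (Div e f) + 3 + bits_factor e + bits_factor f"

lemma fits_val:
  assumes "all_fit h s"
  shows "fits (val_size e * (h + 1)) (val e s)"
proof (induction e)
  case (Const q)
  show ?case by (rule fits_mono[of "rat_bits q"]) (simp_all add: fits_rat_bits)
next
  case (Cell a e)
  show ?case by (rule fits_mono[of h]) (use assms in \<open>simp_all add: all_fit_def\<close>)
next
  case (Add e f)
  from fits_mono[OF fits_add[OF this], of "val_size (Add e f) * (h + 1)"] show ?case
    by (simp add: algebra_simps)
next
  case (Sub e f)
  from fits_mono[OF fits_diff[OF this], of "val_size (Sub e f) * (h + 1)"] show ?case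
    by (simp add: algebra_simps)
next
  case (Mul e f)
  from fits_mono[OF fits_mult[OF this], of "val_size (Mul e f) * (h + 1)"] show ?case
    by (simp add: algebra_simps)
next
  case (Div e f)
  from fits_mono[OF fits_divide[OF this], of "val_size (Div e f) * (h + 1)"] show ?case
    by (simp add: algebra_simps)
qed

lemma exp_bits_le:
  assumes "all_fit h s"
  shows "exp_bits e s \<le> bits_factor e * (h + 1)"
proof -
  have val_bits: "rat_bits (val e s) \<le> (2 * val_size e + 3) * (h + 1)" for e
    using rat_bits_le_if_fits[OF fits_val[OF assms, of e]] by (simp add: algebra_simps)
  show ?thesis
  proof (induction e)
    case (Cell a e)
    then show ?case using val_bits[of "Cell a e"] by (simp add: algebra_simps)
  next
    case (Add e f)
    then show ?case using val_bits[of "Add e f"] by (simp add: algebra_simps)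
  next
    case (Sub e f)
    then show ?case using val_bits[of "Sub e f"] by (simp add: algebra_simps)
  next
    case (Mul e f)
    then show ?case using val_bits[of "Mul e f"] by (simp add: algebra_simps)
  next
    case (Div e f)
    then show ?case using val_bits[of "Div e f"] by (simp add: algebra_simps)
  qed simp
qed

fun writes :: "prog \<Rightarrow> nat set" where
  "writes Skip = {}"
| "writes (Assign a e f) = {a}"
| "writes (Seq c d) = writes c \<union> writes d"
| "writes (IfLess e f c d) = writes c \<union> writes d"
| "writes (WhileLess e f c) = writes c"

fun prog_factor :: "prog \<Rightarrow> nat" where
  "prog_factor Skip = 1"
| "prog_factor (Assign a e f) = 1 + bits_factor e + bits_factor f"
| "prog_factor (Seq c d) = prog_factor c + prog_factor d"
| "prog_factor (IfLess e f c d) = 1 + bits_factor e + bits_factor f + prog_factor c + prog_factor d"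
| "prog_factor (WhileLess e f c) = 1 + bits_factor e + bits_factor f + prog_factor c"

text \<open>The number of operations when every loop is iterated at most \<open>M\<close> times, as a
  polynomial in \<open>M\<close>.\<close>

fun ops_poly :: "prog \<Rightarrow> nat poly" where
  "ops_poly Skip = 1"
| "ops_poly (Assign a e f) = [:1 + exp_ops e + exp_ops f:]"
| "ops_poly (Seq c d) = ops_poly c + ops_poly d"
| "ops_poly (IfLess e f c d) = [:1 + exp_ops e + exp_ops f:] + ops_poly c + ops_poly d"
| "ops_poly (WhileLess e f c) = [:1, 1:] * ([:1 + exp_ops e + exp_ops f:] + ops_poly c)"

definition same_outside :: "nat set \<Rightarrow> memory \<Rightarrow> memory \<Rightarrow> bool" where
  "same_outside W s t \<longleftrightarrow> (\<forall>a. a \<notin> W \<longrightarrow> t a = s a)"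

lemma same_outsideD: "same_outside W s t \<Longrightarrow> a \<notin> W \<Longrightarrow> t a = s a"
  unfolding same_outside_def by blast

lemma same_outside_trans:
  "same_outside V s t \<Longrightarrow> same_outside W t r \<Longrightarrow> V \<subseteq> X \<Longrightarrow> W \<subseteq> X \<Longrightarrow> same_outside X s r"
  unfolding same_outside_def by (metis subsetD)

definition determined_by :: "(memory \<Rightarrow> bool) \<Rightarrow> nat set \<Rightarrow> bool" where
  "determined_by P A \<longleftrightarrow> (\<forall>s t. P s \<longrightarrow> (\<forall>a\<in>A. t a = s a) \<longrightarrow> P t)"

lemma determined_by_frame:
  assumes "determined_by P A" "P s" "same_outside W s t" "W \<inter> A = {}"
  shows "P t"
proof -
  have "\<forall>a\<in>A. t a = s a" using assms(3,4) by (auto intro: same_outsideD)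
  then show ?thesis using assms(1,2) unfolding determined_by_def by blast
qed

definition run :: "nat \<Rightarrow> nat \<Rightarrow> prog \<Rightarrow> memory \<Rightarrow> (memory \<Rightarrow> bool) \<Rightarrow> bool" where
  "run M h c s Q \<longleftrightarrow> (\<exists>u b t. exec c s u b t \<and> u \<le> poly (ops_poly c) M \<and>
     b \<le> prog_factor c * (h + 1) * u \<and> all_fit h t \<and> same_outside (writes c) s t \<and> Q t)"

lemma runI:
  assumes "exec c s u b t" "u \<le> poly (ops_poly c) M" "b \<le> prog_factor c * (h + 1) * u"
    "all_fit h t" "same_outside (writes c) s t" "Q t"
  shows "run M h c s Q"
  using assms unfolding run_def by blast

lemma runE:
  assumes "run M h c s Q"
  obtains u b t where "exec c s u b t" "u \<le> poly (ops_poly c) M" "b \<le> prog_factor c * (h + 1) * u"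
    "all_fit h t" "same_outside (writes c) s t" "Q t"
  using assms unfolding run_def by blast

lemma run_conseq:
  assumes "run M h c s P" "\<And>t. all_fit h t \<Longrightarrow> same_outside (writes c) s t \<Longrightarrow> P t \<Longrightarrow> Q t"
  shows "run M h c s Q"
  using assms unfolding run_def by blast

lemma cost_add_mono:
  fixes b b' k k' l H u u' :: nat
  assumes "b \<le> k * H * u" "b' \<le> k' * H * u'" "k \<le> l" "k' \<le> l"
  shows "b + b' \<le> l * H * (u + u')"
proof -
  have "b \<le> l * H * u" using assms(1) by (rule order_trans) (intro mult_le_mono assms order_refl)
  moreover have "b' \<le> l * H * u'"
    using assms(2) by (rule order_trans) (intro mult_le_mono assms order_refl)
  ultimately show ?thesis by (simp add: distrib_left)
qed

lemma step_cost_le: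
  assumes "all_fit h s"
  shows "1 + exp_bits e s + exp_bits f s
    \<le> (1 + bits_factor e + bits_factor f) * (h + 1) * (1 + exp_ops e + exp_ops f)"
proof -
  have "1 + exp_bits e s + exp_bits f s \<le> (1 + bits_factor e + bits_factor f) * (h + 1)"
    using exp_bits_le[OF assms, of e] exp_bits_le[OF assms, of f] by (simp add: algebra_simps)
  also have "\<dots> \<le> \<dots> * (1 + exp_ops e + exp_ops f)" by simp
  finally show ?thesis .
qed

lemma run_Skip: "all_fit h s \<Longrightarrow> Q s \<Longrightarrow> run M h Skip s Q"
  by (rule runI[OF exec.Skip]) (auto simp: same_outside_def)

lemma run_Assign:
  assumes "all_fit h s" "fits h (val f s)" "Q (s(a := (s a)(val e s := val f s)))"
  shows "run M h (Assign a e f) s Q"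
  by (rule runI[OF exec.Assign])
    (use assms step_cost_le[OF assms(1), of e f] in \<open>auto simp: all_fit_def same_outside_def\<close>)

lemma run_Seq:
  assumes "run M h c s P" "\<And>t. all_fit h t \<Longrightarrow> same_outside (writes c) s t \<Longrightarrow> P t \<Longrightarrow> run M h d t Q"
  shows "run M h (Seq c d) s Q"
proof -
  obtain u b t where first: "exec c s u b t" "u \<le> poly (ops_poly c) M"
    "b \<le> prog_factor c * (h + 1) * u"
    "all_fit h t" "same_outside (writes c) s t" "P t"
    using assms(1) by (rule runE)
  obtain u' b' r where second: "exec d t u' b' r" "u' \<le> poly (ops_poly d) M"
    "b' \<le> prog_factor d * (h + 1) * u'" "all_fit h r" "same_outside (writes d) t r" "Q r"
    using assms(2)[OF first(4-6)] by (rule runE)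
  show ?thesis
  proof (rule runI[OF exec.Seq[OF first(1) second(1)]])
    show "b + b' \<le> prog_factor (Seq c d) * (h + 1) * (u + u')"
      by (rule cost_add_mono[OF first(3) second(3)]) auto
    show "same_outside (writes (Seq c d)) s r"
      by (rule same_outside_trans[OF first(5) second(5)]) auto
  qed (use first second in auto)
qed

lemma run_IfLess:
  assumes fit: "all_fit h s"
    and if_true: "val e s < val f s \<Longrightarrow> run M h c s Q"
    and if_false: "\<not> val e s < val f s \<Longrightarrow> run M h d s Q"
  shows "run M h (IfLess e f c d) s Q"
proof (cases "val e s < val f s")
  case True
  obtain u b t where branch: "exec c s u b t" "u \<le> poly (ops_poly c) M"
    "b \<le> prog_factor c * (h + 1) * u"
    "all_fit h t" "same_outside (writes c) s t" "Q t"
    using if_true[OF True] by (rule runE)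
  show ?thesis
  proof (rule runI[OF exec.IfTrue[OF True branch(1)]])
    show "1 + exp_bits e s + exp_bits f s + b
        \<le> prog_factor (IfLess e f c d) * (h + 1) * (1 + exp_ops e + exp_ops f + u)"
      by (rule cost_add_mono[OF step_cost_le[OF fit] branch(3)]) auto
  qed (use branch in \<open>auto simp: same_outside_def\<close>)
next
  case False
  obtain u b t where branch: "exec d s u b t" "u \<le> poly (ops_poly d) M"
    "b \<le> prog_factor d * (h + 1) * u"
    "all_fit h t" "same_outside (writes d) s t" "Q t"
    using if_false[OF False] by (rule runE)
  show ?thesis
  proof (rule runI[OF exec.IfFalse[OF False branch(1)]])
    show "1 + exp_bits e s + exp_bits f s + b
        \<le> prog_factor (IfLess e f c d) * (h + 1) * (1 + exp_ops e + exp_ops f + u)"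
      by (rule cost_add_mono[OF step_cost_le[OF fit] branch(3)]) auto
  qed (use branch in \<open>auto simp: same_outside_def\<close>)
qed

lemma exec_WhileLess_bounded:
  assumes test: "\<And>k t. k \<le> K \<Longrightarrow> Inv k t \<Longrightarrow> val e t < val f t \<longleftrightarrow> k < K"
    and fit: "\<And>k t. Inv k t \<Longrightarrow> all_fit h t"
    and step: "\<And>k t. k < K \<Longrightarrow> Inv k t \<Longrightarrow> run M h c t (Inv (Suc k))"
    and "k \<le> K" "Inv k s"
  shows "\<exists>u b t. exec (WhileLess e f c) s u b t \<and>
    u \<le> (K - k + 1) * (1 + exp_ops e + exp_ops f + poly (ops_poly c) M) \<and>
    b \<le> prog_factor (WhileLess e f c) * (h + 1) * u \<and> same_outside (writes c) s t \<and> Inv K t"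
  using \<open>k \<le> K\<close> \<open>Inv k s\<close>
proof (induction k arbitrary: s rule: inc_induct)
  case base
  have "\<not> val e s < val f s" using test base by blast
  moreover have "1 + exp_bits e s + exp_bits f s
      \<le> prog_factor (WhileLess e f c) * (h + 1) * (1 + exp_ops e + exp_ops f)"
    using step_cost_le[OF fit[OF base], of e f] by (rule order_trans) (intro mult_le_mono; simp)
  ultimately show ?case using exec.WhileFalse[of e s f c] base
    by (intro exI[of _ "1 + exp_ops e + exp_ops f"] exI[of _ "1 + exp_bits e s + exp_bits f s"]
        exI[of _ s]) (auto simp: same_outside_def)
next
  case (step k)
  have less: "val e s < val f s" using test[of k s] step.hyps step.prems by simp
  obtain u b t where body: "exec c s u b t" "u \<le> poly (ops_poly c) M"
    "b \<le> prog_factor c * (h + 1) * u" "same_outside (writes c) s t" "Inv (Suc k) t"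
    using assms(3)[OF step.hyps(2) step.prems] by (rule runE)
  obtain u' b' r where rest: "exec (WhileLess e f c) t u' b' r"
      "u' \<le> (K - Suc k + 1) * (1 + exp_ops e + exp_ops f + poly (ops_poly c) M)"
      "b' \<le> prog_factor (WhileLess e f c) * (h + 1) * u'" "same_outside (writes c) t r" "Inv K r"
    using step.IH[OF body(5)] by blast
  have first: "1 + exp_bits e s + exp_bits f s + b
      \<le> prog_factor (WhileLess e f c) * (h + 1) * (1 + exp_ops e + exp_ops f + u)"
    by (rule cost_add_mono[OF step_cost_le[OF fit[OF step.prems]] body(3)]) auto
  have bits: "1 + exp_bits e s + exp_bits f s + b + b'
      \<le> prog_factor (WhileLess e f c) * (h + 1) * (1 + exp_ops e + exp_ops f + u + u')"
    by (rule cost_add_mono[OF first rest(3)]) auto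
  have "K - k + 1 = Suc (K - Suc k + 1)" using step.hyps by simp
  then have "1 + exp_ops e + exp_ops f + u + u'
      \<le> (K - k + 1) * (1 + exp_ops e + exp_ops f + poly (ops_poly c) M)"
    using body(2) rest(2) by simp
  moreover have "same_outside (writes c) s r" using body(4) rest(4)
    by (rule same_outside_trans) auto
  ultimately show ?case
    using exec.WhileTrue[OF less body(1) rest(1)] bits rest(5) by blast
qed

lemma run_WhileLess:
  assumes test: "\<And>k t. k \<le> K \<Longrightarrow> Inv k t \<Longrightarrow> val e t < val f t \<longleftrightarrow> k < K"
    and fit: "\<And>k t. Inv k t \<Longrightarrow> all_fit h t"
    and step: "\<And>k t. k < K \<Longrightarrow> Inv k t \<Longrightarrow> run M h c t (Inv (Suc k))"
    and "K \<le> M" "Inv 0 s"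
  shows "run M h (WhileLess e f c) s (Inv K)"
proof -
  obtain u b t where loop: "exec (WhileLess e f c) s u b t"
    "u \<le> (K - 0 + 1) * (1 + exp_ops e + exp_ops f + poly (ops_poly c) M)"
    "b \<le> prog_factor (WhileLess e f c) * (h + 1) * u" "same_outside (writes c) s t" "Inv K t"
    using exec_WhileLess_bounded[of K Inv e f h M c 0 s] test fit step \<open>Inv 0 s\<close> by force
  show ?thesis
  proof (rule runI[OF loop(1)])
    have "u \<le> (M + 1) * (1 + exp_ops e + exp_ops f + poly (ops_poly c) M)"
      using loop(2) by (rule order_trans) (use \<open>K \<le> M\<close> in \<open>intro mult_right_mono; simp\<close>)
    then show "u \<le> poly (ops_poly (WhileLess e f c)) M" by (simp add: algebra_simps)
  qed (use loop fit in auto)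
qed

abbreviation Var :: "nat \<Rightarrow> exp" where "Var a \<equiv> Cell a (Const 0)"

definition For :: "nat \<Rightarrow> exp \<Rightarrow> prog \<Rightarrow> prog" where
  "For i e c = Seq (Assign i (Const 0) (Const 0))
     (WhileLess (Var i) e (Seq c (Assign i (Const 0) (Add (Var i) (Const 1)))))"

lemma writes_For [simp]: "writes (For i e c) = insert i (writes c)"
  by (auto simp: For_def)

lemma run_For:
  assumes s: "all_fit h s" "Inv 0 s" and K: "K \<le> M" "K \<le> 2 ^ h" and i: "i \<notin> writes c"
    and frame: "\<And>t. same_outside (insert i (writes c)) s t \<Longrightarrow> P t"
    and bound: "\<And>t. P t \<Longrightarrow> val e t = of_nat K"
    and counter: "\<And>k t v. Inv k (t(i := v)) = Inv k t"
    and step: "\<And>k t. k < K \<Longrightarrow> all_fit h t \<Longrightarrow> P t \<Longrightarrow> t i 0 = of_nat k \<Longrightarrow> Inv k t \<Longrightarrow>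
      run M h c t (Inv (Suc k))"
  shows "run M h (For i e c) s (\<lambda>t. P t \<and> Inv K t)"
proof -
  let ?W = "insert i (writes c)"
  let ?next = "Assign i (Const 0) (Add (Var i) (Const 1))"
  define J where "J k t \<longleftrightarrow> all_fit h t \<and> same_outside ?W s t \<and> t i 0 = of_nat k \<and> Inv k t" for k t
  have body: "run M h (Seq c ?next) t (J (Suc k))" if "k < K" "J k t" for k t
  proof (rule run_Seq[OF step[OF that(1)]])
    fix r assume r: "all_fit h r" "same_outside (writes c) t r" "Inv (Suc k) r"
    have "val (Add (Var i) (Const 1)) r = of_nat (Suc k)"
      using same_outsideD[OF r(2) i] that(2) unfolding J_def by simp
    moreover have "fits h (of_nat (Suc k))" using that(1) K(2) by (intro fits_of_nat) simp
    moreover have "same_outside ?W s (r(i := v))" for v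
      using that(2) r(2) unfolding J_def same_outside_def by simp
    ultimately show "run M h ?next r (J (Suc k))"
      using r unfolding J_def by (intro run_Assign) (auto simp: counter all_fit_def add.commute)
  qed (use that frame in \<open>auto simp: J_def\<close>)
  have "run M h (WhileLess (Var i) e (Seq c ?next)) t (J K)" if "J 0 t" for t
  proof (rule run_WhileLess[where K = K and Inv = J, OF _ _ body])
    show "val (Var i) r < val e r \<longleftrightarrow> k < K" if "J k r" for k r
      using that bound[OF frame, of r] unfolding J_def by simp
  qed (use K(1) that in \<open>auto simp: J_def\<close>)
  moreover have "J 0 (s(i := (s i)(0 := 0)))"
    using s unfolding J_def by (auto simp: counter all_fit_def same_outside_def)
  ultimately have "run M h (For i e c) s (J K)"
    unfolding For_def using s(1)
    by (intro run_Seq[where P = "\<lambda>t. t = s(i := (s i)(0 := 0))"] run_Assign) auto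
  then show ?thesis by (rule run_conseq) (use frame in \<open>auto simp: J_def\<close>)
qed

text \<open>Only for programs without loops.\<close>

fun wp :: "nat \<Rightarrow> prog \<Rightarrow> (memory \<Rightarrow> bool) \<Rightarrow> memory \<Rightarrow> bool" where
  "wp h Skip Q s \<longleftrightarrow> Q s"
| "wp h (Assign a e f) Q s \<longleftrightarrow> fits h (val f s) \<and> Q (s(a := (s a)(val e s := val f s)))"
| "wp h (Seq c d) Q s \<longleftrightarrow> wp h c (wp h d Q) s"
| "wp h (IfLess e f c d) Q s \<longleftrightarrow> (if val e s < val f s then wp h c Q s else wp h d Q s)"
| "wp h (WhileLess e f c) Q s \<longleftrightarrow> False"

lemma run_wp: "all_fit h s \<Longrightarrow> wp h c Q s \<Longrightarrow> run M h c s Q"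
proof (induction c arbitrary: Q s)
  case (Seq c d)
  show ?case by (rule run_Seq[where P = "wp h d Q"]) (use Seq in auto)
qed (auto intro: run_Skip run_Assign run_IfLess)

lemma run_Seq_wp:
  assumes "all_fit h s" "wp h c (\<lambda>t. all_fit h t \<longrightarrow> run M h d t Q) s"
  shows "run M h (Seq c d) s Q"
  by (rule run_Seq[OF run_wp[OF assms]]) simp


subsection \<open>Port loads bound completion times from below\<close>

text \<open>Source \<open>i\<close> is port \<open>i\<close> and destination \<open>j\<close> is port \<open>N + j\<close>, where \<open>N\<close> is the number of ports
  on each side.\<close>

definition flow_ports :: "coflow_instance \<Rightarrow> nat \<Rightarrow> nat \<Rightarrow> nat set" where
  "flow_ports I i j = {i, ports I + j}"

definition port_flows :: "coflow_instance \<Rightarrow> nat \<Rightarrow> (nat \<times> nat) set" where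
  "port_flows I p = {(i, j). i < ports I \<and> j < ports I \<and> p \<in> flow_ports I i j}"

definition port_load :: "coflow_instance \<Rightarrow> nat \<Rightarrow> nat \<Rightarrow> nat" where
  "port_load I p k = (\<Sum>(i, j)\<in>port_flows I p. demand I i j k)"

lemma port_flows_subset: "port_flows I p \<subseteq> {..<ports I} \<times> {..<ports I}"
  unfolding port_flows_def by auto

lemma finite_port_flows [simp]: "finite (port_flows I p)"
  using port_flows_subset by (rule finite_subset) simp

lemma valid_instanceD:
  assumes "valid_instance I"
  shows "0 < cores I" "0 < ports I" "k < coflows I \<Longrightarrow> 0 \<le> release I k"
    "k < coflows I \<Longrightarrow> 0 < weight I k"
  using assms unfolding valid_instance_def by auto

lemma feasibleD:
  assumes "feasible I S" "i < ports I" "j < ports I" "k < coflows I"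
  shows "core S k < cores I" "0 \<le> rate S i j k t" "rate S i j k t \<le> 1"
    "0 \<le> T \<Longrightarrow> rate S i j k integrable_on {0..T}"
    "\<exists>T \<ge> 0. \<forall>T' \<ge> T. sent S i j k T' = real (demand I i j k)"
proof -
  have "\<forall>k < coflows I. core S k < cores I"
    using assms(1) unfolding feasible_def by (rule conjunct1)
  then show "core S k < cores I" using assms(4) by blast
  have flow: "(\<forall>t. 0 \<le> rate S i j k t \<and> rate S i j k t \<le> 1) \<and>
      (\<forall>t < real_of_rat (release I k). rate S i j k t = 0) \<and>
      (\<forall>T \<ge> 0. rate S i j k integrable_on {0..T}) \<and>
      (\<exists>T \<ge> 0. \<forall>T' \<ge> T. sent S i j k T' = real (demand I i j k))"
    using assms(1)[unfolded feasible_def, THEN conjunct2, THEN conjunct1] assms(2-4) by blast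
  show "0 \<le> rate S i j k t" "rate S i j k t \<le> 1" using flow by blast+
  show "0 \<le> T \<Longrightarrow> rate S i j k integrable_on {0..T}" using flow by blast
  show "\<exists>T \<ge> 0. \<forall>T' \<ge> T. sent S i j k T' = real (demand I i j k)" using flow by blast
qed

lemma feasible_port_exclusive:
  assumes "feasible I S" "(i, j) \<in> port_flows I p" "(i', j') \<in> port_flows I p"
    "k < coflows I" "k' < coflows I" "core S k = core S k'" "rate S i j k t > 0"
    "rate S i' j' k' t > 0"
  shows "(i, j, k) = (i', j', k')"
proof -
  have less: "i < ports I" "j < ports I" "i' < ports I" "j' < ports I"
    using assms(2,3) unfolding port_flows_def by auto
  then consider (source) "i' = i" | (destination) "j' = j"
    using assms(2,3) unfolding port_flows_def flow_ports_def by auto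
  then show ?thesis
  proof cases
    case source
    then have "j = j' \<and> k = k'"
      using assms(1)[unfolded feasible_def, THEN conjunct2, THEN conjunct2, THEN conjunct1]
        assms(4-8) less by blast
    with source show ?thesis by simp
  next
    case destination
    then have "i = i' \<and> k = k'"
      using assms(1)[unfolded feasible_def, THEN conjunct2, THEN conjunct2, THEN conjunct2]
        assms(4-8) less by blast
    with destination show ?thesis by simp
  qed
qed

lemma sent_mono:
  assumes "feasible I S" "i < ports I" "j < ports I" "k < coflows I" "0 \<le> x" "x \<le> y"
  shows "sent S i j k x \<le> sent S i j k y"
  unfolding sent_def
  by (rule integral_subset_le) (use assms feasibleD[OF assms(1-4)] in auto)

definition completion_candidates :: "coflow_instance \<Rightarrow> schedule \<Rightarrow> nat \<Rightarrow> nat \<Rightarrow> nat \<Rightarrow> real set" where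
  "completion_candidates I S i j k =
     {T. real_of_rat (release I k) \<le> T \<and> sent S i j k T = real (demand I i j k)}"

lemma flow_completion_eq: "flow_completion I S i j k = Inf (completion_candidates I S i j k)"
  unfolding flow_completion_def completion_candidates_def ..

lemma flow_completion_le:
  assumes "T \<in> completion_candidates I S i j k"
  shows "flow_completion I S i j k \<le> T"
  unfolding flow_completion_eq using assms
  by (intro cInf_lower bdd_belowI[of _ "real_of_rat (release I k)"])
    (auto simp: completion_candidates_def)

lemma completion_candidates_nonempty:
  assumes "feasible I S" "i < ports I" "j < ports I" "k < coflows I"
  shows "completion_candidates I S i j k \<noteq> {}"
proof -
  obtain T where "\<forall>T' \<ge> T. sent S i j k T' = real (demand I i j k)"
    using feasibleD(5)[OF assms] by blast
  then have "max T (real_of_rat (release I k)) \<in> completion_candidates I S i j k"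
    unfolding completion_candidates_def by simp
  then show ?thesis by blast
qed

lemma release_le_flow_completion:
  assumes "feasible I S" "i < ports I" "j < ports I" "k < coflows I"
  shows "real_of_rat (release I k) \<le> flow_completion I S i j k"
  unfolding flow_completion_eq
  by (rule cInf_greatest[OF completion_candidates_nonempty[OF assms]])
    (simp add: completion_candidates_def)

lemma sent_after_flow_completion:
  assumes valid: "valid_instance I"
    and flow: "feasible I S" "i < ports I" "j < ports I" "k < coflows I"
    and T: "flow_completion I S i j k < T"
  shows "sent S i j k T = real (demand I i j k)"
proof -
  obtain a where a: "real_of_rat (release I k) \<le> a" "sent S i j k a = real (demand I i j k)" "a < T"
    using cInf_lessD[OF completion_candidates_nonempty[OF flow] T[unfolded flow_completion_eq]]
    unfolding completion_candidates_def by blast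
  obtain b where b: "\<forall>T' \<ge> b. sent S i j k T' = real (demand I i j k)"
    using feasibleD(5)[OF flow] by blast
  have "0 \<le> real_of_rat (release I k)" using valid_instanceD(3)[OF valid flow(4)] by simp
  then have "0 \<le> a" using a(1) by linarith
  then have "sent S i j k a \<le> sent S i j k T" "sent S i j k T \<le> sent S i j k (max T b)"
    using a(3) by (intro sent_mono[OF flow]; simp)+
  then show ?thesis using a(2) b by simp
qed

lemma flow_completion_le_completion_time:
  assumes "i < ports I" "j < ports I"
  shows "flow_completion I S i j k \<le> completion_time I S k"
  unfolding completion_time_def
  by (rule Max_ge) (use assms in \<open>auto intro!: image_eqI[of _ _ "(i, j)"]\<close>)

lemma release_le_completion_time:
  assumes "valid_instance I" "feasible I S" "k < coflows I"
  shows "real_of_rat (release I k) \<le> completion_time I S k"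
  using release_le_flow_completion[OF assms(2) _ _ assms(3), of 0 0]
    flow_completion_le_completion_time[of 0 I 0 S k] valid_instanceD(2)[OF assms(1)] by linarith

lemma sum_rate_le_cores:
  assumes feas: "feasible I S" and X: "X \<subseteq> {..<ports I} \<times> {..<ports I} \<times> {..<coflows I}"
    and exclusive: "\<And>i j k i' j' k'. (i, j, k) \<in> X \<Longrightarrow> (i', j', k') \<in> X \<Longrightarrow> core S k = core S k' \<Longrightarrow>
      rate S i j k t > 0 \<Longrightarrow> rate S i' j' k' t > 0 \<Longrightarrow> (i, j, k) = (i', j', k')"
  shows "(\<Sum>(i, j, k)\<in>X. rate S i j k t) \<le> real (cores I)"
proof -
  define served where "served = {(i, j, k) \<in> X. rate S i j k t > 0}"
  have fin: "finite X" using X finite_subset by blast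
  have "(\<Sum>(i, j, k)\<in>X. rate S i j k t) = (\<Sum>(i, j, k)\<in>served. rate S i j k t)"
    using fin X feasibleD(2)[OF feas] unfolding served_def
    by (intro sum.mono_neutral_right) (auto simp: less_le)
  also have "\<dots> \<le> (\<Sum>_\<in>served. 1)"
    using X feasibleD(3)[OF feas] unfolding served_def by (intro sum_mono) auto
  also have "\<dots> = real (card served)" by simp
  also have "card served \<le> card {..<cores I}"
  proof (rule card_inj_on_le)
    show "inj_on (\<lambda>(i, j, k). core S k) served"
      using exclusive unfolding served_def inj_on_def by fastforce
    show "(\<lambda>(i, j, k). core S k) ` served \<subseteq> {..<cores I}"
      using X feas unfolding served_def feasible_def by auto
  qed simp
  finally show ?thesis by simp
qed

lemma sum_demand_le:
  assumes valid: "valid_instance I" and feas: "feasible I S"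
    and X: "X \<subseteq> {..<ports I} \<times> {..<ports I} \<times> {..<coflows I}"
    and exclusive: "\<And>i j k i' j' k' t. (i, j, k) \<in> X \<Longrightarrow> (i', j', k') \<in> X \<Longrightarrow> core S k = core S k' \<Longrightarrow>
      rate S i j k t > 0 \<Longrightarrow> rate S i' j' k' t > 0 \<Longrightarrow> (i, j, k) = (i', j', k')"
    and T: "0 \<le> T" "\<And>i j k. (i, j, k) \<in> X \<Longrightarrow> completion_time I S k < T"
  shows "(\<Sum>(i, j, k)\<in>X. real (demand I i j k)) \<le> real (cores I) * T"
proof -
  have fin: "finite X" using X finite_subset by blast
  have integrable: "(case x of (i, j, k) \<Rightarrow> rate S i j k) integrable_on {0..T}" if "x \<in> X" for x
    using that X feasibleD(4)[OF feas _ _ _ T(1)] by auto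
  have "real (demand I i j k) = integral {0..T} (rate S i j k)" if "(i, j, k) \<in> X" for i j k
  proof -
    have ijk: "i < ports I" "j < ports I" "k < coflows I" using that X by auto
    then have "flow_completion I S i j k < T"
      using flow_completion_le_completion_time[of i I j S k] T(2)[OF that] by linarith
    then show ?thesis using sent_after_flow_completion[OF valid feas ijk] unfolding sent_def by simp
  qed
  then have "(\<Sum>(i, j, k)\<in>X. real (demand I i j k)) = (\<Sum>(i, j, k)\<in>X. integral {0..T} (rate S i j k))"
    by (intro sum.cong) auto
  also have "\<dots> = integral {0..T} (\<lambda>t. \<Sum>(i, j, k)\<in>X. rate S i j k t)"
    using integral_sum[OF fin integrable] by (simp add: case_prod_unfold)
  also have "\<dots> \<le> integral {0..T} (\<lambda>t. real (cores I))"
  proof (rule integral_le)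
    show "(\<lambda>t. \<Sum>(i, j, k)\<in>X. rate S i j k t) integrable_on {0..T}"
      using integrable_sum[OF fin integrable] by (simp add: case_prod_unfold)
  qed (use sum_rate_le_cores[OF feas X exclusive] in auto)
  also have "\<dots> = real (cores I) * T" using T(1) by simp
  finally show ?thesis .
qed

lemma sum_port_load_le:
  assumes valid: "valid_instance I" and feas: "feasible I S" and U: "U \<subseteq> {..<coflows I}"
    and T: "0 \<le> T" "\<And>k. k \<in> U \<Longrightarrow> completion_time I S k \<le> T"
  shows "(\<Sum>k\<in>U. real (port_load I p k)) \<le> real (cores I) * T"
proof -
  let ?X = "{(i, j, k). (i, j) \<in> port_flows I p \<and> k \<in> U}"
  have reindex: "?X = (\<lambda>(k, i, j). (i, j, k)) ` (U \<times> port_flows I p)" by force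
  have "(\<Sum>k\<in>U. real (port_load I p k)) = (\<Sum>(i, j, k)\<in>?X. real (demand I i j k))"
    unfolding reindex
    by (subst sum.reindex) (auto simp: inj_on_def port_load_def sum.cartesian_product split_beta)
  moreover have "(\<Sum>(i, j, k)\<in>?X. real (demand I i j k)) \<le> real (cores I) * T'" if "T < T'" for T'
  proof (rule sum_demand_le[OF valid feas])
    show "?X \<subseteq> {..<ports I} \<times> {..<ports I} \<times> {..<coflows I}"
      using U port_flows_subset[of I p] by auto
    show "(i, j, k) = (i', j', k')" if "(i, j, k) \<in> ?X" "(i', j', k') \<in> ?X" "core S k = core S k'"
      "rate S i j k t > 0" "rate S i' j' k' t > 0" for i j k i' j' k' t
      using feasible_port_exclusive[OF feas _ _ _ _ that(3-5)] that(1,2) U by auto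
    show "completion_time I S k < T'" if "(i, j, k) \<in> ?X" for i j k
      using that T(2)[of k] \<open>T < T'\<close> by simp
  qed (use T(1) that in simp)
  ultimately have "(\<Sum>k\<in>U. real (port_load I p k)) \<le> T' * real (cores I)" if "T < T'" for T'
    using that by (simp only: mult.commute)
  moreover have cores: "0 < real (cores I)" using valid_instanceD(1)[OF valid] by simp
  ultimately have "(\<Sum>k\<in>U. real (port_load I p k)) / real (cores I) \<le> T"
    by - (rule dense_ge, simp only: pos_divide_le_eq)
  then show ?thesis using cores by (simp only: pos_divide_le_eq mult.commute)
qed

text \<open>Every pair of indices is counted in at least one of its two orders.\<close>

lemma square_sum_le_weighted_sum:
  fixes a C :: "'a \<Rightarrow> real"
  assumes fin: "finite U" and a: "\<And>k. k \<in> U \<Longrightarrow> 0 \<le> a k"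
    and prefix: "\<And>k. k \<in> U \<Longrightarrow> (\<Sum>l | l \<in> U \<and> C l \<le> C k. a l) \<le> m * C k"
  shows "(\<Sum>k\<in>U. a k)\<^sup>2 \<le> (\<Sum>k\<in>U. a k * (2 * m * C k))"
proof -
  let ?up = "\<lambda>k l. if C l \<le> C k then a k * a l else 0"
  have "(\<Sum>k\<in>U. a k)\<^sup>2 = (\<Sum>k\<in>U. \<Sum>l\<in>U. a k * a l)"
    by (simp add: power2_eq_square sum_product)
  also have "\<dots> \<le> (\<Sum>k\<in>U. \<Sum>l\<in>U. ?up k l + ?up l k)" using a by (intro sum_mono) auto
  also have "\<dots> = (\<Sum>k\<in>U. \<Sum>l\<in>U. ?up k l) + (\<Sum>k\<in>U. \<Sum>l\<in>U. ?up l k)" by (simp add: sum.distrib)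
  also have "(\<Sum>k\<in>U. \<Sum>l\<in>U. ?up l k) = (\<Sum>k\<in>U. \<Sum>l\<in>U. ?up k l)" by (rule sum.swap)
  also have "(\<Sum>k\<in>U. \<Sum>l\<in>U. ?up k l) = (\<Sum>k\<in>U. a k * (\<Sum>l | l \<in> U \<and> C l \<le> C k. a l))"
    using fin by (simp add: sum_distrib_left sum.inter_filter if_distrib cong: if_cong)
  also have "\<dots> \<le> (\<Sum>k\<in>U. a k * (m * C k))" by (intro sum_mono mult_left_mono prefix a)
  finally show ?thesis by (simp add: sum_distrib_left algebra_simps)
qed


subsection \<open>Ordering by local ratios\<close>

locale weighted_loads =
  fixes n q :: nat and L :: "nat \<Rightarrow> nat \<Rightarrow> nat" and w :: "nat \<Rightarrow> real"
  assumes q_pos: "0 < q" and w_nonneg: "k < n \<Longrightarrow> 0 \<le> w k"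
begin

definition peak :: "nat set \<Rightarrow> nat" where
  "peak U = Max ((\<lambda>p. \<Sum>k\<in>U. L p k) ` {..<q})"

lemma load_le_peak: "p < q \<Longrightarrow> (\<Sum>k\<in>U. L p k) \<le> peak U"
  unfolding peak_def by (rule Max_ge) auto

lemma peak_eqI:
  assumes "p < q" "\<And>r. r < q \<Longrightarrow> (\<Sum>k\<in>U. L r k) \<le> (\<Sum>k\<in>U. L p k)"
  shows "(\<Sum>k\<in>U. L p k) = peak U"
  unfolding peak_def using assms by (intro Max_eqI[symmetric]) auto

lemma peak_mono:
  assumes "finite V" "U \<subseteq> V"
  shows "peak U \<le> peak V"
  unfolding peak_def[of U]
proof (rule Max.boundedI)
  fix a assume "a \<in> (\<lambda>p. \<Sum>k\<in>U. L p k) ` {..<q}"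
  then obtain p where p: "p < q" "a = (\<Sum>k\<in>U. L p k)" by auto
  have "a \<le> (\<Sum>k\<in>V. L p k)" unfolding p(2) using assms by (intro sum_mono2) auto
  then show "a \<le> peak V" using load_le_peak[OF p(1), of V] by linarith
qed (use q_pos in \<open>auto simp: lessThan_empty_iff\<close>)

definition load_inequalities :: "(nat \<Rightarrow> real) \<Rightarrow> bool" where
  "load_inequalities c \<longleftrightarrow> (\<forall>k<n. 0 \<le> c k) \<and> (\<forall>p<q. \<forall>U\<subseteq>{..<n}.
     (\<Sum>k\<in>U. real (L p k))\<^sup>2 \<le> (\<Sum>k\<in>U. real (L p k) * c k))"

text \<open>The residual weights \<open>v\<close> still count with the costs \<open>c\<close>; the weight subtracted so far is
  bounded by the current peak.\<close>

definition charge :: "(nat \<Rightarrow> real) \<Rightarrow> (nat \<Rightarrow> real) \<Rightarrow> nat set \<Rightarrow> real" where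
  "charge v c U = (\<Sum>k\<in>U. v k * c k + (w k - v k) * real (peak U))"

lemma charge_reduce_le:
  assumes ineqs: "load_inequalities c" and U: "U \<subseteq> {..<n}" and p: "p < q" "(\<Sum>k\<in>U. L p k) = peak U"
    and \<theta>: "0 \<le> \<theta>" and v': "\<And>k. k \<in> U \<Longrightarrow> v' k = v k - \<theta> * real (L p k)"
  shows "charge v' c U \<le> charge v c U"
proof -
  let ?V = "real (peak U)"
  have V: "(\<Sum>k\<in>U. real (L p k)) = ?V" using p(2) by (metis of_nat_sum)
  have "charge v c U =
      (\<Sum>k\<in>U. v' k * c k + (w k - v' k) * ?V + \<theta> * (real (L p k) * c k) - \<theta> * ?V * real (L p k))"
    unfolding charge_def by (rule sum.cong) (simp_all add: v' algebra_simps)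
  also have "\<dots> = charge v' c U + \<theta> * (\<Sum>k\<in>U. real (L p k) * c k) - \<theta> * ?V * ?V"
    unfolding charge_def by (simp add: sum.distrib sum_subtractf sum_distrib_left[symmetric] V)
  finally have "charge v c U = charge v' c U + \<theta> * ((\<Sum>k\<in>U. real (L p k) * c k) - ?V\<^sup>2)"
    by (simp add: algebra_simps power2_eq_square)
  moreover have "?V\<^sup>2 \<le> (\<Sum>k\<in>U. real (L p k) * c k)"
    using ineqs U p(1) unfolding load_inequalities_def V[symmetric] by blast
  ultimately show ?thesis using \<theta> by simp
qed

lemma charge_remove_le:
  assumes ineqs: "load_inequalities c" and U: "U \<subseteq> {..<n}" "k \<in> U"
    and v: "\<And>l. l \<in> U \<Longrightarrow> 0 \<le> v l \<and> v l \<le> w l" and tight: "v k = 0 \<or> peak U = 0"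
  shows "charge v c (U - {k}) + w k * real (peak U) \<le> charge v c U"
proof -
  have fin: "finite U" using U(1) finite_subset by blast
  have "0 \<le> c k" using ineqs U unfolding load_inequalities_def by auto
  then have "0 \<le> v k * c k" using v[OF U(2)] by simp
  moreover have "w k * real (peak U) = (w k - v k) * real (peak U)" using tight by auto
  moreover have "charge v c (U - {k}) \<le> (\<Sum>l\<in>U - {k}. v l * c l + (w l - v l) * real (peak U))"
    unfolding charge_def using v peak_mono[OF fin, of "U - {k}"]
    by (intro sum_mono add_left_mono mult_left_mono) auto
  moreover have "charge v c U = v k * c k + (w k - v k) * real (peak U) +
      (\<Sum>l\<in>U - {k}. v l * c l + (w l - v l) * real (peak U))"
    unfolding charge_def by (rule sum.remove[OF fin U(2)])
  ultimately show ?thesis by linarith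
qed

text \<open>The positions from \<open>m\<close> on of the order \<open>\<pi>\<close> are final.\<close>

definition local_ratio_inv :: "nat \<Rightarrow> (nat \<Rightarrow> nat) \<Rightarrow> (nat \<Rightarrow> real) \<Rightarrow> bool" where
  "local_ratio_inv m \<pi> v \<longleftrightarrow> bij_betw \<pi> {..<n} {..<n} \<and>
     (\<forall>k\<in>\<pi> ` {..<m}. 0 \<le> v k \<and> v k \<le> w k) \<and>
     (\<forall>c. load_inequalities c \<longrightarrow>
        charge v c (\<pi> ` {..<m}) + (\<Sum>x=m..<n. w (\<pi> x) * real (peak (\<pi> ` {..<Suc x})))
        \<le> (\<Sum>k<n. w k * c k))"

lemma local_ratio_invD:
  assumes "local_ratio_inv m \<pi> v"
  shows "bij_betw \<pi> {..<n} {..<n}" "x < m \<Longrightarrow> 0 \<le> v (\<pi> x)" "x < m \<Longrightarrow> v (\<pi> x) \<le> w (\<pi> x)"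
  using assms unfolding local_ratio_inv_def by auto

lemma local_ratio_inv_init: "local_ratio_inv n id w"
  unfolding local_ratio_inv_def charge_def using w_nonneg by auto

lemma local_ratio_inv_step:
  assumes inv: "local_ratio_inv (Suc m) \<pi> v" and m: "m < n"
    and p: "p < q" "(\<Sum>k\<in>\<pi> ` {..<Suc m}. L p k) = peak (\<pi> ` {..<Suc m})"
    and \<theta>: "0 \<le> \<theta>" and v': "\<And>k. k \<in> \<pi> ` {..<Suc m} \<Longrightarrow> v' k = v k - \<theta> * real (L p k)"
    and nonneg: "\<And>k. k \<in> \<pi> ` {..<Suc m} \<Longrightarrow> 0 \<le> v' k"
    and tight: "v' (\<pi> m) = 0 \<or> peak (\<pi> ` {..<Suc m}) = 0"
  shows "local_ratio_inv m \<pi> v'"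
proof -
  let ?U = "\<pi> ` {..<Suc m}"
  have bij: "bij_betw \<pi> {..<n} {..<n}" using inv by (rule local_ratio_invD)
  then have U: "?U \<subseteq> {..<n}" using m unfolding bij_betw_def by auto
  have "inj_on \<pi> {..<Suc m}" using bij m unfolding bij_betw_def by (auto intro: inj_on_subset)
  then have remove: "\<pi> ` {..<m} = ?U - {\<pi> m}"
    by (simp add: lessThan_Suc inj_on_insert)
  have bounds: "0 \<le> v' k \<and> v' k \<le> w k" if "k \<in> ?U" for k
  proof -
    have "v k \<le> w k" using inv that unfolding local_ratio_inv_def by blast
    moreover have "0 \<le> \<theta> * real (L p k)" using \<theta> by simp
    ultimately show ?thesis using v'[OF that] nonneg[OF that] by linarith
  qed
  have "charge v' c (\<pi> ` {..<m}) + (\<Sum>x=m..<n. w (\<pi> x) * real (peak (\<pi> ` {..<Suc x})))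
      \<le> (\<Sum>k<n. w k * c k)" if ineqs: "load_inequalities c" for c
  proof -
    have "charge v' c (\<pi> ` {..<m}) + w (\<pi> m) * real (peak ?U) \<le> charge v' c ?U"
      unfolding remove using ineqs U bounds tight by (intro charge_remove_le) auto
    also have "\<dots> \<le> charge v c ?U" by (rule charge_reduce_le[OF ineqs U p \<theta> v'])
    also have "\<dots> + (\<Sum>x=Suc m..<n. w (\<pi> x) * real (peak (\<pi> ` {..<Suc x}))) \<le> (\<Sum>k<n. w k * c k)"
      using inv ineqs unfolding local_ratio_inv_def by blast
    finally show ?thesis using m by (simp add: sum.atLeast_Suc_lessThan)
  qed
  then show ?thesis unfolding local_ratio_inv_def using bij bounds by auto
qed

lemma local_ratio_inv_transpose:
  assumes inv: "local_ratio_inv (Suc m) \<pi> v" and m: "b \<le> m" "m < n"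
  shows "local_ratio_inv (Suc m) (\<pi> \<circ> Transposition.transpose b m) v"
proof -
  let ?\<rho> = "\<pi> \<circ> Transposition.transpose b m"
  have prefix: "?\<rho> ` {..<x} = \<pi> ` {..<x}" if "m < x" for x
    unfolding image_comp[symmetric] using m that by (subst transpose_image_eq) auto
  have "bij_betw (Transposition.transpose b m) {..<n} {..<n}" using m by simp
  then have "bij_betw ?\<rho> {..<n} {..<n}"
    using local_ratio_invD(1)[OF inv] by (rule bij_betw_trans)
  moreover have "(\<Sum>x=Suc m..<n. w (?\<rho> x) * real (peak (?\<rho> ` {..<Suc x})))
      = (\<Sum>x=Suc m..<n. w (\<pi> x) * real (peak (\<pi> ` {..<Suc x})))"
  proof (rule sum.cong[OF refl])
    fix x assume "x \<in> {Suc m..<n}"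
    then have "m < Suc x" "Transposition.transpose b m x = x" using m by auto
    then show "w (?\<rho> x) * real (peak (?\<rho> ` {..<Suc x})) = w (\<pi> x) * real (peak (\<pi> ` {..<Suc x}))"
      by (simp only: prefix comp_apply)
  qed
  ultimately show ?thesis
    using inv unfolding local_ratio_inv_def by (simp only: prefix[OF lessI]) blast
qed

lemma local_ratio_inv_final:
  assumes "local_ratio_inv 0 \<pi> v" "load_inequalities c"
  shows "(\<Sum>x<n. w (\<pi> x) * real (peak (\<pi> ` {..<Suc x}))) \<le> (\<Sum>k<n. w k * c k)"
  using assms unfolding local_ratio_inv_def charge_def by (auto simp: atLeast0LessThan)

end

text \<open>The ratio \<open>u b / a b\<close> is minimal among the first \<open>y\<close>; written without division, so that
  ratios with denominator 0 count as infinite unless the numerator is 0.\<close>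

definition min_ratio :: "(nat \<Rightarrow> rat) \<Rightarrow> (nat \<Rightarrow> nat) \<Rightarrow> nat \<Rightarrow> nat \<Rightarrow> bool" where
  "min_ratio u a b y \<longleftrightarrow> (\<forall>x<y. u b * of_nat (a x) \<le> u x * of_nat (a b))"

lemma min_ratio_0 [simp]: "min_ratio u a b 0"
  unfolding min_ratio_def by simp

lemma min_ratio_Suc_keep:
  "min_ratio u a b y \<Longrightarrow> u b * of_nat (a y) \<le> u y * of_nat (a b) \<Longrightarrow> min_ratio u a b (Suc y)"
  unfolding min_ratio_def by (auto simp: less_Suc_eq)

lemma min_ratio_Suc_replace:
  assumes min: "min_ratio u a b y" and less: "u y * of_nat (a b) < u b * of_nat (a y)"
    and nonneg: "0 \<le> u b" "\<And>x. x \<le> y \<Longrightarrow> 0 \<le> u x"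
  shows "min_ratio u a y (Suc y)"
proof -
  have "u y * of_nat (a x) \<le> u x * of_nat (a y)" if x: "x < y" for x
  proof (cases "a b = 0")
    case True
    then have "0 < u b" using less nonneg(1) by (auto simp: zero_less_mult_iff)
    moreover have "u b * of_nat (a x) \<le> 0" using min x True unfolding min_ratio_def by auto
    ultimately have "a x = 0" by (simp add: mult_le_0_iff)
    then show ?thesis using nonneg(2)[of x] x by simp
  next
    case False
    have "u y * of_nat (a x) * of_nat (a b) = u y * of_nat (a b) * of_nat (a x)" by simp
    also have "\<dots> \<le> u b * of_nat (a y) * of_nat (a x)"
      using less by (intro mult_right_mono) auto
    also have "\<dots> = u b * of_nat (a x) * of_nat (a y)" by simp
    also have "\<dots> \<le> u x * of_nat (a b) * of_nat (a y)"
      using min x unfolding min_ratio_def by (intro mult_right_mono) auto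
    also have "\<dots> = u x * of_nat (a y) * of_nat (a b)" by simp
    finally show ?thesis using False by (simp add: mult_le_cancel_right)
  qed
  then show ?thesis unfolding min_ratio_def by (auto simp: less_Suc_eq)
qed

lemma min_ratio_residual:
  fixes u :: "nat \<Rightarrow> rat" and a :: "nat \<Rightarrow> nat"
  assumes min: "min_ratio u a b y" and b: "b < y" and nonneg: "\<And>x. x < y \<Longrightarrow> 0 \<le> u x"
  defines "\<theta> \<equiv> u b / of_nat (a b)"
  shows "0 \<le> \<theta>" "\<theta> \<le> u b" "\<And>x. x < y \<Longrightarrow> 0 \<le> u x - \<theta> * of_nat (a x)"
    "u b - \<theta> * of_nat (a b) = 0 \<or> (\<forall>x<y. a x = 0)"
proof -
  show "0 \<le> \<theta>" unfolding \<theta>_def using nonneg[OF b] by simp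
  show "\<theta> \<le> u b"
  proof (cases "a b = 0")
    case False
    then have "1 \<le> rat_of_nat (a b)" by simp
    then show ?thesis unfolding \<theta>_def using nonneg[OF b]
      by (simp add: divide_le_eq mult_le_cancel_left1)
  qed (use nonneg[OF b] in \<open>simp add: \<theta>_def\<close>)
  show "0 \<le> u x - \<theta> * of_nat (a x)" if "x < y" for x
  proof (cases "a b = 0")
    case False
    then show ?thesis using min that unfolding min_ratio_def \<theta>_def by (simp add: field_simps)
  qed (use nonneg[OF that] in \<open>simp add: \<theta>_def\<close>)
  show "u b - \<theta> * of_nat (a b) = 0 \<or> (\<forall>x<y. a x = 0)"
  proof (cases "a b = 0")
    case True
    then have "u b * of_nat (a x) \<le> 0" if "x < y" for x
      using min that unfolding min_ratio_def by fastforce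
    then have "u b = 0 \<or> a x = 0" if "x < y" for x
      using that nonneg[OF b] by (force simp: mult_le_0_iff)
    then show ?thesis unfolding \<theta>_def True by auto
  qed (simp add: \<theta>_def)
qed


lemma residual_common_denominator:
  fixes u :: "'a \<Rightarrow> rat" and a :: "'a \<Rightarrow> nat"
  assumes D: "0 < D" "D \<le> 2 ^ h" "\<And>k. k \<in> A \<Longrightarrow> u k * of_int D \<in> \<int>"
    and b: "b \<in> A" "a b \<le> 2 ^ j"
  obtains D' :: int where "0 < D'" "D' \<le> 2 ^ (h + j)" "u b / of_nat (a b) * of_int D' \<in> \<int>"
    "\<And>k. k \<in> A \<Longrightarrow> u k * of_int D' \<in> \<int>"
    "\<And>k. k \<in> A \<Longrightarrow> (u k - u b / of_nat (a b) * of_nat (a k)) * of_int D' \<in> \<int>"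
proof -
  define c where "c = (if a b = 0 then 1 else a b)"
  let ?\<theta> = "u b / of_nat (a b)" and ?D = "D * int c"
  have c_bounds: "0 < c" "c \<le> 2 ^ j" using b(2) unfolding c_def by auto
  then have "int c \<le> 2 ^ j" by simp
  then have "?D \<le> 2 ^ h * 2 ^ j" using D(1,2) by (intro mult_mono) auto
  then have denominator: "?D \<le> 2 ^ (h + j)" by (simp add: power_add)
  have "?\<theta> * of_int ?D = (if a b = 0 then 0 else u b * of_int D)"
    unfolding c_def by simp
  then have ratio: "?\<theta> * of_int ?D \<in> \<int>" using D(3)[OF b(1)] by simp
  have old: "u k * of_int ?D \<in> \<int>" if "k \<in> A" for k
  proof -
    have "u k * of_int ?D = u k * of_int D * of_nat c" by simp
    then show ?thesis using D(3)[OF that] by (simp only: Ints_mult Ints_of_nat)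
  qed
  have "(u k - ?\<theta> * of_nat (a k)) * of_int ?D \<in> \<int>" if "k \<in> A" for k
  proof -
    have "(u k - ?\<theta> * of_nat (a k)) * of_int ?D = u k * of_int ?D - ?\<theta> * of_int ?D * of_nat (a k)"
      by (simp only: left_diff_distrib mult.assoc mult.commute[of "of_nat (a k)"])
    then show ?thesis using ratio old[OF that] by (simp only: Ints_diff Ints_mult Ints_of_nat)
  qed
  moreover have "0 < ?D" using D(1) c_bounds(1) by simp
  ultimately show thesis using that[of ?D] denominator ratio old by blast
qed


subsection \<open>Preemptive list scheduling\<close>

lemma has_integral_half_open_interval:
  fixes a b T :: real
  assumes "0 \<le> a" "a \<le> b" "0 \<le> T"
  shows "((\<lambda>t. of_bool (a \<le> t \<and> t < b)) has_integral (min T b - min T a)) {0..T}"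
proof -
  have "{a..b} \<inter> {0..T} = {a..min b T}" using assms by auto
  then have "((\<lambda>_. 1::real) has_integral (min T b - min T a)) ({a..b} \<inter> {0..T})"
    using has_integral_const_real[of "1::real" a "min b T"] assms
    by (cases "a \<le> T") (auto simp: min_def split: if_splits)
  then have "((\<lambda>t. if t \<in> {a..b} then 1 else 0) has_integral (min T b - min T a)) {0..T}"
    unfolding has_integral_restrict_Int .
  then show ?thesis
    by (rule has_integral_spike_finite[of "{b}", rotated 2]) auto
qed

text \<open>Flows are numbered by decreasing priority; flow \<open>z\<close> has size \<open>d z\<close>, release time \<open>r z\<close> and
  occupies the ports \<open>P z\<close>. The set of active flows is recomputed greedily whenever an active flow
  is finished or a flow is released.\<close>

locale list_scheduling =
  fixes F :: nat and P :: "nat \<Rightarrow> 'p set" and d :: "nat \<Rightarrow> nat" and r :: "nat \<Rightarrow> rat"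
  assumes finite_P: "z < F \<Longrightarrow> finite (P z)" and P_nonempty: "z < F \<Longrightarrow> P z \<noteq> {}"
    and r_nonneg: "z < F \<Longrightarrow> 0 \<le> r z"
begin

primrec chosen :: "(nat \<Rightarrow> bool) \<Rightarrow> nat \<Rightarrow> nat set" where
  "chosen ok 0 = {}"
| "chosen ok (Suc z) = (if ok z \<and> (\<forall>y\<in>chosen ok z. P y \<inter> P z = {})
     then insert z (chosen ok z) else chosen ok z)"

lemma chosenD: "z \<in> chosen ok m \<Longrightarrow> z < m \<and> ok z"
  by (induction m) (auto split: if_splits intro: less_SucI)

lemma finite_chosen [simp]: "finite (chosen ok m)"
  by (induction m) auto

lemma chosen_mono: "m \<le> m' \<Longrightarrow> chosen ok m \<subseteq> chosen ok m'"
  by (induction m' rule: dec_induct) auto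

lemma chosen_stable:
  assumes "y < m" "m \<le> m'"
  shows "y \<in> chosen ok m' \<longleftrightarrow> y \<in> chosen ok m"
  using assms(2) by (induction m' rule: dec_induct) (use assms(1) in auto)

lemma chosen_no_conflict:
  "y \<in> chosen ok m \<Longrightarrow> z \<in> chosen ok m \<Longrightarrow> P y \<inter> P z \<noteq> {} \<Longrightarrow> y = z"
  by (induction m) (auto split: if_splits)

lemma chosen_blocked:
  assumes "z < m" "ok z" "P z \<noteq> {}"
  shows "\<exists>y\<in>chosen ok m. y \<le> z \<and> P y \<inter> P z \<noteq> {}"
proof (cases "z \<in> chosen ok (Suc z)")
  case True
  then show ?thesis using chosen_mono[of "Suc z" m ok] assms by auto
next
  case False
  then obtain y where y: "y \<in> chosen ok z" "P y \<inter> P z \<noteq> {}"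
    using assms(2) by (auto split: if_splits)
  moreover have "y \<in> chosen ok m" using y(1) chosen_mono[of z m ok] assms(1) by auto
  ultimately show ?thesis using chosenD[OF y(1)] by (intro bexI[of _ y]) auto
qed

definition ready :: "rat \<Rightarrow> (nat \<Rightarrow> rat) \<Rightarrow> nat \<Rightarrow> bool" where
  "ready T l z \<longleftrightarrow> 0 < l z \<and> r z \<le> T"

definition gaps :: "rat \<Rightarrow> (nat \<Rightarrow> rat) \<Rightarrow> nat \<Rightarrow> rat set" where
  "gaps T l m = l ` chosen (ready T l) m \<union> (\<lambda>z. r z - T) ` {z. z < m \<and> 0 < l z \<and> T < r z}"

definition gap :: "rat \<Rightarrow> (nat \<Rightarrow> rat) \<Rightarrow> nat \<Rightarrow> rat" where
  "gap T l m = (if gaps T l m = {} then 0 else Min (gaps T l m))"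

lemma finite_gaps [simp]: "finite (gaps T l m)"
  unfolding gaps_def by simp

lemma gap_0 [simp]: "gap T l 0 = 0"
  unfolding gap_def gaps_def by simp

lemma gaps_pos: "x \<in> gaps T l m \<Longrightarrow> 0 < x"
  unfolding gaps_def by (auto simp: ready_def dest: chosenD)

lemma gap_in_gaps: "gaps T l m \<noteq> {} \<Longrightarrow> gap T l m \<in> gaps T l m"
  unfolding gap_def by simp

lemma gap_le: "x \<in> gaps T l m \<Longrightarrow> gap T l m \<le> x"
  unfolding gap_def by auto

lemma gap_nonneg: "0 \<le> gap T l m"
  using gap_in_gaps[of T l m] gaps_pos[of _ T l m] unfolding gap_def by (auto simp: less_imp_le)

lemma gap_Suc_insert:
  assumes "gaps T l (Suc m) = insert v (gaps T l m)"
  shows "gap T l (Suc m) = (if 0 < gap T l m \<and> gap T l m \<le> v then gap T l m else v)"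
proof (cases "gaps T l m = {}")
  case True
  then show ?thesis using assms unfolding gap_def by simp
next
  case False
  then have "0 < gap T l m" using gaps_pos gap_in_gaps by blast
  moreover have "gap T l (Suc m) = min v (gap T l m)"
    using assms False unfolding gap_def by simp
  ultimately show ?thesis by auto
qed

lemma gap_Suc_unreleased:
  assumes "0 < l m" "T < r m"
  shows "gap T l (Suc m) = (if 0 < gap T l m \<and> gap T l m \<le> r m - T then gap T l m else r m - T)"
  by (rule gap_Suc_insert) (use assms in \<open>auto simp: gaps_def ready_def less_Suc_eq\<close>)

lemma gap_Suc_chosen:
  assumes "0 < l m" "r m \<le> T" "\<forall>y\<in>chosen (ready T l) m. P y \<inter> P m = {}"
  shows "gap T l (Suc m) = (if 0 < gap T l m \<and> gap T l m \<le> l m then gap T l m else l m)"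
proof (rule gap_Suc_insert)
  have "{z. z < Suc m \<and> 0 < l z \<and> T < r z} = {z. z < m \<and> 0 < l z \<and> T < r z}"
    using assms(2) by (auto simp: less_Suc_eq)
  then show "gaps T l (Suc m) = insert (l m) (gaps T l m)"
    using assms unfolding gaps_def by (simp add: ready_def)
qed

lemma gap_Suc_skip:
  assumes "\<not> 0 < l m \<or> r m \<le> T \<and> \<not> (\<forall>y\<in>chosen (ready T l) m. P y \<inter> P m = {})"
  shows "gap T l (Suc m) = gap T l m"
proof -
  have "{z. z < Suc m \<and> 0 < l z \<and> T < r z} = {z. z < m \<and> 0 < l z \<and> T < r z}"
    using assms by (auto simp: less_Suc_eq)
  moreover have "chosen (ready T l) (Suc m) = chosen (ready T l) m"
    using assms by (auto simp: ready_def)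
  ultimately have "gaps T l (Suc m) = gaps T l m" unfolding gaps_def by (simp only:)
  then show ?thesis unfolding gap_def by (simp only:)
qed

primrec state :: "nat \<Rightarrow> rat \<times> (nat \<Rightarrow> rat)" where
  "state 0 = (0, \<lambda>z. of_nat (d z))"
| "state (Suc e) = (let T = fst (state e); l = snd (state e); g = gap T l F in
     (T + g, \<lambda>z. if z \<in> chosen (ready T l) F then l z - g else l z))"

definition time :: "nat \<Rightarrow> rat" where "time e = fst (state e)"
definition left :: "nat \<Rightarrow> nat \<Rightarrow> rat" where "left e = snd (state e)"
definition active :: "nat \<Rightarrow> nat set" where "active e = chosen (ready (time e) (left e)) F"
definition len :: "nat \<Rightarrow> rat" where "len e = gap (time e) (left e) F"

lemma time_0 [simp]: "time 0 = 0" and left_0 [simp]: "left 0 z = of_nat (d z)"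
  by (simp_all add: time_def left_def)

lemma time_Suc: "time (Suc e) = time e + len e"
  by (simp add: time_def left_def len_def Let_def)

lemma left_Suc: "left (Suc e) z = (if z \<in> active e then left e z - len e else left e z)"
  by (simp add: time_def left_def len_def active_def Let_def)

lemma len_nonneg: "0 \<le> len e"
  unfolding len_def by (rule gap_nonneg)

lemma time_mono: "e \<le> e' \<Longrightarrow> time e \<le> time e'"
  by (induction e' rule: dec_induct)
    (auto simp: time_Suc intro: order_trans add_increasing2 len_nonneg)

lemma time_nonneg: "0 \<le> time e"
  using time_mono[of 0 e] by simp

lemma activeD:
  assumes "z \<in> active e"
  shows "z < F" "0 < left e z" "r z \<le> time e" "len e \<le> left e z"
proof -
  show "z < F" "0 < left e z" "r z \<le> time e"
    using assms chosenD unfolding active_def ready_def by blast+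
  show "len e \<le> left e z"
    unfolding len_def by (rule gap_le) (use assms in \<open>auto simp: gaps_def active_def\<close>)
qed

lemma active_no_conflict: "y \<in> active e \<Longrightarrow> z \<in> active e \<Longrightarrow> P y \<inter> P z \<noteq> {} \<Longrightarrow> y = z"
  unfolding active_def by (rule chosen_no_conflict)

lemma active_blocked:
  assumes "z < F" "0 < left e z" "r z \<le> time e"
  obtains y p where "y \<in> active e" "y \<le> z" "p \<in> P y" "p \<in> P z"
  using chosen_blocked[of z F "ready (time e) (left e)"] P_nonempty[OF assms(1)] assms
  unfolding active_def ready_def by blast

lemma time_Suc_le_release:
  assumes "z < F" "0 < left e z" "time e < r z"
  shows "time (Suc e) \<le> r z"
proof -
  have "len e \<le> r z - time e"
    unfolding len_def by (rule gap_le) (use assms in \<open>auto simp: gaps_def\<close>)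
  then show ?thesis by (simp add: time_Suc)
qed

lemma left_nonneg: "0 \<le> left e z"
  by (induction e) (auto simp: left_Suc activeD)

lemma left_Suc_le: "left (Suc e) z \<le> left e z"
  by (simp add: left_Suc len_nonneg)

lemma left_antimono: "e \<le> e' \<Longrightarrow> left e' z \<le> left e z"
  by (induction e' rule: dec_induct) (auto intro: order_trans left_Suc_le)

lemma left_le: "left e z \<le> of_nat (d z)"
  using left_antimono[of 0 e z] by simp

lemma left_eq: "left e z = of_nat (d z) - (\<Sum>e' | e' < e \<and> z \<in> active e'. len e')"
proof (induction e)
  case (Suc e)
  have "{e'. e' < Suc e \<and> z \<in> active e'} =
      (if z \<in> active e then insert e {e'. e' < e \<and> z \<in> active e'}
       else {e'. e' < e \<and> z \<in> active e'})"
    by (auto simp: less_Suc_eq)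
  then show ?case using Suc by (simp add: left_Suc)
qed simp

lemma gaps_nonempty:
  assumes "z < F" "0 < left e z"
  shows "gaps (time e) (left e) F \<noteq> {}"
proof (cases "time e < r z")
  case True
  then show ?thesis using assms unfolding gaps_def by auto
next
  case False
  then have "r z \<le> time e" by simp
  from assms this obtain y p where "y \<in> active e" by (rule active_blocked)
  then show ?thesis unfolding gaps_def active_def by blast
qed

definition pending :: "nat \<Rightarrow> nat set" where "pending e = {z. z < F \<and> 0 < left e z}"

definition unreleased :: "nat \<Rightarrow> nat set" where
  "unreleased e = {z. z < F \<and> 0 < left e z \<and> time e < r z}"

lemma pending_Suc_subset: "pending (Suc e) \<subseteq> pending e"
  unfolding pending_def using left_Suc_le by (auto intro: less_le_trans)

lemma unreleased_Suc_subset: "unreleased (Suc e) \<subseteq> unreleased e"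
  unfolding unreleased_def using left_Suc_le time_mono[of e "Suc e"]
  by (auto intro: less_le_trans le_less_trans)

lemma card_pending_unreleased_decreases:
  assumes "pending e \<noteq> {}"
  shows "card (pending (Suc e)) + card (unreleased (Suc e))
    < card (pending e) + card (unreleased e)"
proof -
  have fin: "finite (pending e)" "finite (unreleased e)" by (auto simp: pending_def unreleased_def)
  have card_le: "card (pending (Suc e)) \<le> card (pending e)"
    "card (unreleased (Suc e)) \<le> card (unreleased e)"
    using card_mono[OF fin(1) pending_Suc_subset] card_mono[OF fin(2) unreleased_Suc_subset] .
  have "len e \<in> gaps (time e) (left e) F"
    using assms gaps_nonempty unfolding len_def pending_def by (intro gap_in_gaps) blast
  then consider (finished) z where "z \<in> active e" "len e = left e z"
    | (released) z where "z < F" "0 < left e z" "time e < r z" "len e = r z - time e"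
    unfolding gaps_def active_def by auto
  then show ?thesis
  proof cases
    case finished
    then have "z \<in> pending e - pending (Suc e)"
      using activeD[OF finished(1)] unfolding pending_def by (simp add: left_Suc)
    then have "card (pending (Suc e)) < card (pending e)"
      using fin pending_Suc_subset by (intro psubset_card_mono) auto
    then show ?thesis using card_le(2) by linarith
  next
    case released
    then have "z \<in> unreleased e - unreleased (Suc e)"
      unfolding unreleased_def by (simp add: time_Suc)
    then have "card (unreleased (Suc e)) < card (unreleased e)"
      using fin unreleased_Suc_subset by (intro psubset_card_mono) auto
    then show ?thesis using card_le(1) by linarith
  qed
qed

lemma left_finally_0:
  assumes "z < F"
  shows "left (2 * F) z = 0"
proof -
  have "pending e = {} \<or> card (pending e) + card (unreleased e) + e \<le> 2 * F" for e
  proof (induction e)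
    case 0
    have "card (pending 0) \<le> card {..<F}" "card (unreleased 0) \<le> card {..<F}"
      by (rule card_mono; auto simp: pending_def unreleased_def)+
    then show ?case by simp
  next
    case (Suc e)
    then show ?case using pending_Suc_subset[of e] card_pending_unreleased_decreases[of e]
      by fastforce
  qed
  from this[of "2 * F"] have "pending (2 * F) = {} \<or> card (pending (2 * F)) = 0" by linarith
  then have "pending (2 * F) = {}" by (auto simp: pending_def)
  then show ?thesis using assms left_nonneg[of "2 * F" z] unfolding pending_def by force
qed

definition blocking_sent :: "nat \<Rightarrow> nat \<Rightarrow> 'p \<Rightarrow> rat" where
  "blocking_sent z e p = (\<Sum>y | y \<le> z \<and> p \<in> P y. of_nat (d y) - left e y)"

lemma blocking_sent_0 [simp]: "blocking_sent z 0 p = 0"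
  unfolding blocking_sent_def by simp

lemma blocking_sent_Suc_mono: "blocking_sent z e p \<le> blocking_sent z (Suc e) p"
  unfolding blocking_sent_def using left_Suc_le by (intro sum_mono) simp

lemma blocking_sent_Suc_active:
  assumes "y \<in> active e" "y \<le> z" "p \<in> P y"
  shows "blocking_sent z e p + len e \<le> blocking_sent z (Suc e) p"
proof -
  let ?Y = "{y. y \<le> z \<and> p \<in> P y}"
  have "(\<Sum>x\<in>?Y - {y}. of_nat (d x) - left e x) \<le> (\<Sum>x\<in>?Y - {y}. of_nat (d x) - left (Suc e) x)"
    using left_Suc_le by (intro sum_mono) simp
  moreover have "finite ?Y" "y \<in> ?Y" using assms by auto
  ultimately show ?thesis
    unfolding blocking_sent_def using assms(1) by (simp add: sum.remove[of ?Y y] left_Suc)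
qed

lemma blocking_sent_le: "blocking_sent z e p \<le> of_nat (\<Sum>y | y \<le> z \<and> p \<in> P y. d y)"
  unfolding blocking_sent_def of_nat_sum by (intro sum_mono) (simp add: left_nonneg)

lemma time_le_release_plus_blocking_sent:
  assumes z: "z < F" and unfinished: "\<And>e'. e' < e \<Longrightarrow> 0 < left e' z"
  shows "time e \<le> r z + (\<Sum>p\<in>P z. blocking_sent z e p)"
  using unfinished
proof (induction e)
  case 0
  then show ?case using r_nonneg[OF z] by simp
next
  case (Suc e)
  have mono: "(\<Sum>p\<in>Q. blocking_sent z e p) \<le> (\<Sum>p\<in>Q. blocking_sent z (Suc e) p)" for Q
    by (intro sum_mono blocking_sent_Suc_mono)
  show ?case
  proof (cases "time e < r z")
    case True
    then have "time (Suc e) \<le> r z" using time_Suc_le_release z Suc.prems[of e] by simp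
    moreover have "0 \<le> (\<Sum>p\<in>P z. blocking_sent z (Suc e) p)"
      unfolding blocking_sent_def by (intro sum_nonneg) (simp add: left_le)
    ultimately show ?thesis by linarith
  next
    case False
    then have "0 < left e z" "r z \<le> time e" using Suc.prems[of e] by auto
    from z this obtain y p where y: "y \<in> active e" "y \<le> z" "p \<in> P y" "p \<in> P z"
      by (rule active_blocked)
    have "(\<Sum>p\<in>P z. blocking_sent z e p) + len e \<le> (\<Sum>p\<in>P z. blocking_sent z (Suc e) p)"
      using blocking_sent_Suc_active[OF y(1-3)] mono[of "P z - {p}"]
      by (simp add: sum.remove[OF finite_P[OF z] y(4)])
    moreover have "time e \<le> r z + (\<Sum>p\<in>P z. blocking_sent z e p)" using Suc by simp
    ultimately show ?thesis by (simp add: time_Suc)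
  qed
qed

lemma finish_event:
  assumes z: "z < F" "0 < d z"
  obtains e where "e \<le> 2 * F" "left e z = 0" "r z \<le> time e"
    "time e \<le> r z + of_nat (\<Sum>p\<in>P z. \<Sum>y | y \<le> z \<and> p \<in> P y. d y)"
proof -
  define e where "e = (LEAST e. left e z = 0)"
  have finished: "left e z = 0" unfolding e_def
    by (rule LeastI[of _ "2 * F"]) (rule left_finally_0[OF z(1)])
  have e_le: "e \<le> 2 * F" unfolding e_def by (rule Least_le) (rule left_finally_0[OF z(1)])
  have before: "0 < left e' z" if "e' < e" for e'
    using not_less_Least[of e' "\<lambda>e. left e z = 0"] that left_nonneg[of e' z] unfolding e_def
    by (simp add: less_le)
  have "e \<noteq> 0" using finished z(2) by (cases e) auto
  then obtain e' where e': "e = Suc e'" using not0_implies_Suc by blast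
  have "z \<in> active e'" using finished before[of e'] unfolding e' left_Suc by (auto split: if_splits)
  then have released: "r z \<le> time e"
    using activeD(3) time_mono[of e' e] e' by (meson lessI less_imp_le order_trans)
  have "time e \<le> r z + (\<Sum>p\<in>P z. blocking_sent z e p)"
    using z(1) before by (rule time_le_release_plus_blocking_sent)
  also have "(\<Sum>p\<in>P z. blocking_sent z e p) \<le> of_nat (\<Sum>p\<in>P z. \<Sum>y | y \<le> z \<and> p \<in> P y. d y)"
    unfolding of_nat_sum[of _ "P z"] by (intro sum_mono blocking_sent_le)
  finally show thesis using that e_le finished released by simp
qed

subsubsection \<open>Size of the numbers\<close>

lemma gap_multiple:
  assumes D: "\<And>z. z < F \<Longrightarrow> r z * of_int D \<in> \<int>" and "T * of_int D \<in> \<int>" "\<And>z. l z * of_int D \<in> \<int>"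
    "m \<le> F"
  shows "gap T l m * of_int D \<in> \<int>"
proof (cases "gaps T l m = {}")
  case False
  then have "gap T l m \<in> gaps T l m" by (rule gap_in_gaps)
  then show ?thesis using assms unfolding gaps_def by (auto simp: left_diff_distrib)
qed (simp add: gap_def)

lemma time_left_multiples:
  assumes D: "\<And>z. z < F \<Longrightarrow> r z * of_int D \<in> \<int>"
  shows "time e * of_int D \<in> \<int> \<and> (\<forall>z. left e z * of_int D \<in> \<int>)"
proof (induction e)
  case (Suc e)
  then have "len e * of_int D \<in> \<int>" unfolding len_def by (intro gap_multiple D) auto
  then show ?case using Suc by (auto simp: time_Suc left_Suc distrib_right left_diff_distrib)
qed auto

lemma gap_bound:
  assumes "\<And>z. z < F \<Longrightarrow> r z \<le> R" "\<And>z. z < F \<Longrightarrow> d z \<le> X" "0 \<le> R" "m \<le> F"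
  shows "gap (time e) (left e) m \<le> R + of_nat X"
    "time e + gap (time e) (left e) m \<le> max R (time e + of_nat X)"
proof -
  have "gap (time e) (left e) m \<le> of_nat X \<or> time e + gap (time e) (left e) m \<le> R"
  proof (cases "gaps (time e) (left e) m = {}")
    case False
    then have "gap (time e) (left e) m \<in> gaps (time e) (left e) m" by (rule gap_in_gaps)
    then consider (finish) z where "z < m" "gap (time e) (left e) m = left e z"
      | (release) z where "z < m" "gap (time e) (left e) m = r z - time e"
      unfolding gaps_def using chosenD by blast
    then show ?thesis
    proof cases
      case finish
      then have "d z \<le> X" using assms by simp
      then show ?thesis using left_le[of e z] finish(2) by (metis of_nat_mono order_trans)
    next
      case release
      then show ?thesis using assms(1)[of z] assms(4) by simp
    qed
  qed (simp add: gap_def)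
  then show "gap (time e) (left e) m \<le> R + of_nat X"
    "time e + gap (time e) (left e) m \<le> max R (time e + of_nat X)"
    using time_nonneg[of e] assms(3) by (auto simp: max_def)
qed

lemma time_bound:
  assumes "\<And>z. z < F \<Longrightarrow> r z \<le> R" "\<And>z. z < F \<Longrightarrow> d z \<le> X" "0 \<le> R"
  shows "time e \<le> R + of_nat (e * X)"
proof (induction e)
  case (Suc e)
  have "time (Suc e) \<le> max R (time e + of_nat X)"
    unfolding time_Suc len_def by (rule gap_bound(2)[OF assms]) auto
  moreover have "rat_of_nat (Suc e * X) = of_nat (e * X) + of_nat X" by (simp add: algebra_simps)
  moreover have "0 \<le> rat_of_nat (e * X)" "0 \<le> rat_of_nat X" by (rule of_nat_0_le_iff)+
  ultimately show ?case using Suc assms(3) unfolding le_max_iff_disj by linarith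
qed (use assms in simp)

subsubsection \<open>Transmission in real time\<close>

definition \<tau> :: "nat \<Rightarrow> real" where "\<tau> e = real_of_rat (time e)"

definition transmitting :: "nat \<Rightarrow> real \<Rightarrow> bool" where
  "transmitting z t \<longleftrightarrow> (\<exists>e<2 * F. z \<in> active e \<and> \<tau> e \<le> t \<and> t < \<tau> (Suc e))"

lemma \<tau>_mono: "e \<le> e' \<Longrightarrow> \<tau> e \<le> \<tau> e'"
  unfolding \<tau>_def by (simp add: of_rat_less_eq time_mono)

lemma \<tau>_nonneg: "0 \<le> \<tau> e"
  unfolding \<tau>_def by (simp add: time_nonneg)

lemma \<tau>_Suc_diff: "\<tau> (Suc e) - \<tau> e = real_of_rat (len e)"
  unfolding \<tau>_def by (simp add: time_Suc of_rat_add)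

lemma event_unique:
  assumes "\<tau> e \<le> t" "t < \<tau> (Suc e)" "\<tau> e' \<le> t" "t < \<tau> (Suc e')"
  shows "e = e'"
proof (rule ccontr)
  assume "e \<noteq> e'"
  then consider "Suc e \<le> e'" | "Suc e' \<le> e" by linarith
  then show False using \<tau>_mono[of "Suc e" e'] \<tau>_mono[of "Suc e'" e] assms by cases auto
qed

lemma transmitting_no_conflict:
  assumes "transmitting y t" "transmitting z t" "P y \<inter> P z \<noteq> {}"
  shows "y = z"
  using assms event_unique active_no_conflict unfolding transmitting_def by blast

lemma transmitting_after_release:
  assumes "transmitting z t"
  shows "real_of_rat (r z) \<le> t"
proof -
  obtain e where "z \<in> active e" "\<tau> e \<le> t" using assms unfolding transmitting_def by blast
  then show ?thesis using activeD(3)[of z e] of_rat_less_eq[of "r z" "time e", where 'a = real]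
    unfolding \<tau>_def by linarith
qed

lemma transmitting_eq_sum:
  "of_bool (transmitting z t) =
    (\<Sum>e | e < 2 * F \<and> z \<in> active e. of_bool (\<tau> e \<le> t \<and> t < \<tau> (Suc e)) :: real)" (is "_ = ?sum")
proof (cases "transmitting z t")
  case True
  then obtain e where e: "e < 2 * F" "z \<in> active e" "\<tau> e \<le> t" "t < \<tau> (Suc e)"
    unfolding transmitting_def by blast
  have "?sum = (\<Sum>e' | e' < 2 * F \<and> z \<in> active e'. if e' = e then 1 else 0)"
    using e event_unique by (intro sum.cong) auto
  also have "\<dots> = 1" using e by simp
  finally show ?thesis using True by simp
next
  case False
  then have "?sum = 0" unfolding transmitting_def by (intro sum.neutral) auto
  then show ?thesis using False by simp
qed

lemma transmitting_has_integral_sum: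
  assumes "0 \<le> T"
  shows "((\<lambda>t. of_bool (transmitting z t)) has_integral
    (\<Sum>e | e < 2 * F \<and> z \<in> active e. min T (\<tau> (Suc e)) - min T (\<tau> e))) {0..T}"
  unfolding transmitting_eq_sum using assms \<tau>_nonneg \<tau>_mono
  by (intro has_integral_sum has_integral_half_open_interval) auto

lemma transmitting_has_integral:
  assumes e: "e \<le> 2 * F" and T: "\<tau> e \<le> T" "e = 2 * F \<or> T = \<tau> e"
  shows "((\<lambda>t. of_bool (transmitting z t)) has_integral
    (real (d z) - real_of_rat (left e z))) {0..T}"
proof -
  have "(\<Sum>e' | e' < 2 * F \<and> z \<in> active e'. min T (\<tau> (Suc e')) - min T (\<tau> e'))
      = (\<Sum>e' | e' < 2 * F \<and> z \<in> active e'. if e' < e then real_of_rat (len e') else 0)"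
  proof (rule sum.cong[OF refl])
    fix e' assume e': "e' \<in> {e'. e' < 2 * F \<and> z \<in> active e'}"
    show "min T (\<tau> (Suc e')) - min T (\<tau> e') = (if e' < e then real_of_rat (len e') else 0)"
    proof (cases "e' < e")
      case True
      then have "\<tau> e' \<le> T" "\<tau> (Suc e') \<le> T"
        using T(1) \<tau>_mono[of e' e] \<tau>_mono[of "Suc e'" e] by linarith+
      then show ?thesis using True by (simp add: \<tau>_Suc_diff)
    next
      case False
      then have "T \<le> \<tau> e'" "T \<le> \<tau> (Suc e')"
        using T(2) e' \<tau>_mono[of e e'] \<tau>_mono[of e "Suc e'"] by auto
      then show ?thesis using False by simp
    qed
  qed
  also have "\<dots> = (\<Sum>e' | (e' < 2 * F \<and> z \<in> active e') \<and> e' < e. real_of_rat (len e'))"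
    using sum.inter_filter[of "{e'. e' < 2 * F \<and> z \<in> active e'}" "\<lambda>e'. real_of_rat (len e')"
      "\<lambda>e'. e' < e"]
    by simp
  also have "{e'. (e' < 2 * F \<and> z \<in> active e') \<and> e' < e} = {e'. e' < e \<and> z \<in> active e'}"
    using e by auto
  also have "(\<Sum>e' | e' < e \<and> z \<in> active e'. real_of_rat (len e'))
      = real (d z) - real_of_rat (left e z)"
    by (simp add: left_eq of_rat_sum of_rat_diff)
  moreover have "0 \<le> T" using \<tau>_nonneg[of e] T(1) by linarith
  ultimately show ?thesis using transmitting_has_integral_sum[of T z] by simp
qed

lemma transmitted_finally:
  assumes "z < F" "\<tau> (2 * F) \<le> T"
  shows "((\<lambda>t. of_bool (transmitting z t)) has_integral real (d z)) {0..T}"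
  using transmitting_has_integral[of "2 * F" T z] assms left_finally_0 by simp

lemma list_scheduling_completion:
  assumes z: "z < F"
  obtains T where "real_of_rat (r z) \<le> T"
    "T \<le> real_of_rat (r z) + real (\<Sum>p\<in>P z. \<Sum>y | y \<le> z \<and> p \<in> P y. d y)"
    "((\<lambda>t. of_bool (transmitting z t)) has_integral real (d z)) {0..T}"
proof (cases "d z = 0")
  case True
  then have "left e z = 0" for e using left_nonneg[of e z] left_le[of e z] by simp
  then have "\<not> transmitting z t" for t unfolding transmitting_def using activeD(2) by fastforce
  then show thesis using that[of "real_of_rat (r z)"] True by (simp add: sum_nonneg)
next
  case False
  then obtain e where e: "e \<le> 2 * F" "left e z = 0" "r z \<le> time e"
    "time e \<le> r z + of_nat (\<Sum>p\<in>P z. \<Sum>y | y \<le> z \<and> p \<in> P y. d y)"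
    using finish_event[OF z] by blast
  have "\<tau> e \<le> real_of_rat (r z + of_nat (\<Sum>p\<in>P z. \<Sum>y | y \<le> z \<and> p \<in> P y. d y))"
    unfolding \<tau>_def of_rat_less_eq by (rule e(4))
  then have "\<tau> e \<le> real_of_rat (r z) + real (\<Sum>p\<in>P z. \<Sum>y | y \<le> z \<and> p \<in> P y. d y)"
    unfolding of_rat_add of_rat_of_nat_eq .
  moreover have "real_of_rat (r z) \<le> \<tau> e" using e(3) by (simp add: \<tau>_def of_rat_less_eq)
  moreover have "((\<lambda>t. of_bool (transmitting z t)) has_integral real (d z)) {0..\<tau> e}"
    using transmitting_has_integral[of e "\<tau> e" z] e(1,2) by simp
  ultimately show thesis using that by blast
qed

end


subsection \<open>A coflow order and its schedule\<close>

locale valid_coflow_instance =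
  fixes I :: coflow_instance
  assumes valid: "valid_instance I"
begin

abbreviation N where "N \<equiv> ports I"
abbreviation n where "n \<equiv> coflows I"

lemmas cores_pos = valid_instanceD(1)[OF valid]
  and ports_pos = valid_instanceD(2)[OF valid]
  and release_nonneg = valid_instanceD(3)[OF valid]
  and weight_pos = valid_instanceD(4)[OF valid]

definition flows :: nat where "flows = n * N * N"
definition flow_number :: "nat \<Rightarrow> nat \<Rightarrow> nat \<Rightarrow> nat" where "flow_number x i j = (x * N + i) * N + j"
definition pos :: "nat \<Rightarrow> nat" where "pos z = z div N div N"
definition src :: "nat \<Rightarrow> nat" where "src z = z div N mod N"
definition dst :: "nat \<Rightarrow> nat" where "dst z = z mod N"
definition ports_of :: "nat \<Rightarrow> nat set" where "ports_of z = flow_ports I (src z) (dst z)"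

lemma flow_number_parts:
  assumes "i < N" "j < N"
  shows "pos (flow_number x i j) = x" "src (flow_number x i j) = i" "dst (flow_number x i j) = j"
  using assms by (simp_all add: flow_number_def src_def dst_def pos_def)

lemma flow_number_eq: "flow_number (pos z) (src z) (dst z) = z"
  unfolding flow_number_def src_def dst_def pos_def by (simp only: div_mult_mod_eq)

lemma flow_number_less:
  assumes "x < n" "i < N" "j < N"
  shows "flow_number x i j < flows"
proof -
  have "Suc (x * N + i) \<le> Suc x * N" using assms(2) by simp
  also have "\<dots> \<le> n * N" using assms(1) by (intro mult_le_mono1) simp
  finally have "Suc (x * N + i) * N \<le> flows" unfolding flows_def by (intro mult_le_mono1)
  then show ?thesis unfolding flow_number_def using assms(3) by simp
qed

lemma src_less: "src z < N" and dst_less: "dst z < N"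
  using ports_pos by (simp_all add: src_def dst_def)

lemma pos_less: "z < flows \<Longrightarrow> pos z < n"
  using ports_pos unfolding pos_def flows_def
  by (simp add: div_less_iff_less_mult mult.commute mult.left_commute)

lemma pos_mono: "y \<le> z \<Longrightarrow> pos y \<le> pos z"
  unfolding pos_def by (simp add: div_le_mono)

lemma ports_of_less: "p \<in> ports_of z \<Longrightarrow> p < 2 * N"
  using src_less[of z] dst_less[of z] unfolding ports_of_def flow_ports_def by auto

lemma sum_flows_at_port:
  assumes "x < n"
  shows "(\<Sum>y | y < flows \<and> pos y = x \<and> p \<in> ports_of y. f (src y) (dst y))
    = (\<Sum>(i, j)\<in>port_flows I p. f i j)"
proof (rule sum.reindex_bij_witness[of _ "\<lambda>(i, j). flow_number x i j" "\<lambda>y. (src y, dst y)"])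
  fix y assume y: "y \<in> {y. y < flows \<and> pos y = x \<and> p \<in> ports_of y}"
  then show "(case (src y, dst y) of (i, j) \<Rightarrow> flow_number x i j) = y"
    using flow_number_eq[of y] by simp
  show "(src y, dst y) \<in> port_flows I p"
    using y src_less dst_less unfolding port_flows_def ports_of_def by simp
next
  fix ij assume ij: "ij \<in> port_flows I p"
  then show "(src (case ij of (i, j) \<Rightarrow> flow_number x i j),
      dst (case ij of (i, j) \<Rightarrow> flow_number x i j)) = ij"
    unfolding port_flows_def by (auto simp: flow_number_parts)
  show "(case ij of (i, j) \<Rightarrow> flow_number x i j) \<in> {y. y < flows \<and> pos y = x \<and> p \<in> ports_of y}"
    using ij assms unfolding port_flows_def ports_of_def
    by (auto simp: flow_number_parts intro: flow_number_less)
qed simp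

sublocale weighted_loads n "2 * N" "port_load I" "\<lambda>k. real_of_rat (weight I k)"
  by unfold_locales (use ports_pos weight_pos in \<open>auto simp: less_imp_le\<close>)

lemma load_inequalities_completion_time:
  assumes feas: "feasible I S"
  shows "load_inequalities (\<lambda>k. 2 * real (cores I) * completion_time I S k)"
proof -
  have nonneg: "0 \<le> completion_time I S k" if "k < n" for k
  proof -
    have "0 \<le> real_of_rat (release I k)" using release_nonneg[OF that] by simp
    then show ?thesis using release_le_completion_time[OF valid feas that] by linarith
  qed
  have "(\<Sum>k\<in>U. real (port_load I p k))\<^sup>2
      \<le> (\<Sum>k\<in>U. real (port_load I p k) * (2 * real (cores I) * completion_time I S k))"
    if U: "U \<subseteq> {..<n}" for p U
  proof (rule square_sum_le_weighted_sum)
    show "finite U" using U finite_subset by blast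
    fix k assume "k \<in> U"
    then show "(\<Sum>l | l \<in> U \<and> completion_time I S l \<le> completion_time I S k. real (port_load I p l))
        \<le> real (cores I) * completion_time I S k"
      using U nonneg by (intro sum_port_load_le[OF valid feas]) auto
  qed simp
  then show ?thesis unfolding load_inequalities_def using nonneg by simp
qed

end

locale coflow_order = valid_coflow_instance +
  fixes \<pi> :: "nat \<Rightarrow> nat"
  assumes bij: "bij_betw \<pi> {..<n} {..<n}"
begin

definition cof :: "nat \<Rightarrow> nat" where "cof z = \<pi> (pos z)"
definition size_of :: "nat \<Rightarrow> nat" where "size_of z = demand I (src z) (dst z) (cof z)"
definition release_of :: "nat \<Rightarrow> rat" where "release_of z = release I (cof z)"

lemma \<pi>_less: "x < n \<Longrightarrow> \<pi> x < n"
  using bij by (auto simp: bij_betw_def)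

lemma cof_less: "z < flows \<Longrightarrow> cof z < n"
  unfolding cof_def by (intro \<pi>_less pos_less)

lemma inj_on_\<pi>: "m \<le> n \<Longrightarrow> inj_on \<pi> {..<m}"
  using bij unfolding bij_betw_def by (auto intro: inj_on_subset)

lemma flow_eqI:
  assumes "y < flows" "z < flows" "src y = src z" "dst y = dst z" "cof y = cof z"
  shows "y = z"
proof -
  have "pos y = pos z"
    using inj_onD[OF inj_on_\<pi>[OF order_refl] assms(5)[unfolded cof_def]]
      pos_less[OF assms(1)] pos_less[OF assms(2)] by simp
  then show ?thesis using assms(3,4) by (metis flow_number_eq)
qed

lemma obtain_flow:
  assumes "i < N" "j < N" "k < n"
  obtains z where "z < flows" "src z = i" "dst z = j" "cof z = k"
proof -
  have "k \<in> \<pi> ` {..<n}" using bij assms(3) by (simp add: bij_betw_def)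
  then obtain x where "x < n" "\<pi> x = k" by auto
  then show thesis
    using that[of "flow_number x i j"] flow_number_less[of x i j] flow_number_parts[of i j x]
      assms(1,2) by (simp add: cof_def)
qed

sublocale list_scheduling flows ports_of size_of release_of
  by unfold_locales
    (use release_nonneg cof_less in \<open>auto simp: release_of_def ports_of_def flow_ports_def\<close>)

definition sched :: schedule where
  "sched = \<lparr>core = (\<lambda>_. 0), rate = (\<lambda>i j k t. of_bool (\<exists>z<flows.
     src z = i \<and> dst z = j \<and> cof z = k \<and> transmitting z t))\<rparr>"

lemma rate_sched:
  assumes "i < N" "j < N" "k < n"
  obtains z where "z < flows" "src z = i" "dst z = j" "cof z = k"
    "rate sched i j k = (\<lambda>t. of_bool (transmitting z t))"
proof -
  obtain z where z: "z < flows" "src z = i" "dst z = j" "cof z = k"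
    using assms by (rule obtain_flow)
  then have "(\<exists>y<flows. src y = i \<and> dst y = j \<and> cof y = k \<and> transmitting y t) \<longleftrightarrow> transmitting z t"
    for t
    using flow_eqI by blast
  then have "rate sched i j k = (\<lambda>t. of_bool (transmitting z t))"
    unfolding sched_def by simp
  with z show thesis by (rule that)
qed

lemma sched_exclusive:
  assumes "i < N" "j < N" "k < n" "i' < N" "j' < N" "k' < n" "i = i' \<or> j = j'"
    "0 < rate sched i j k t" "0 < rate sched i' j' k' t"
  shows "i = i' \<and> j = j' \<and> k = k'"
proof -
  obtain z
    where z: "src z = i" "dst z = j" "cof z = k"
      "rate sched i j k = (\<lambda>t. of_bool (transmitting z t))"
    using assms(1-3) by (rule rate_sched)
  obtain z' where z': "src z' = i'" "dst z' = j'" "cof z' = k'"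
    "rate sched i' j' k' = (\<lambda>t. of_bool (transmitting z' t))"
    using assms(4-6) by (rule rate_sched)
  have "ports_of z \<inter> ports_of z' \<noteq> {}"
    using assms(7) z z' unfolding ports_of_def flow_ports_def by auto
  then have "z = z'" using transmitting_no_conflict[of z t z'] assms(8,9) z(4) z'(4) by simp
  then show ?thesis using z z' by auto
qed

lemma feasible_sched: "feasible I sched"
  unfolding feasible_def
proof (intro conjI allI impI)
  show "core sched k < cores I" for k using cores_pos by (simp add: sched_def)
next
  fix i j k assume ijk: "i < N" "j < N" "k < n"
  then obtain z where z: "z < flows" "src z = i" "dst z = j" "cof z = k"
    "rate sched i j k = (\<lambda>t. of_bool (transmitting z t))" by (rule rate_sched)
  show "0 \<le> rate sched i j k t" "rate sched i j k t \<le> 1" for t unfolding z(5) by simp_all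
  show "rate sched i j k t = 0" if "t < real_of_rat (release I k)" for t
    using transmitting_after_release[of z t] that z(4,5) unfolding release_of_def by auto
  show "rate sched i j k integrable_on {0..T}" if "0 \<le> T" for T
    unfolding z(5) using transmitting_has_integral_sum[OF that] by (rule has_integral_integrable)
  have "sent sched i j k T = real (demand I i j k)" if "\<tau> (2 * flows) \<le> T" for T
    unfolding sent_def z(5) using transmitted_finally[OF z(1) that] z(2-4)
    by (simp add: size_of_def integral_unique)
  then show "\<exists>T\<ge>0. \<forall>T'\<ge>T. sent sched i j k T' = real (demand I i j k)"
    using \<tau>_nonneg by blast
qed (use sched_exclusive in blast)+

lemma blocking_size_le_peak:
  assumes z: "z < flows" and p: "p \<in> ports_of z"
  shows "(\<Sum>y | y \<le> z \<and> p \<in> ports_of y. size_of y) \<le> peak (\<pi> ` {..<Suc (pos z)})"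
proof -
  let ?Y = "{y. y \<le> z \<and> p \<in> ports_of y}" and ?X = "{..<Suc (pos z)}"
  have "(\<Sum>y\<in>?Y. size_of y) = (\<Sum>x\<in>?X. \<Sum>y | y \<in> ?Y \<and> pos y = x. size_of y)"
    using pos_mono by (intro sum.group[symmetric]) (auto simp: less_Suc_eq_le)
  also have "\<dots> \<le> (\<Sum>x\<in>?X. \<Sum>y | y < flows \<and> pos y = x \<and> p \<in> ports_of y. size_of y)"
    using z by (intro sum_mono sum_mono2) auto
  also have "\<dots> = (\<Sum>x\<in>?X. port_load I p (\<pi> x))"
  proof (rule sum.cong[OF refl])
    fix x assume "x \<in> ?X"
    then have "x < n" using pos_less[OF z] by simp
    then show "(\<Sum>y | y < flows \<and> pos y = x \<and> p \<in> ports_of y. size_of y) = port_load I p (\<pi> x)"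
      using sum_flows_at_port[of x "\<lambda>i j. demand I i j (\<pi> x)" p]
      unfolding port_load_def size_of_def cof_def by (simp cong: conj_cong)
  qed
  also have "\<dots> = (\<Sum>k\<in>\<pi> ` ?X. port_load I p k)"
    using inj_on_\<pi>[of "Suc (pos z)"] pos_less[OF z] by (simp add: sum.reindex)
  also have "\<dots> \<le> peak (\<pi> ` ?X)" using ports_of_less[OF p] by (rule load_le_peak)
  finally show ?thesis .
qed

lemma flow_completion_sched_le:
  assumes ij: "i < N" "j < N" and x: "x < n"
  shows "flow_completion I sched i j (\<pi> x)
    \<le> real_of_rat (release I (\<pi> x)) + 2 * real (peak (\<pi> ` {..<Suc x}))"
proof -
  obtain z where z: "z < flows" "src z = i" "dst z = j" "cof z = \<pi> x"
    "rate sched i j (\<pi> x) = (\<lambda>t. of_bool (transmitting z t))"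
    using ij \<pi>_less[OF x] by (rule rate_sched)
  have pos: "pos z = x"
    using inj_onD[OF inj_on_\<pi>[OF order_refl], of "pos z" x] z(4) x pos_less[OF z(1)]
    unfolding cof_def by simp
  obtain T where T: "real_of_rat (release_of z) \<le> T"
    "T \<le> real_of_rat (release_of z) + real (\<Sum>p\<in>ports_of z. \<Sum>y | y \<le> z \<and> p \<in> ports_of y. size_of y)"
    "((\<lambda>t. of_bool (transmitting z t)) has_integral real (size_of z)) {0..T}"
    using z(1) by (rule list_scheduling_completion)
  have "T \<in> completion_candidates I sched i j (\<pi> x)"
    unfolding completion_candidates_def sent_def z(5) using T(1,3) z(2-4)
    by (simp add: release_of_def size_of_def integral_unique)
  then have completion: "flow_completion I sched i j (\<pi> x) \<le> T" by (rule flow_completion_le)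
  have "(\<Sum>p\<in>ports_of z. \<Sum>y | y \<le> z \<and> p \<in> ports_of y. size_of y)
      \<le> (\<Sum>p\<in>ports_of z. peak (\<pi> ` {..<Suc x}))"
    using blocking_size_le_peak[OF z(1)] unfolding pos by (rule sum_mono)
  also have "card (ports_of z) = 2"
    using src_less[of z] unfolding ports_of_def flow_ports_def by simp
  then have "(\<Sum>p\<in>ports_of z. peak (\<pi> ` {..<Suc x})) = 2 * peak (\<pi> ` {..<Suc x})" by simp
  finally have "real (\<Sum>p\<in>ports_of z. \<Sum>y | y \<le> z \<and> p \<in> ports_of y. size_of y)
      \<le> real (2 * peak (\<pi> ` {..<Suc x}))" by (rule of_nat_mono)
  then have "real (\<Sum>p\<in>ports_of z. \<Sum>y | y \<le> z \<and> p \<in> ports_of y. size_of y)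
      \<le> 2 * real (peak (\<pi> ` {..<Suc x}))" by (simp only: of_nat_mult of_nat_numeral)
  then show ?thesis using completion T(2) unfolding release_of_def z(4) by linarith
qed

lemma completion_time_sched_le:
  assumes x: "x < n"
  shows "completion_time I sched (\<pi> x)
    \<le> real_of_rat (release I (\<pi> x)) + 2 * real (peak (\<pi> ` {..<Suc x}))"
  unfolding completion_time_def
proof (rule Max.boundedI)
  have "(0, 0) \<in> {..<N} \<times> {..<N}" using ports_pos by simp
  then show "(\<lambda>(i, j). flow_completion I sched i j (\<pi> x)) ` ({..<N} \<times> {..<N}) \<noteq> {}" by blast
qed (use flow_completion_sched_le[OF _ _ x] in auto)

lemma objective_sched_le:
  assumes inv: "local_ratio_inv 0 \<pi> v" and feas: "feasible I S"
  shows "objective I sched \<le> (4 * real (cores I) + 1) * objective I S"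
proof -
  let ?w = "\<lambda>k. real_of_rat (weight I k)" and ?r = "\<lambda>k. real_of_rat (release I k)"
  let ?peak = "\<lambda>x. real (peak (\<pi> ` {..<Suc x}))"
  have reindex: "(\<Sum>k<n. f k) = (\<Sum>x<n. f (\<pi> x))" for f :: "nat \<Rightarrow> real"
    using sum.reindex_bij_betw[OF bij, of f] by simp
  have "objective I sched = (\<Sum>x<n. ?w (\<pi> x) * completion_time I sched (\<pi> x))"
    unfolding objective_def by (rule reindex)
  also have "\<dots> \<le> (\<Sum>x<n. ?w (\<pi> x) * (?r (\<pi> x) + 2 * ?peak x))"
    using completion_time_sched_le w_nonneg \<pi>_less by (intro sum_mono mult_left_mono) auto
  also have "\<dots> = (\<Sum>x<n. ?w (\<pi> x) * ?r (\<pi> x)) + 2 * (\<Sum>x<n. ?w (\<pi> x) * ?peak x)"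
    by (simp add: distrib_left sum.distrib sum_distrib_left algebra_simps)
  also have "(\<Sum>x<n. ?w (\<pi> x) * ?r (\<pi> x)) = (\<Sum>k<n. ?w k * ?r k)" by (rule reindex[symmetric])
  also have "(\<Sum>k<n. ?w k * ?r k) \<le> objective I S"
    unfolding objective_def using release_le_completion_time[OF valid feas] w_nonneg
    by (intro sum_mono mult_left_mono) auto
  also have "(\<Sum>x<n. ?w (\<pi> x) * ?peak x)
      \<le> (\<Sum>k<n. ?w k * (2 * real (cores I) * completion_time I S k))"
    by (rule local_ratio_inv_final[OF inv load_inequalities_completion_time[OF feas]])
  also have "\<dots> = 2 * real (cores I) * objective I S"
    unfolding objective_def by (simp add: sum_distrib_left algebra_simps)
  finally show ?thesis by (simp add: algebra_simps)
qed

lemma objective_sched_le_optimum: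
  assumes inv: "local_ratio_inv 0 \<pi> v"
  shows "objective I sched \<le> (4 * real (cores I) + 1) * optimum I"
proof -
  have "objective I sched / (4 * real (cores I) + 1) \<le> optimum I"
    unfolding optimum_def
  proof (rule cInf_greatest)
    show "{objective I S |S. feasible I S} \<noteq> {}" using feasible_sched by blast
    fix v assume "v \<in> {objective I S |S. feasible I S}"
    then show "objective I sched / (4 * real (cores I) + 1) \<le> v"
      using objective_sched_le[OF inv] by (auto simp: divide_le_eq mult.commute)
  qed
  then show ?thesis by (simp add: divide_le_eq mult.commute)
qed

end


subsection \<open>Size of the input\<close>

context valid_coflow_instance
begin

abbreviation \<beta> where "\<beta> \<equiv> input_bits I"

definition bit_bound :: nat where "bit_bound = (\<beta> + 4)\<^sup>2"
definition loop_bound :: nat where "loop_bound = 2 * input_count I"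

abbreviation runs :: "prog \<Rightarrow> memory \<Rightarrow> (memory \<Rightarrow> bool) \<Rightarrow> bool" where
  "runs \<equiv> run loop_bound bit_bound"
abbreviation short :: "rat \<Rightarrow> bool" where "short \<equiv> fits bit_bound"
abbreviation all_short :: "memory \<Rightarrow> bool" where "all_short \<equiv> all_fit bit_bound"

lemma input_bits_parts:
  "rat_bits (of_nat (cores I)) \<le> \<beta>" "rat_bits (of_nat N) \<le> \<beta>" "rat_bits (of_nat n) \<le> \<beta>"
  "(\<Sum>k<n. \<Sum>i<N. \<Sum>j<N. rat_bits (of_nat (demand I i j k))) \<le> \<beta>"
  "(\<Sum>k<n. rat_bits (release I k)) \<le> \<beta>" "(\<Sum>k<n. rat_bits (weight I k)) \<le> \<beta>"
  unfolding input_bits_def sum.distrib by simp_all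

lemma input_count_le_input_bits: "input_count I \<le> \<beta>"
proof -
  have "n * N * N = (\<Sum>k<n. \<Sum>i<N. \<Sum>j<N. 1)" by simp
  also have "\<dots> \<le> (\<Sum>k<n. \<Sum>i<N. \<Sum>j<N. rat_bits (of_nat (demand I i j k)))"
    by (intro sum_mono rat_bits_ge_1)
  finally have "n * N * N \<le> (\<Sum>k<n. \<Sum>i<N. \<Sum>j<N. rat_bits (of_nat (demand I i j k)))" .
  moreover have "2 * n = (\<Sum>k<n. 1 + 1)" by simp
  then have "2 * n \<le> (\<Sum>k<n. rat_bits (release I k) + rat_bits (weight I k))"
    by (simp only:) (intro sum_mono add_mono rat_bits_ge_1)
  moreover note rat_bits_ge_1[of "of_nat (cores I)"] rat_bits_ge_1[of "of_nat N"]
    rat_bits_ge_1[of "of_nat n"]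
  ultimately show ?thesis unfolding input_bits_def input_count_def by linarith
qed

lemma two_power_mono: "a \<le> b \<Longrightarrow> (2::'a::linordered_semidom) ^ a \<le> 2 ^ b"
  by (rule power_increasing) auto

lemma rat_bits_release_le: "k < n \<Longrightarrow> rat_bits (release I k) \<le> \<beta>"
  and rat_bits_weight_le: "k < n \<Longrightarrow> rat_bits (weight I k) \<le> \<beta>"
  using member_le_sum[of k "{..<n}" "\<lambda>k. rat_bits (release I k)"]
    member_le_sum[of k "{..<n}" "\<lambda>k. rat_bits (weight I k)"] input_bits_parts(5,6) by auto

lemma release_le: "k < n \<Longrightarrow> release I k \<le> 2 ^ \<beta>"
  using abs_less_two_power_rat_bits[of "release I k"]
    two_power_mono[OF rat_bits_release_le, of k, where 'a=rat] by linarith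

lemma weight_le: "k < n \<Longrightarrow> weight I k \<le> 2 ^ \<beta>"
  using abs_less_two_power_rat_bits[of "weight I k"]
    two_power_mono[OF rat_bits_weight_le, of k, where 'a=rat] by linarith

lemma port_load_le:
  assumes "k < n"
  shows "port_load I p k \<le> 2 ^ \<beta>"
proof -
  let ?bits = "\<lambda>(i, j). rat_bits (of_nat (demand I i j k))"
  have "port_load I p k < 2 ^ (\<Sum>ij\<in>port_flows I p. ?bits ij)"
    unfolding port_load_def
    by (rule sum_less_two_power_sum) (auto simp: nat_less_two_power_rat_bits)
  also have "(\<Sum>ij\<in>port_flows I p. ?bits ij) \<le> (\<Sum>ij\<in>{..<N} \<times> {..<N}. ?bits ij)"
    using port_flows_subset by (intro sum_mono2) auto
  also have "\<dots> = (\<Sum>i<N. \<Sum>j<N. ?bits (i, j))" by (simp add: sum.cartesian_product)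
  also have "\<dots> \<le> (\<Sum>k<n. \<Sum>i<N. \<Sum>j<N. rat_bits (of_nat (demand I i j k)))"
    using assms member_le_sum[of k "{..<n}" "\<lambda>k. \<Sum>i<N. \<Sum>j<N. rat_bits (of_nat (demand I i j k))"]
    by simp
  also have "\<dots> \<le> \<beta>" by (rule input_bits_parts)
  finally show ?thesis by (simp add: two_power_mono)
qed

lemma demand_le:
  assumes "i < N" "j < N" "k < n"
  shows "demand I i j k \<le> 2 ^ \<beta>"
proof -
  have "(i, j) \<in> port_flows I i" using assms unfolding port_flows_def flow_ports_def by simp
  then have "demand I i j k \<le> port_load I i k"
    unfolding port_load_def
    using member_le_sum[of "(i, j)" "port_flows I i" "\<lambda>(i, j). demand I i j k"]
    by simp
  then show ?thesis using port_load_le[OF assms(3), of i] by linarith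
qed

lemma two_power_le_bit_bound:
  "a \<le> \<beta> * \<beta> + 8 * \<beta> + 8 \<Longrightarrow> (2::'a::linordered_semidom) ^ a \<le> 2 ^ bit_bound"
  by (rule two_power_mono) (simp add: bit_bound_def power2_eq_square algebra_simps)

lemma le_two_power_bit_boundI: "x \<le> 2 ^ (3 * \<beta> + 2) \<Longrightarrow> x \<le> (2::nat) ^ bit_bound"
  using two_power_le_bit_bound[of "3 * \<beta> + 2", where 'a=nat] by linarith

lemma short_of_nat: "x \<le> 2 ^ (3 * \<beta> + 2) \<Longrightarrow> short (of_nat x)"
  by (intro fits_of_nat le_two_power_bit_boundI)

lemma two_power_input_bits_le: "(2::nat) ^ \<beta> \<le> 2 ^ (3 * \<beta> + 2)"
  by (rule two_power_mono) simp

lemma coflows_le_input_bits: "2 * n \<le> \<beta>" and flows_le_input_bits: "flows \<le> \<beta>"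
  using input_count_le_input_bits unfolding input_count_def flows_def by auto

lemma loop_bounds: "n \<le> loop_bound" "0 < n \<Longrightarrow> 2 * N \<le> loop_bound" "flows \<le> loop_bound"
  "2 * flows \<le> loop_bound"
proof -
  show "2 * N \<le> loop_bound" if "0 < n"
  proof -
    have "1 \<le> n * N" using that ports_pos by (simp add: Suc_le_eq)
    then have "1 * N \<le> n * N * N" by (rule mult_le_mono1)
    then have "2 * N \<le> 2 * (n * N * N)" by (simp only: mult_1 mult_le_mono)
    also have "\<dots> \<le> loop_bound" by (simp add: loop_bound_def input_count_def)
    finally show ?thesis .
  qed
qed (auto simp: loop_bound_def input_count_def flows_def)

lemma counts_le: "n \<le> 2 ^ (3 * \<beta> + 2)" "2 * N \<le> 2 ^ (3 * \<beta> + 2)" "2 * flows \<le> 2 ^ (3 * \<beta> + 2)"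
  "2 * flows * flows \<le> 2 ^ (3 * \<beta> + 2)"
proof -
  have \<beta>: "\<beta> < 2 ^ \<beta>" by (rule less_exp)
  have "N \<le> 2 ^ \<beta>"
    using nat_less_two_power_rat_bits[of N] two_power_mono[OF input_bits_parts(2), where 'a=nat]
    by linarith
  then have "2 * N \<le> 2 ^ (\<beta> + 1)" by simp
  also have "\<dots> \<le> 2 ^ (3 * \<beta> + 2)" by (rule two_power_mono) simp
  finally show "2 * N \<le> 2 ^ (3 * \<beta> + 2)" .
  have "flows \<le> 2 ^ \<beta>" using \<beta> flows_le_input_bits by linarith
  then have "2 * flows * flows \<le> 2 * 2 ^ \<beta> * 2 ^ \<beta>" by (intro mult_le_mono order_refl)
  also have "\<dots> = 2 ^ (2 * \<beta> + 1)" by (simp add: power_add mult_2 distrib_right)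
  also have "\<dots> \<le> 2 ^ (3 * \<beta> + 2)" by (rule two_power_mono) simp
  finally show "2 * flows * flows \<le> 2 ^ (3 * \<beta> + 2)" .
  have "2 * \<beta> \<le> 2 ^ (\<beta> + 1)" using \<beta> by simp
  also have "\<dots> \<le> 2 ^ (3 * \<beta> + 2)" by (rule two_power_mono) simp
  finally have "2 * \<beta> \<le> 2 ^ (3 * \<beta> + 2)" .
  then show "n \<le> 2 ^ (3 * \<beta> + 2)" "2 * flows \<le> 2 ^ (3 * \<beta> + 2)"
    using coflows_le_input_bits flows_le_input_bits by linarith+
qed

lemma encode_header:
  "encode I 0 0 = of_nat (cores I)" "encode I 0 1 = of_nat N" "encode I 0 2 = of_nat n"
  by (simp_all add: encode_def)

lemma encode_demand:
  assumes z: "z < flows"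
  shows "encode I 1 (of_nat z) = of_nat (demand I (src z) (dst z) (pos z))"
proof -
  let ?d = "of_nat (demand I (src z) (dst z) (pos z)) :: rat"
  have "encode I 1 (of_nat z) =
      (\<Sum>k<n. \<Sum>i<N. \<Sum>j<N. if z = flow_number k i j then of_nat (demand I i j k) else 0)"
    unfolding encode_def flow_number_def by (simp del: of_nat_add of_nat_mult)
  also have "\<dots> = (\<Sum>(k, i, j)\<in>{..<n} \<times> {..<N} \<times> {..<N}.
      if z = flow_number k i j then of_nat (demand I i j k) else 0)"
    by (simp add: sum.cartesian_product)
  also have "\<dots> = (\<Sum>x\<in>{..<n} \<times> {..<N} \<times> {..<N}. if x = (pos z, src z, dst z) then ?d else 0)"
    by (intro sum.cong) (auto simp: flow_number_parts flow_number_eq split: if_splits)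
  also have "\<dots> = ?d" using pos_less[OF z] src_less dst_less by simp
  finally show ?thesis .
qed

lemma encode_release: "k < n \<Longrightarrow> encode I 2 (of_nat k) = release I k"
  and encode_weight: "k < n \<Longrightarrow> encode I 3 (of_nat k) = weight I k"
  and encode_other: "a > 3 \<Longrightarrow> encode I a q = 0"
  by (auto simp: encode_def)

lemma encode_outside:
  "\<nexists>z. z < flows \<and> q = of_nat z \<Longrightarrow> encode I 1 q = 0" "\<nexists>k. k < n \<and> q = of_nat k \<Longrightarrow> encode I 2 q = 0"
  "\<nexists>k. k < n \<and> q = of_nat k \<Longrightarrow> encode I 3 q = 0"
proof -
  assume "\<nexists>z. z < flows \<and> q = of_nat z"
  then have "q \<noteq> of_nat ((k * N + i) * N + j)" if "k < n" "i < N" "j < N" for k i j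
    using flow_number_less[OF that] unfolding flow_number_def by blast
  then show "encode I 1 q = 0" unfolding encode_def
    by (simp only: fun_upd_apply) (auto intro!: sum.neutral)
qed (auto simp: encode_def intro!: sum.neutral)

lemma all_short_encode: "all_short (encode I)"
  unfolding all_fit_def
proof (intro allI)
  fix a :: nat and q
  have short_if_bits: "short x" if "rat_bits x \<le> \<beta>" for x
    using fits_rat_bits
    by (rule fits_mono) (use that in \<open>simp add: bit_bound_def power2_eq_square algebra_simps\<close>)
  consider (header) "a = 0" | (demand) "a = 1" | (release) "a = 2" | (weight) "a = 3"
    | (other) "a > 3" by linarith
  then show "short (encode I a q)"
  proof cases
    case header
    then show ?thesis using input_bits_parts(1,2,3) by (auto simp: encode_def intro: short_if_bits)
  next
    case demand
    have "short (of_nat (demand I (src z) (dst z) (pos z)))" if "z < flows" for z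
      using demand_le[OF src_less[of z] dst_less[of z] pos_less[OF that]] two_power_input_bits_le
      by (intro short_of_nat) linarith
    then show ?thesis using demand encode_demand encode_outside(1)[of q] by (metis fits_0)
  next
    case release
    then show ?thesis
      using encode_release encode_outside(2)[of q] short_if_bits[OF rat_bits_release_le]
      by (metis fits_0)
  next
    case weight
    then show ?thesis
      using encode_weight encode_outside(3)[of q] short_if_bits[OF rat_bits_weight_le]
      by (metis fits_0)
  next
    case other
    then show ?thesis using encode_other by simp
  qed
qed

end


subsection \<open>Computing the port loads\<close>

text \<open>Arrays are named by input abbreviations; a name ending in \<open>var\<close> denotes an array of which only
  cell 0 is used.\<close>

abbreviation (input) header_array :: nat where "header_array \<equiv> 0"
abbreviation (input) demand_array :: nat where "demand_array \<equiv> 1"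
abbreviation (input) release_array :: nat where "release_array \<equiv> 2"
abbreviation (input) weight_array :: nat where "weight_array \<equiv> 3"
abbreviation (input) out_core_array :: nat where "out_core_array \<equiv> 4"
abbreviation (input) out_count_var :: nat where "out_count_var \<equiv> 5"
abbreviation (input) out_source_array :: nat where "out_source_array \<equiv> 6"
abbreviation (input) out_destination_array :: nat where "out_destination_array \<equiv> 7"
abbreviation (input) out_coflow_array :: nat where "out_coflow_array \<equiv> 8"
abbreviation (input) out_start_array :: nat where "out_start_array \<equiv> 9"
abbreviation (input) out_end_array :: nat where "out_end_array \<equiv> 10"
abbreviation (input) load_array :: nat where "load_array \<equiv> 11"
abbreviation (input) pos_array :: nat where "pos_array \<equiv> 12"
abbreviation (input) src_array :: nat where "src_array \<equiv> 13"
abbreviation (input) dst_array :: nat where "dst_array \<equiv> 14"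
abbreviation (input) coflow_array :: nat where "coflow_array \<equiv> 15"
abbreviation (input) left_array :: nat where "left_array \<equiv> 16"
abbreviation (input) order_array :: nat where "order_array \<equiv> 17"
abbreviation (input) stamp_array :: nat where "stamp_array \<equiv> 18"
abbreviation (input) active_array :: nat where "active_array \<equiv> 19"
abbreviation (input) flow_count_var :: nat where "flow_count_var \<equiv> 20"
abbreviation (input) flow_var :: nat where "flow_var \<equiv> 21"
abbreviation (input) pos_var :: nat where "pos_var \<equiv> 22"
abbreviation (input) src_var :: nat where "src_var \<equiv> 23"
abbreviation (input) dst_var :: nat where "dst_var \<equiv> 24"
abbreviation (input) round_var :: nat where "round_var \<equiv> 25"
abbreviation (input) last_var :: nat where "last_var \<equiv> 26"
abbreviation (input) port_var :: nat where "port_var \<equiv> 27"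
abbreviation (input) sum_var :: nat where "sum_var \<equiv> 28"
abbreviation (input) peak_var :: nat where "peak_var \<equiv> 29"
abbreviation (input) peak_port_var :: nat where "peak_port_var \<equiv> 30"
abbreviation (input) best_var :: nat where "best_var \<equiv> 31"
abbreviation (input) ratio_var :: nat where "ratio_var \<equiv> 32"
abbreviation (input) swap_var :: nat where "swap_var \<equiv> 33"
abbreviation (input) event_var :: nat where "event_var \<equiv> 34"
abbreviation (input) time_var :: nat where "time_var \<equiv> 35"
abbreviation (input) gap_var :: nat where "gap_var \<equiv> 36"

abbreviation Ports :: exp where "Ports \<equiv> Cell header_array (Const 1)"
abbreviation Coflows :: exp where "Coflows \<equiv> Cell header_array (Const 2)"

abbreviation Source_port :: exp where "Source_port \<equiv> Cell src_array (Var flow_var)"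
abbreviation Destination_port :: exp where
  "Destination_port \<equiv> Add Ports (Cell dst_array (Var flow_var))"

definition set_var :: "nat \<Rightarrow> exp \<Rightarrow> prog" where
  "set_var a e = Assign a (Const 0) e"

definition increment :: "nat \<Rightarrow> prog" where
  "increment a = set_var a (Add (Var a) (Const 1))"

definition next_flow :: prog where
  "next_flow = IfLess (Add (Var dst_var) (Const 1)) Ports (increment dst_var)
     (Seq (set_var dst_var (Const 0))
       (IfLess (Add (Var src_var) (Const 1)) Ports (increment src_var)
         (Seq (set_var src_var (Const 0)) (increment pos_var))))"

definition index_step :: prog where
  "index_step = Seq (Assign pos_array (Var flow_var) (Var pos_var))
     (Seq (Assign src_array (Var flow_var) (Var src_var))
     (Seq (Assign dst_array (Var flow_var) (Var dst_var)) next_flow))"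

definition index_prog :: prog where
  "index_prog = Seq (set_var flow_count_var (Mul (Mul Coflows Ports) Ports))
     (For flow_var (Var flow_count_var) index_step)"

definition add_load :: "exp \<Rightarrow> prog" where
  "add_load e = Assign load_array (Add (Mul e Coflows) (Cell pos_array (Var flow_var)))
     (Add (Cell load_array (Add (Mul e Coflows) (Cell pos_array (Var flow_var))))
       (Cell demand_array (Var flow_var)))"

definition load_step :: prog where
  "load_step = Seq (add_load Source_port) (add_load Destination_port)"

definition load_prog :: prog where
  "load_prog = For flow_var (Var flow_count_var) load_step"

lemma writes_load_progs [simp]:
  "writes (set_var a e) = {a}"
  "writes index_step = {pos_array, src_array, dst_array, pos_var, src_var, dst_var}"
  "writes index_prog = {pos_array, src_array, dst_array, flow_count_var, flow_var, pos_var, src_var,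
     dst_var}"
  "writes (add_load e) = {load_array}" "writes load_step = {load_array}"
  "writes load_prog = {flow_var, load_array}"
  by (auto simp: set_var_def increment_def index_step_def next_flow_def index_prog_def add_load_def
      load_step_def load_prog_def)

lemma pair_index_eq:
  fixes a b c :: nat
  assumes "a < c" "b < c"
  shows "p * c + a = q * c + b \<longleftrightarrow> p = q \<and> a = b"
proof
  assume index: "p * c + a = q * c + b"
  from arg_cong[OF index, of "\<lambda>x. x div c"] arg_cong[OF index, of "\<lambda>x. x mod c"]
  show "p = q \<and> a = b" using assms by simp
qed simp

context valid_coflow_instance
begin

definition input_kept :: "memory \<Rightarrow> bool" where
  "input_kept s \<longleftrightarrow> (\<forall>a\<in>{header_array, demand_array, release_array}. s a = encode I a)"

definition indexed :: "nat \<Rightarrow> memory \<Rightarrow> bool" where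
  "indexed z s \<longleftrightarrow> (\<forall>y<z. s pos_array (of_nat y) = of_nat (pos y) \<and>
     s src_array (of_nat y) = of_nat (src y) \<and> s dst_array (of_nat y) = of_nat (dst y))"

definition indexed_input :: "memory \<Rightarrow> bool" where
  "indexed_input s \<longleftrightarrow> input_kept s \<and> s flow_count_var 0 = of_nat flows \<and> indexed flows s"

definition counters_at :: "nat \<Rightarrow> memory \<Rightarrow> bool" where
  "counters_at z s \<longleftrightarrow> s pos_var 0 = of_nat (pos z) \<and> s src_var 0 = of_nat (src z) \<and>
     s dst_var 0 = of_nat (dst z)"

lemma input_keptD:
  assumes "input_kept s"
  shows "s header_array 1 = of_nat N" "s header_array 2 = of_nat n"
    "z < flows \<Longrightarrow> s demand_array (of_nat z) = of_nat (demand I (src z) (dst z) (pos z))"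
    "k < n \<Longrightarrow> s release_array (of_nat k) = release I k"
  using assms encode_header encode_demand encode_release unfolding input_kept_def by auto

lemma indexed_inputD:
  assumes "indexed_input s"
  shows "s header_array 1 = of_nat N" "s header_array 2 = of_nat n"
    "s flow_count_var 0 = of_nat flows"
    "z < flows \<Longrightarrow> s demand_array (of_nat z) = of_nat (demand I (src z) (dst z) (pos z))"
    "k < n \<Longrightarrow> s release_array (of_nat k) = release I k"
    "z < flows \<Longrightarrow> s pos_array (of_nat z) = of_nat (pos z)"
    "z < flows \<Longrightarrow> s src_array (of_nat z) = of_nat (src z)"
    "z < flows \<Longrightarrow> s dst_array (of_nat z) = of_nat (dst z)"
  using assms input_keptD[of s] unfolding indexed_input_def indexed_def by auto

lemma indexed_input_determined_by: "determined_by indexed_input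
    {header_array, demand_array, release_array, pos_array, src_array, dst_array, flow_count_var}"
  by (simp add: determined_by_def indexed_input_def input_kept_def indexed_def)

lemmas indexed_input_frame = determined_by_frame[OF indexed_input_determined_by]

lemma run_For_flows:
  assumes s: "all_short s" "Inv 0 s" and written: "flow_var \<notin> writes c"
    and frame: "\<And>t. same_outside (insert flow_var (writes c)) s t \<Longrightarrow> R t"
    and count: "\<And>t. R t \<Longrightarrow> indexed_input t"
    and counter: "\<And>z t v. Inv z (t(flow_var := v)) = Inv z t"
    and step: "\<And>z t. z < flows \<Longrightarrow> all_short t \<Longrightarrow> R t \<Longrightarrow> t flow_var 0 = of_nat z \<Longrightarrow> Inv z t \<Longrightarrow>
      runs c t (Inv (Suc z))"
  shows "runs (For flow_var (Var flow_count_var) c) s (\<lambda>t. R t \<and> Inv flows t)"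
proof (rule run_For[OF s(1)])
  have "flows \<le> 2 * flows" by simp
  then show "flows \<le> 2 ^ bit_bound" using counts_le(3) by (intro le_two_power_bit_boundI) linarith
  show "val (Var flow_count_var) t = of_nat flows" if "R t" for t
    using indexed_inputD(3)[OF count[OF that]] by simp
  show "Inv z (t(flow_var := v)) = Inv z t" for z t v by (rule counter)
qed (use s(2) written frame step loop_bounds(3) in auto)

lemma Suc_less_ports_iff:
  "Suc (src z) < N \<longleftrightarrow> Suc (src z) \<noteq> N" "Suc (dst z) < N \<longleftrightarrow> Suc (dst z) \<noteq> N"
  using src_less[of z] dst_less[of z] by auto

lemma dst_Suc: "dst (Suc z) = (if Suc (dst z) < N then Suc (dst z) else 0)"
  unfolding Suc_less_ports_iff by (simp add: dst_def mod_Suc)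

lemma src_Suc:
  "src (Suc z) = (if Suc (dst z) < N then src z else if Suc (src z) < N then Suc (src z) else 0)"
  unfolding Suc_less_ports_iff by (simp add: src_def dst_def div_Suc mod_Suc)

lemma pos_Suc:
  "pos (Suc z) = (if Suc (dst z) < N \<or> Suc (src z) < N then pos z else Suc (pos z))"
  unfolding Suc_less_ports_iff by (simp add: pos_def src_def dst_def div_Suc mod_Suc)

lemma pos_le: "z \<le> flows \<Longrightarrow> pos z \<le> n"
  using pos_mono[of z flows] ports_pos by (simp add: pos_def flows_def)

lemma short_flow_parts:
  "z \<le> flows \<Longrightarrow> short (of_nat (pos z))" "short (of_nat (src z))" "short (of_nat (dst z))"
  using pos_le[of z] src_less[of z] dst_less[of z] counts_le(1,2) by (intro short_of_nat; linarith)+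

lemma run_index_step:
  assumes z: "z < flows"
    and s: "all_short s" "input_kept s" "s flow_var 0 = of_nat z" "counters_at z s" "indexed z s"
  shows "runs index_step s (\<lambda>t. counters_at (Suc z) t \<and> indexed (Suc z) t)"
proof (rule run_wp[OF s(1)])
  have "rat_of_nat (src z) + 1 < of_nat N \<longleftrightarrow> Suc (src z) < N"
    "rat_of_nat (dst z) + 1 < of_nat N \<longleftrightarrow> Suc (dst z) < N"
    by (metis add.commute of_nat_Suc of_nat_less_iff)+
  moreover have "short (of_nat (pos (Suc z)))" "short (of_nat (src (Suc z)))"
    "short (of_nat (dst (Suc z)))"
    using z by (intro short_flow_parts; simp)+
  ultimately show "wp bit_bound index_step (\<lambda>t. counters_at (Suc z) t \<and> indexed (Suc z) t) s"
    using s z short_flow_parts[of z] input_keptD(1)[OF s(2)]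
    unfolding index_step_def next_flow_def increment_def set_var_def counters_at_def
    by (auto simp: pos_Suc src_Suc dst_Suc indexed_def less_Suc_eq add.commute split: if_splits)
qed

lemma run_index_prog: "runs index_prog (encode I) indexed_input"
  unfolding index_prog_def
proof (rule run_Seq_wp[OF all_short_encode])
  have "flows \<le> 2 * flows" by simp
  then have fits: "flows \<le> 2 ^ (3 * \<beta> + 2)" using counts_le(3) by linarith
  let ?loop = "For flow_var (Var flow_count_var) index_step"
  let ?s = "(encode I)(flow_count_var := (encode I flow_count_var)(0 := of_nat flows))"
  have "runs ?loop ?s indexed_input" if short: "all_short ?s"
  proof (rule run_conseq)
    let ?P = "\<lambda>t. input_kept t \<and> t flow_count_var 0 = of_nat flows"
    let ?Inv = "\<lambda>z t. counters_at z t \<and> indexed z t"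
    show "runs ?loop ?s (\<lambda>t. ?P t \<and> ?Inv flows t)"
    proof (rule run_For[OF short])
      show "?P t" if "same_outside (insert flow_var (writes index_step)) ?s t" for t
        using that by (auto simp: same_outside_def input_kept_def)
      show "?Inv 0 ?s"
        by (simp add: counters_at_def indexed_def pos_def src_def dst_def encode_other)
      show "runs index_step t (?Inv (Suc z))"
        if "z < flows" "all_short t" "?P t" "t flow_var 0 = of_nat z" "?Inv z t" for z t
        using that by (intro run_index_step) auto
      show "flows \<le> 2 ^ bit_bound" using fits by (rule le_two_power_bit_boundI)
    qed (use loop_bounds(3) in \<open>auto simp: counters_at_def indexed_def\<close>)
  qed (auto simp: indexed_input_def)
  then show "wp bit_bound (set_var flow_count_var (Mul (Mul Coflows Ports) Ports))
      (\<lambda>t. all_short t \<longrightarrow> runs ?loop t indexed_input) (encode I)"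
    using short_of_nat[OF fits] encode_header unfolding set_var_def by (simp add: flows_def)
qed

definition partial_load :: "nat \<Rightarrow> nat \<Rightarrow> nat \<Rightarrow> nat" where
  "partial_load z p k = (\<Sum>y | y < z \<and> pos y = k \<and> p \<in> ports_of y. demand I (src y) (dst y) k)"

lemma partial_load_Suc: "partial_load (Suc z) p k =
    partial_load z p k + (if k = pos z \<and> p \<in> ports_of z then demand I (src z) (dst z) k else 0)"
proof -
  have "{y. y < Suc z \<and> pos y = k \<and> p \<in> ports_of y} =
      (if k = pos z \<and> p \<in> ports_of z then insert z {y. y < z \<and> pos y = k \<and> p \<in> ports_of y}
       else {y. y < z \<and> pos y = k \<and> p \<in> ports_of y})"
    by (auto simp: less_Suc_eq)
  then show ?thesis unfolding partial_load_def by simp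
qed

lemma partial_load_eq: "k < n \<Longrightarrow> partial_load flows p k = port_load I p k"
  unfolding partial_load_def port_load_def
  using sum_flows_at_port[of k "\<lambda>i j. demand I i j k" p] by simp

lemma partial_load_le:
  assumes "k < n" "z \<le> flows"
  shows "partial_load z p k \<le> 2 ^ \<beta>"
proof -
  have "partial_load z p k \<le> partial_load flows p k"
    unfolding partial_load_def using assms(2) by (intro sum_mono2) auto
  then show ?thesis using partial_load_eq[OF assms(1)] port_load_le[OF assms(1)]
    by (metis order_trans)
qed

definition loads_are :: "(nat \<Rightarrow> nat \<Rightarrow> nat) \<Rightarrow> memory \<Rightarrow> bool" where
  "loads_are g s \<longleftrightarrow> (\<forall>p<2 * N. \<forall>k<n. s load_array (of_nat (p * n + k)) = of_nat (g p k))"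

lemma run_add_load:
  assumes z: "z < flows" and p: "val e s = of_nat p" "p < 2 * N"
    and s: "all_short s" "indexed_input s" "s flow_var 0 = of_nat z" "loads_are g s"
    and g': "\<And>q k. g' q k = g q k +
      (if k = pos z \<and> q = p then demand I (src z) (dst z) k else 0)" "g' p (pos z) \<le> 2 ^ \<beta>"
  shows "runs (add_load e) s (loads_are g')"
proof (rule run_wp[OF s(1)])
  have "s load_array (of_nat (p * n + pos z)) = of_nat (g p (pos z))"
    using s(4) p(2) pos_less[OF z] unfolding loads_are_def by blast
  moreover have "short (of_nat (g' p (pos z)))"
    using g'(2) two_power_input_bits_le by (intro short_of_nat) linarith
  ultimately show "wp bit_bound (add_load e) (loads_are g') s"
    using s(3,4) indexed_inputD(2,4,6)[OF s(2)] z p pos_less[OF z]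
    unfolding add_load_def loads_are_def
    by (auto simp: g'(1) pair_index_eq simp flip: of_nat_add of_nat_mult)
qed

lemma run_load_step:
  assumes z: "z < flows" and s: "all_short s" "indexed_input s" "s flow_var 0 = of_nat z"
    "loads_are (partial_load z) s"
  shows "runs load_step s (loads_are (partial_load (Suc z)))"
  unfolding load_step_def
proof (rule run_Seq)
  define g where "g q k = partial_load z q k +
      (if k = pos z \<and> q = src z then demand I (src z) (dst z) k else 0)" for q k
  have final: "partial_load (Suc z) q k = g q k +
      (if k = pos z \<and> q = N + dst z then demand I (src z) (dst z) k else 0)" for q k
    using src_less[of z] unfolding g_def partial_load_Suc ports_of_def flow_ports_def by auto
  have bound: "partial_load (Suc z) q (pos z) \<le> 2 ^ \<beta>" for q
    using z pos_less[OF z] by (intro partial_load_le) auto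
  show "runs (add_load Source_port) s (loads_are g)"
  proof (rule run_add_load[OF z _ _ s(1,2,3,4) g_def])
    show "g (src z) (pos z) \<le> 2 ^ \<beta>" using bound[of "src z"] unfolding final by linarith
  qed (use s z indexed_inputD(7)[OF s(2)] src_less[of z] in auto)
  fix t assume t: "all_short t" "same_outside (writes (add_load Source_port)) s t" "loads_are g t"
  have input: "indexed_input t" using s(2) t(2) by (rule indexed_input_frame) simp
  have "t flow_var 0 = of_nat z" using same_outsideD[OF t(2)] s(3) by simp
  then show "runs (add_load Destination_port) t (loads_are (partial_load (Suc z)))"
    using indexed_inputD(1,8)[OF input] z dst_less[of z]
    by (intro run_add_load[OF z _ _ t(1) input _ t(3) final bound]) auto
qed

abbreviation loads_stored :: "memory \<Rightarrow> bool" where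
  "loads_stored \<equiv> loads_are (port_load I)"

lemma run_load_prog:
  assumes s: "all_short s" "indexed_input s" "\<And>q. s load_array q = 0"
  shows "runs load_prog s (\<lambda>t. indexed_input t \<and> loads_stored t)"
  unfolding load_prog_def
proof (rule run_conseq)
  show "runs (For flow_var (Var flow_count_var) load_step) s
      (\<lambda>t. indexed_input t \<and> loads_are (partial_load flows) t)"
  proof (rule run_For_flows[OF s(1)])
    show "indexed_input t" if "same_outside (insert flow_var (writes load_step)) s t" for t
      using s(2) that by (rule indexed_input_frame) simp
    show "runs load_step t (loads_are (partial_load (Suc z)))"
      if "z < flows" "all_short t" "indexed_input t" "t flow_var 0 = of_nat z"
        "loads_are (partial_load z) t" for z t
      using that by (rule run_load_step)
  qed (use s(3) in \<open>auto simp: loads_are_def partial_load_def\<close>)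
qed (auto simp: loads_are_def partial_load_eq)

end


subsection \<open>Computing the order\<close>

abbreviation Load :: "exp \<Rightarrow> exp \<Rightarrow> exp" where
  "Load e f \<equiv> Cell load_array (Add (Mul e Coflows) (Cell order_array f))"
abbreviation Weight :: "exp \<Rightarrow> exp" where
  "Weight e \<equiv> Cell weight_array (Cell order_array e)"

definition init_order_prog :: prog where
  "init_order_prog = For pos_var Coflows (Assign order_array (Var pos_var) (Var pos_var))"

definition sum_step :: prog where
  "sum_step = set_var sum_var (Add (Var sum_var) (Load (Var port_var) (Var pos_var)))"

definition sum_prog :: prog where
  "sum_prog = Seq (set_var sum_var (Const 0)) (For pos_var (Add (Var last_var) (Const 1)) sum_step)"

definition max_step :: prog where
  "max_step = IfLess (Var peak_var) (Var sum_var)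
     (Seq (set_var peak_var (Var sum_var)) (set_var peak_port_var (Var port_var))) Skip"

definition peak_prog :: prog where
  "peak_prog = Seq (Seq (set_var peak_var (Const 0)) (set_var peak_port_var (Const 0)))
     (For port_var (Mul (Const 2) Ports) (Seq sum_prog max_step))"

definition select_step :: prog where
  "select_step = IfLess
     (Mul (Weight (Var pos_var)) (Load (Var peak_port_var) (Var best_var)))
     (Mul (Weight (Var best_var)) (Load (Var peak_port_var) (Var pos_var)))
     (set_var best_var (Var pos_var)) Skip"

definition select_prog :: prog where
  "select_prog = Seq (set_var best_var (Const 0))
     (For pos_var (Add (Var last_var) (Const 1)) select_step)"

definition reduce_step :: prog where
  "reduce_step = Assign weight_array (Cell order_array (Var pos_var))
     (Sub (Weight (Var pos_var)) (Mul (Var ratio_var) (Load (Var peak_port_var) (Var pos_var))))"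

definition reduce_prog :: prog where
  "reduce_prog = Seq
     (set_var ratio_var (Div (Weight (Var best_var)) (Load (Var peak_port_var) (Var best_var))))
     (For pos_var (Add (Var last_var) (Const 1)) reduce_step)"

definition swap_prog :: prog where
  "swap_prog = Seq (set_var swap_var (Cell order_array (Var best_var)))
     (Seq (Assign order_array (Var best_var) (Cell order_array (Var last_var)))
       (Assign order_array (Var last_var) (Var swap_var)))"

definition round_prog :: prog where
  "round_prog = Seq (set_var last_var (Sub (Sub Coflows (Var round_var)) (Const 1)))
     (Seq peak_prog (Seq select_prog (Seq reduce_prog swap_prog)))"

definition order_prog :: prog where
  "order_prog = Seq init_order_prog (For round_var Coflows round_prog)"

lemma writes_order_progs [simp]:
  "writes init_order_prog = {order_array, pos_var}"
  "writes sum_step = {sum_var}"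
  "writes sum_prog = {pos_var, sum_var}"
  "writes max_step = {peak_var, peak_port_var}"
  "writes peak_prog = {pos_var, port_var, sum_var, peak_var, peak_port_var}"
  "writes select_step = {best_var}"
  "writes select_prog = {pos_var, best_var}"
  "writes reduce_step = {weight_array}"
  "writes reduce_prog = {weight_array, pos_var, ratio_var}"
  "writes swap_prog = {order_array, swap_var}"
  "writes round_prog = {weight_array, order_array, pos_var, last_var, port_var, sum_var, peak_var,
     peak_port_var, best_var, ratio_var, swap_var}"
  "writes order_prog = {weight_array, order_array, pos_var, round_var, last_var, port_var, sum_var,
     peak_var, peak_port_var, best_var, ratio_var, swap_var}"
  by (auto simp: init_order_prog_def sum_step_def sum_prog_def max_step_def peak_prog_def
      select_step_def select_prog_def reduce_step_def reduce_prog_def swap_prog_def round_prog_def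
      order_prog_def)

context valid_coflow_instance
begin

definition order_stored :: "(nat \<Rightarrow> nat) \<Rightarrow> memory \<Rightarrow> bool" where
  "order_stored \<pi> s \<longleftrightarrow> (\<forall>x<n. s order_array (of_nat x) = of_nat (\<pi> x))"

definition round_state :: "(nat \<Rightarrow> nat) \<Rightarrow> nat \<Rightarrow> memory \<Rightarrow> bool" where
  "round_state \<pi> m s \<longleftrightarrow> indexed_input s \<and> loads_stored s \<and> order_stored \<pi> s \<and>
     s last_var 0 = of_nat m"

lemma loaded_input_determined_by: "determined_by (\<lambda>s. indexed_input s \<and> loads_stored s)
    {header_array, demand_array, release_array, load_array, pos_array, src_array, dst_array,
     flow_count_var}"
  by (simp add: determined_by_def indexed_input_def input_kept_def indexed_def loads_are_def)

lemma round_state_determined_by: "determined_by (round_state \<pi> m)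
    {header_array, demand_array, release_array, load_array, pos_array, src_array, dst_array,
     order_array, flow_count_var, last_var}"
  by (simp add: determined_by_def round_state_def indexed_input_def input_kept_def indexed_def
      loads_are_def order_stored_def)

lemmas loaded_input_frame = determined_by_frame[OF loaded_input_determined_by]
  and round_state_frame = determined_by_frame[OF round_state_determined_by]

lemma val_load:
  assumes "indexed_input s" "loads_stored s" "order_stored \<pi> s" "\<pi> x < n" "x < n" "p < 2 * N"
    "val e s = of_nat p" "val f s = of_nat x"
  shows "val (Load e f) s = of_nat (port_load I p (\<pi> x))"
proof -
  have "val (Add (Mul e Coflows) (Cell order_array f)) s = of_nat (p * n + \<pi> x)"
    using assms indexed_inputD(2)[OF assms(1)] unfolding order_stored_def by simp
  then show ?thesis using assms(2,4,6) unfolding loads_are_def by simp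
qed

lemma run_init_order_prog:
  assumes s: "all_short s" "indexed_input s"
  shows "runs init_order_prog s (order_stored id)"
  unfolding init_order_prog_def
proof (rule run_conseq)
  let ?c = "Assign order_array (Var pos_var) (Var pos_var)"
  show "runs (For pos_var Coflows ?c) s
      (\<lambda>t. indexed_input t \<and> (\<forall>x<n. t order_array (of_nat x) = of_nat x))"
  proof (rule run_For)
    show "indexed_input t" if "same_outside (insert pos_var (writes ?c)) s t" for t
      using s(2) that by (rule indexed_input_frame) simp
    show "runs ?c t (\<lambda>t. \<forall>y<Suc x. t order_array (of_nat y) = of_nat y)"
      if "x < n" "all_short t" "t pos_var 0 = of_nat x" "\<forall>y<x. t order_array (of_nat y) = of_nat y"
        for x t
    proof (rule run_wp[OF that(2)])
      have "short (of_nat x)" using that(1) counts_le(1) by (intro short_of_nat) linarith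
      then show "wp bit_bound ?c (\<lambda>t. \<forall>y<Suc x. t order_array (of_nat y) = of_nat y) t"
        using that by (auto simp: less_Suc_eq)
    qed
  qed (use s(1) loop_bounds(1) counts_le(1) in
      \<open>auto simp: indexed_inputD(2) intro: le_two_power_bit_boundI\<close>)
qed (auto simp: order_stored_def)

text \<open>Besides the local-ratio invariant after \<open>t\<close> rounds, the residual weights have a common
  denominator that grows by the factor of one load in each round.\<close>

definition reduced :: "nat \<Rightarrow> (nat \<Rightarrow> nat) \<Rightarrow> (nat \<Rightarrow> rat) \<Rightarrow> bool" where
  "reduced t \<pi> v \<longleftrightarrow> local_ratio_inv (n - t) \<pi> (\<lambda>k. real_of_rat (v k)) \<and>
     (\<exists>D::int. 0 < D \<and> D \<le> 2 ^ (\<beta> * (t + 1)) \<and> (\<forall>k<n. v k * of_int D \<in> \<int>))"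

lemma reduced_init: "reduced 0 id (weight I)"
proof -
  obtain D where "0 < D" "D \<le> 2 ^ \<beta>" "\<And>k. k \<in> {..<n} \<Longrightarrow> weight I k * of_int D \<in> \<int>"
    by (rule common_denominator[OF _ input_bits_parts(6)]) auto
  then show ?thesis unfolding reduced_def using local_ratio_inv_init by auto
qed

lemma reducedD:
  assumes "reduced t \<pi> v" "x < n - t"
  shows "0 \<le> v (\<pi> x)" "v (\<pi> x) \<le> weight I (\<pi> x)"
  using local_ratio_invD(2,3)[of "n - t" \<pi> "\<lambda>k. real_of_rat (v k)" x] assms unfolding reduced_def
  by (simp_all add: of_rat_less_eq)

lemma reduced_bij: "reduced t \<pi> v \<Longrightarrow> bij_betw \<pi> {..<n} {..<n}"
  unfolding reduced_def by (auto dest: local_ratio_invD)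

context
  fixes t m b p :: nat and \<pi> :: "nat \<Rightarrow> nat" and v v' :: "nat \<Rightarrow> rat" and \<theta> :: rat
  assumes reduced: "reduced t \<pi> v" and m: "n - t = Suc m" and b: "b \<le> m" and p: "p < 2 * N"
    and peak_port: "(\<Sum>k\<in>\<pi> ` {..<Suc m}. port_load I p k) = peak (\<pi> ` {..<Suc m})"
    and min: "min_ratio (\<lambda>x. v (\<pi> x)) (\<lambda>x. port_load I p (\<pi> x)) b (Suc m)"
  defines "\<theta> \<equiv> v (\<pi> b) / of_nat (port_load I p (\<pi> b))"
    and "v' \<equiv> \<lambda>k. if k \<in> \<pi> ` {..<Suc m} then v k - \<theta> * of_nat (port_load I p k) else v k"
begin

lemma reduced_position_less: "x \<le> m \<Longrightarrow> \<pi> x < n"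
  using bij_betwE[OF reduced_bij[OF reduced]] m by simp

lemmas residual = min_ratio_residual[OF min, folded \<theta>_def]

lemma residual_nonneg: "k \<in> \<pi> ` {..<Suc m} \<Longrightarrow> 0 \<le> v' k"
  using residual(3) b reducedD(1)[OF reduced] m unfolding v'_def by auto

lemma residual_denominator:
  obtains D :: int
    where "0 < D" "D \<le> 2 ^ (\<beta> * (t + 2))" "\<theta> * of_int D \<in> \<int>" "\<And>k. k < n \<Longrightarrow> v' k * of_int D \<in> \<int>"
proof -
  obtain D :: int where D: "0 < D" "D \<le> 2 ^ (\<beta> * (t + 1))" "\<And>k. k \<in> {..<n} \<Longrightarrow> v k * of_int D \<in> \<int>"
    using reduced unfolding reduced_def by auto
  have chosen: "\<pi> b \<in> {..<n}" using reduced_position_less[OF b] by simp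
  obtain D' :: int where D': "0 < D'" "D' \<le> 2 ^ (\<beta> * (t + 1) + \<beta>)" "\<theta> * of_int D' \<in> \<int>"
    "\<And>k. k \<in> {..<n} \<Longrightarrow> v k * of_int D' \<in> \<int>"
    "\<And>k. k \<in> {..<n} \<Longrightarrow> (v k - \<theta> * of_nat (port_load I p k)) * of_int D' \<in> \<int>"
    using residual_common_denominator[of D "\<beta> * (t + 1)" "{..<n}" v "\<pi> b" "port_load I p" \<beta>,
        OF D chosen port_load_le[OF reduced_position_less[OF b]], folded \<theta>_def] by blast
  have "D' \<le> 2 ^ (\<beta> * (t + 2))" using D'(2) by (simp add: algebra_simps)
  then show thesis using that[of D'] D' unfolding v'_def by simp
qed

lemma short_residual: "short \<theta>" "x \<le> m \<Longrightarrow> short (v' (\<pi> x))"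
proof -
  obtain D :: int where D: "0 < D" "D \<le> 2 ^ (\<beta> * (t + 2))" "\<theta> * of_int D \<in> \<int>"
    "\<And>k. k < n \<Longrightarrow> v' k * of_int D \<in> \<int>" by (rule residual_denominator) blast
  have "t + 2 \<le> \<beta> + 1" using m coflows_le_input_bits by linarith
  then have "\<beta> * (t + 2) \<le> \<beta> * (\<beta> + 1)" by (rule mult_le_mono2)
  then have bits: "\<beta> * (t + 2) + \<beta> \<le> bit_bound"
    by (simp add: bit_bound_def power2_eq_square algebra_simps)
  have weight_short: "v (\<pi> y) \<le> 2 ^ \<beta>" if "y \<le> m" for y
    using reducedD(2)[OF reduced, of y] weight_le[OF reduced_position_less[OF that]] m that by simp
  have nonneg: "\<And>x. x < Suc m \<Longrightarrow> 0 \<le> v (\<pi> x)" using reducedD(1)[OF reduced] m by simp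
  have b': "b < Suc m" using b by simp
  have "\<bar>\<theta>\<bar> \<le> 2 ^ \<beta>" using residual(1,2)[OF b' nonneg] weight_short[OF b] by simp
  then show "short \<theta>" using fits_if_common_denominator[OF D(3,1,2)] bits fits_mono by blast
  show "short (v' (\<pi> x))" if "x \<le> m"
  proof -
    have "0 \<le> \<theta> * of_nat (port_load I p (\<pi> x))" using residual(1)[OF b' nonneg] by simp
    then have "v' (\<pi> x) \<le> v (\<pi> x)" unfolding v'_def by simp
    then have "\<bar>v' (\<pi> x)\<bar> \<le> 2 ^ \<beta>"
      using residual_nonneg[of "\<pi> x"] weight_short[OF that] that by auto
    then show ?thesis
      using fits_if_common_denominator[OF D(4)[OF reduced_position_less[OF that]] D(1,2)] bits
        fits_mono by blast
  qed
qed

lemma reduced_Suc: "reduced (Suc t) (\<pi> \<circ> Transposition.transpose b m) v'"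
proof -
  let ?\<rho> = "\<pi> \<circ> Transposition.transpose b m"
  have image: "?\<rho> ` {..<Suc m} = \<pi> ` {..<Suc m}"
    unfolding image_comp[symmetric] using b by (subst transpose_image_eq) auto
  have b': "b < Suc m" and nonneg: "\<And>x. x < Suc m \<Longrightarrow> 0 \<le> v (\<pi> x)"
    using b reducedD(1)[OF reduced] m by auto
  have "local_ratio_inv m ?\<rho> (\<lambda>k. real_of_rat (v' k))"
  proof (rule local_ratio_inv_step[where p = p and \<theta> = "real_of_rat \<theta>"
        and v = "\<lambda>k. real_of_rat (v k)"])
    show "local_ratio_inv (Suc m) ?\<rho> (\<lambda>k. real_of_rat (v k))"
      using reduced b m unfolding reduced_def by (intro local_ratio_inv_transpose) auto
    show "(\<Sum>k\<in>?\<rho> ` {..<Suc m}. port_load I p k) = peak (?\<rho> ` {..<Suc m})"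
      unfolding image by (rule peak_port)
    show "0 \<le> real_of_rat \<theta>" using residual(1)[OF b' nonneg] by simp
    show "real_of_rat (v' k) = real_of_rat (v k) - real_of_rat \<theta> * real (port_load I p k)"
      if "k \<in> ?\<rho> ` {..<Suc m}" for k
      using that unfolding image v'_def by (simp add: of_rat_diff of_rat_mult)
    show "0 \<le> real_of_rat (v' k)" if "k \<in> ?\<rho> ` {..<Suc m}" for k
      using residual_nonneg[of k] that unfolding image by simp
    have "v' (\<pi> b) = 0 \<or> (\<forall>x<Suc m. port_load I p (\<pi> x) = 0)"
      using residual(4)[OF b' nonneg] b' unfolding v'_def by auto
    moreover have "peak (\<pi> ` {..<Suc m}) = 0" if "\<forall>x<Suc m. port_load I p (\<pi> x) = 0"
      unfolding peak_port[symmetric] using that by auto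
    ultimately show "real_of_rat (v' (?\<rho> m)) = 0 \<or> peak (?\<rho> ` {..<Suc m}) = 0"
      unfolding image by auto
  qed (use m p in auto)
  moreover obtain D :: int where "0 < D" "D \<le> 2 ^ (\<beta> * (t + 2))" "\<And>k. k < n \<Longrightarrow> v' k * of_int D \<in> \<int>"
    by (rule residual_denominator) blast
  moreover have "n - Suc t = m" using m by simp
  ultimately show ?thesis unfolding reduced_def by auto
qed

end

end

context coflow_order
begin

definition prefix_load :: "nat \<Rightarrow> nat \<Rightarrow> nat" where
  "prefix_load p y = (\<Sum>x<y. port_load I p (\<pi> x))"

lemma prefix_load_eq: "y \<le> n \<Longrightarrow> prefix_load p y = (\<Sum>k\<in>\<pi> ` {..<y}. port_load I p k)"
  unfolding prefix_load_def using inj_on_\<pi> by (simp add: sum.reindex)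

lemma short_prefix_load:
  assumes "y \<le> n"
  shows "short (of_nat (prefix_load p y))"
proof (rule short_of_nat)
  have "prefix_load p y \<le> (\<Sum>x<y. 2 ^ \<beta>)"
    unfolding prefix_load_def using assms \<pi>_less by (intro sum_mono port_load_le) auto
  also have "\<dots> = y * 2 ^ \<beta>" by simp
  also have "\<dots> \<le> 2 ^ \<beta> * 2 ^ \<beta>"
    using assms coflows_le_input_bits less_exp[of \<beta>] by (intro mult_right_mono) linarith+
  also have "\<dots> = 2 ^ (\<beta> + \<beta>)" by (simp add: power_add)
  also have "\<dots> \<le> 2 ^ (3 * \<beta> + 2)" by (rule two_power_mono) simp
  finally show "prefix_load p y \<le> 2 ^ (3 * \<beta> + 2)" .
qed

context
  fixes m :: nat
  assumes m: "m < n"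
begin

lemma val_load_round:
  assumes "round_state \<pi> m s" "p < 2 * N" "x \<le> m" "val e s = of_nat p" "val f s = of_nat x"
  shows "val (Load e f) s = of_nat (port_load I p (\<pi> x))"
  using assms m \<pi>_less[of x] unfolding round_state_def by (intro val_load) auto

lemma round_stateD:
  assumes "round_state \<pi> m s"
  shows "indexed_input s" "s last_var 0 = of_nat m"
    "x \<le> m \<Longrightarrow> s order_array (of_nat x) = of_nat (\<pi> x)"
  using assms m unfolding round_state_def order_stored_def by auto

lemma run_For_positions:
  assumes s: "all_short s" "Inv 0 s" "round_state \<pi> m s"
    and written: "writes c \<inter> {header_array, demand_array, release_array, load_array, pos_array,
      src_array, dst_array, order_array, flow_count_var, last_var, pos_var} = {}"
    and counter: "\<And>x t v. Inv x (t(pos_var := v)) = Inv x t"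
    and step: "\<And>x t. x \<le> m \<Longrightarrow> all_short t \<Longrightarrow> round_state \<pi> m t \<Longrightarrow>
      same_outside (insert pos_var (writes c)) s t \<Longrightarrow> t pos_var 0 = of_nat x \<Longrightarrow> Inv x t \<Longrightarrow>
      runs c t (Inv (Suc x))"
  shows "runs (For pos_var (Add (Var last_var) (Const 1)) c) s (Inv (Suc m))"
proof (rule run_conseq)
  let ?P = "\<lambda>t. same_outside (insert pos_var (writes c)) s t"
  have state: "round_state \<pi> m t" if "?P t" for t
    using s(3) that by (rule round_state_frame) (use written in auto)
  show "runs (For pos_var (Add (Var last_var) (Const 1)) c) s (\<lambda>t. ?P t \<and> Inv (Suc m) t)"
  proof (rule run_For[OF s(1)])
    show "val (Add (Var last_var) (Const 1)) t = of_nat (Suc m)" if "?P t" for t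
      using round_stateD(2)[OF state[OF that]] by simp
    show "Suc m \<le> loop_bound" "Suc m \<le> 2 ^ bit_bound"
      using m loop_bounds(1) le_two_power_bit_boundI[OF counts_le(1)] by linarith+
    show "Inv x (t(pos_var := v)) = Inv x t" for x t v by (rule counter)
  qed (use s(2) written step state in auto)
qed simp

lemma run_sum_step:
  assumes s: "all_short s" "round_state \<pi> m s" "s port_var 0 = of_nat p" "s pos_var 0 = of_nat x"
    "s sum_var 0 = of_nat (prefix_load p x)" and p: "p < 2 * N" and x: "x \<le> m"
  shows "runs sum_step s (\<lambda>t. t sum_var 0 = of_nat (prefix_load p (Suc x)))"
proof (rule run_wp[OF s(1)])
  have "val (Load (Var port_var) (Var pos_var)) s = of_nat (port_load I p (\<pi> x))"
    using s(2-4) p x by (intro val_load_round) auto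
  moreover have "short (of_nat (prefix_load p (Suc x)))" using x m by (intro short_prefix_load) simp
  ultimately show "wp bit_bound sum_step (\<lambda>t. t sum_var 0 = of_nat (prefix_load p (Suc x))) s"
    using s(5) unfolding sum_step_def set_var_def by (simp add: prefix_load_def)
qed

lemma run_sum_prog:
  assumes s: "all_short s" "round_state \<pi> m s" "s port_var 0 = of_nat p" and p: "p < 2 * N"
  shows "runs sum_prog s (\<lambda>t. t sum_var 0 = of_nat (prefix_load p (Suc m)))"
  unfolding sum_prog_def
proof (rule run_Seq_wp[OF s(1)])
  let ?loop = "For pos_var (Add (Var last_var) (Const 1)) sum_step"
  let ?Inv = "\<lambda>x t. t sum_var 0 = of_nat (prefix_load p x)"
  let ?t = "s(sum_var := (s sum_var)(0 := 0))"
  have "runs ?loop ?t (?Inv (Suc m))" if short: "all_short ?t"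
  proof (rule run_For_positions[OF short])
    show "round_state \<pi> m ?t"
      by (rule round_state_frame[OF s(2), of "{sum_var}"]) (auto simp: same_outside_def)
    show "runs sum_step r (?Inv (Suc x))" if x: "x \<le> m" and r: "all_short r" "round_state \<pi> m r"
      "same_outside (insert pos_var (writes sum_step)) ?t r" "r pos_var 0 = of_nat x" "?Inv x r"
      for x r
    proof -
      have "r port_var 0 = of_nat p" using same_outsideD[OF r(3), of port_var] s(3) by simp
      then show ?thesis by (rule run_sum_step[OF r(1,2) _ r(4,5) p x])
    qed
  qed (auto simp: prefix_load_def)
  then show "wp bit_bound (set_var sum_var (Const 0))
      (\<lambda>t. all_short t \<longrightarrow> runs ?loop t (?Inv (Suc m))) s"
    unfolding set_var_def by simp
qed

definition best_port :: "nat \<Rightarrow> memory \<Rightarrow> bool" where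
  "best_port q s \<longleftrightarrow> (\<exists>p<2 * N. \<exists>y\<le>prefix_load p (Suc m). s peak_port_var 0 = of_nat p \<and>
     s peak_var 0 = of_nat y \<and> (\<forall>r<q. prefix_load r (Suc m) \<le> y))"

lemma run_max_step:
  assumes s: "all_short s" "s port_var 0 = of_nat q" "s sum_var 0 = of_nat (prefix_load q (Suc m))"
    "best_port q s" and q: "q < 2 * N"
  shows "runs max_step s (best_port (Suc q))"
proof (rule run_wp[OF s(1)])
  obtain p y where py: "p < 2 * N" "y \<le> prefix_load p (Suc m)" "s peak_port_var 0 = of_nat p"
    "s peak_var 0 = of_nat y" "\<forall>r<q. prefix_load r (Suc m) \<le> y"
    using s(4) unfolding best_port_def by blast
  have "short (of_nat (prefix_load q (Suc m)))" using m by (intro short_prefix_load) simp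
  moreover have "short (of_nat q)" using q counts_le(2) by (intro short_of_nat) linarith
  moreover have "best_port (Suc q) t" if "y < prefix_load q (Suc m)" "t peak_port_var 0 = of_nat q"
    "t peak_var 0 = of_nat (prefix_load q (Suc m))" for t
    unfolding best_port_def using that q py(5)
    by (intro exI[of _ q] conjI exI[of _ "prefix_load q (Suc m)"]) (auto simp: less_Suc_eq)
  moreover have "best_port (Suc q) s" if "prefix_load q (Suc m) \<le> y"
    unfolding best_port_def using that py by (auto simp: less_Suc_eq)
  ultimately show "wp bit_bound max_step (best_port (Suc q)) s"
    using s(2,3) py(4) unfolding max_step_def set_var_def by simp
qed

lemma best_port_peak:
  assumes "best_port (2 * N) s"
  shows "\<exists>p<2 * N. s peak_port_var 0 = of_nat p \<and>
    (\<Sum>k\<in>\<pi> ` {..<Suc m}. port_load I p k) = peak (\<pi> ` {..<Suc m})"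
proof -
  obtain p y where p: "p < 2 * N" "y \<le> prefix_load p (Suc m)" "s peak_port_var 0 = of_nat p"
    "\<forall>r<2 * N. prefix_load r (Suc m) \<le> y"
    using assms unfolding best_port_def by blast
  have "prefix_load p (Suc m) = peak (\<pi> ` {..<Suc m})"
    using p(2,4) m unfolding prefix_load_eq[OF Suc_leI[OF m]]
    by (intro peak_eqI[OF p(1)]) (meson order_trans)
  then show ?thesis using p(1,3) m by (auto simp: prefix_load_eq)
qed

lemma run_peak_prog:
  assumes s: "all_short s" "round_state \<pi> m s"
  shows "runs peak_prog s (best_port (2 * N))"
  unfolding peak_prog_def
proof (rule run_Seq_wp[OF s(1)])
  let ?c = "Seq sum_prog max_step"
  let ?loop = "For port_var (Mul (Const 2) Ports) ?c"
  have "runs ?loop t (best_port (2 * N))"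
    if t: "all_short t" "same_outside {peak_var, peak_port_var} s t" "best_port 0 t" for t
  proof (rule run_conseq)
    show "runs ?loop t (\<lambda>r. round_state \<pi> m r \<and> best_port (2 * N) r)"
    proof (rule run_For[OF t(1)])
      have "round_state \<pi> m t" using s(2) t(2) by (rule round_state_frame) simp
      then show "round_state \<pi> m r" if "same_outside (insert port_var (writes ?c)) t r" for r
        using that by (rule round_state_frame) simp
      show "val (Mul (Const 2) Ports) r = of_nat (2 * N)" if "round_state \<pi> m r" for r
        using indexed_inputD(1)[OF round_stateD(1)[OF that]] by simp
      show "runs ?c r (best_port (Suc q))" if q: "q < 2 * N"
        and r: "all_short r" "round_state \<pi> m r"
        "r port_var 0 = of_nat q" "best_port q r" for q r
      proof (rule run_Seq[OF run_sum_prog[OF r(1,2,3) q]])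
        fix r' assume r': "all_short r'" "same_outside (writes sum_prog) r r'"
          "r' sum_var 0 = of_nat (prefix_load q (Suc m))"
        then show "runs max_step r' (best_port (Suc q))"
          using same_outsideD[OF r'(2)] r(3,4) q by (intro run_max_step) (auto simp: best_port_def)
      qed
    qed (use t(3) loop_bounds(2) counts_le(2) m in
        \<open>auto simp: best_port_def intro: le_two_power_bit_boundI\<close>)
  qed simp
  then show "wp bit_bound (Seq (set_var peak_var (Const 0)) (set_var peak_port_var (Const 0)))
      (\<lambda>t. all_short t \<longrightarrow> runs ?loop t (best_port (2 * N))) s"
    using ports_pos unfolding set_var_def by (auto simp: same_outside_def best_port_def)
qed

definition best_position :: "(nat \<Rightarrow> rat) \<Rightarrow> nat \<Rightarrow> nat \<Rightarrow> memory \<Rightarrow> bool" where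
  "best_position v p y s \<longleftrightarrow> (\<exists>b\<le>m. s best_var 0 = of_nat b \<and>
     min_ratio (\<lambda>x. v (\<pi> x)) (\<lambda>x. port_load I p (\<pi> x)) b y)"

lemma run_select_step:
  assumes s: "all_short s" "round_state \<pi> m s" "s peak_port_var 0 = of_nat p"
    "s pos_var 0 = of_nat y" "best_position v p y s"
    and weight: "\<And>k. k < n \<Longrightarrow> s weight_array (of_nat k) = v k"
    and p: "p < 2 * N" and y: "y \<le> m" and nonneg: "\<And>x. x \<le> m \<Longrightarrow> 0 \<le> v (\<pi> x)"
  shows "runs select_step s (best_position v p (Suc y))"
proof (rule run_wp[OF s(1)])
  let ?u = "\<lambda>x. v (\<pi> x)" and ?a = "\<lambda>x. port_load I p (\<pi> x)"
  obtain b where b: "b \<le> m" "s best_var 0 = of_nat b" "min_ratio ?u ?a b y"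
    using s(5) unfolding best_position_def by blast
  have "val (Load (Var peak_port_var) (Var best_var)) s = of_nat (?a b)"
    "val (Load (Var peak_port_var) (Var pos_var)) s = of_nat (?a y)"
    using s(2-4) b(1,2) y p by (intro val_load_round; simp)+
  moreover have "s weight_array (of_nat (\<pi> b)) = ?u b" "s weight_array (of_nat (\<pi> y)) = ?u y"
    using weight \<pi>_less b(1) y m by simp_all
  moreover have "short (of_nat y)" using y m counts_le(1) by (intro short_of_nat) linarith
  moreover have "min_ratio ?u ?a y (Suc y)" if "?u y * of_nat (?a b) < ?u b * of_nat (?a y)"
    using b(3) that nonneg b(1) y by (intro min_ratio_Suc_replace) auto
  moreover have "min_ratio ?u ?a b (Suc y)" if "\<not> ?u y * of_nat (?a b) < ?u b * of_nat (?a y)"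
    using b(3) that by (intro min_ratio_Suc_keep) auto
  ultimately show "wp bit_bound select_step (best_position v p (Suc y)) s"
    using b(1,2) s(4) y round_stateD(3)[OF s(2)]
    unfolding select_step_def set_var_def best_position_def by auto
qed

lemma run_select_prog:
  assumes s: "all_short s" "round_state \<pi> m s" "s peak_port_var 0 = of_nat p"
    and weight: "\<And>k. k < n \<Longrightarrow> s weight_array (of_nat k) = v k"
    and p: "p < 2 * N" and nonneg: "\<And>x. x \<le> m \<Longrightarrow> 0 \<le> v (\<pi> x)"
  shows "runs select_prog s (best_position v p (Suc m))"
  unfolding select_prog_def
proof (rule run_Seq_wp[OF s(1)])
  let ?loop = "For pos_var (Add (Var last_var) (Const 1)) select_step"
  let ?t = "s(best_var := (s best_var)(0 := 0))"
  have "runs ?loop ?t (best_position v p (Suc m))" if short: "all_short ?t"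
  proof (rule run_For_positions[OF short])
    show "round_state \<pi> m ?t"
      by (rule round_state_frame[OF s(2), of "{best_var}"]) (auto simp: same_outside_def)
    show "runs select_step r (best_position v p (Suc y))"
      if y: "y \<le> m" and r: "all_short r" "round_state \<pi> m r"
        "same_outside (insert pos_var (writes select_step)) ?t r" "r pos_var 0 = of_nat y"
        "best_position v p y r" for y r
    proof -
      have "r weight_array = s weight_array" "r peak_port_var 0 = of_nat p"
        using same_outsideD[OF r(3)] s(3) by simp_all
      then show ?thesis using weight
        by (intro run_select_step[OF r(1,2) _ r(4,5) _ p y nonneg]) auto
    qed
  qed (auto simp: best_position_def)
  then show "wp bit_bound (set_var best_var (Const 0))
      (\<lambda>t. all_short t \<longrightarrow> runs ?loop t (best_position v p (Suc m))) s"
    unfolding set_var_def by simp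
qed

lemma run_reduce_step:
  assumes s: "all_short s" "round_state \<pi> m s" "s peak_port_var 0 = of_nat p" "s ratio_var 0 = \<theta>"
    "s pos_var 0 = of_nat y" and p: "p < 2 * N" and y: "y \<le> m"
    and weight: "\<And>k. k < n \<Longrightarrow> s weight_array (of_nat k) = (if k \<in> \<pi> ` {..<y} then v' k else v k)"
    and v': "v' (\<pi> y) = v (\<pi> y) - \<theta> * of_nat (port_load I p (\<pi> y))" "short (v' (\<pi> y))"
  shows "runs reduce_step s
    (\<lambda>t. \<forall>k<n. t weight_array (of_nat k) = (if k \<in> \<pi> ` {..<Suc y} then v' k else v k))"
proof (rule run_wp[OF s(1)])
  have "\<pi> y \<notin> \<pi> ` {..<y}"
    using inj_onD[OF inj_on_\<pi>[OF order_refl], of y] y m by fastforce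
  then have "s weight_array (of_nat (\<pi> y)) = v (\<pi> y)" using weight[of "\<pi> y"] y m \<pi>_less[of y]
    by simp
  moreover have "val (Load (Var peak_port_var) (Var pos_var)) s = of_nat (port_load I p (\<pi> y))"
    using s(2,3,5) y p by (intro val_load_round) auto
  ultimately show "wp bit_bound reduce_step
      (\<lambda>t. \<forall>k<n. t weight_array (of_nat k) = (if k \<in> \<pi> ` {..<Suc y} then v' k else v k)) s"
    using s(4,5) round_stateD(3)[OF s(2) y] weight v' unfolding reduce_step_def
    by (auto simp: less_Suc_eq lessThan_Suc)
qed

lemma run_reduce_prog:
  assumes s: "all_short s" "round_state \<pi> m s" "s peak_port_var 0 = of_nat p"
    "s best_var 0 = of_nat b"
    and p: "p < 2 * N" and b: "b \<le> m"
    and weight: "\<And>k. k < n \<Longrightarrow> s weight_array (of_nat k) = v k"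
    and \<theta>: "\<theta> = v (\<pi> b) / of_nat (port_load I p (\<pi> b))" "short \<theta>"
    and v': "\<And>k. v' k = (if k \<in> \<pi> ` {..<Suc m} then v k - \<theta> * of_nat (port_load I p k) else v k)"
      "\<And>x. x \<le> m \<Longrightarrow> short (v' (\<pi> x))"
  shows "runs reduce_prog s (\<lambda>t. \<forall>k<n. t weight_array (of_nat k) = v' k)"
  unfolding reduce_prog_def
proof (rule run_Seq_wp[OF s(1)])
  let ?loop = "For pos_var (Add (Var last_var) (Const 1)) reduce_step"
  let ?Inv = "\<lambda>y t. \<forall>k<n. t weight_array (of_nat k) = (if k \<in> \<pi> ` {..<y} then v' k else v k)"
  let ?t = "s(ratio_var := (s ratio_var)(0 := \<theta>))"
  have "runs ?loop ?t (?Inv (Suc m))" if short: "all_short ?t"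
  proof (rule run_For_positions[where Inv = ?Inv, OF short])
    show "round_state \<pi> m ?t"
      by (rule round_state_frame[OF s(2), of "{ratio_var}"]) (auto simp: same_outside_def)
    show "runs reduce_step r (?Inv (Suc y))" if y: "y \<le> m" and r: "all_short r" "round_state \<pi> m r"
      "same_outside (insert pos_var (writes reduce_step)) ?t r" "r pos_var 0 = of_nat y" "?Inv y r"
      for y r
    proof (rule run_reduce_step[OF r(1,2) _ _ r(4) p y])
      show "r ratio_var 0 = \<theta>" "r peak_port_var 0 = of_nat p"
        using same_outsideD[OF r(3)] s(3) by simp_all
    qed (use r(5) y v' in auto)
  qed (auto simp: weight)
  then have "runs ?loop ?t (\<lambda>r. \<forall>k<n. r weight_array (of_nat k) = v' k)" if "all_short ?t"
    by (rule run_conseq) (use that in \<open>auto simp: v'(1)\<close>)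
  moreover have "val (Load (Var peak_port_var) (Var best_var)) s = of_nat (port_load I p (\<pi> b))"
    using s(2-4) b p by (intro val_load_round) auto
  moreover have "val (Weight (Var best_var)) s = v (\<pi> b)"
    using round_stateD(3)[OF s(2) b] s(4) weight \<pi>_less[of b] b m by simp
  ultimately show "wp bit_bound
      (set_var ratio_var (Div (Weight (Var best_var)) (Load (Var peak_port_var) (Var best_var))))
      (\<lambda>t. all_short t \<longrightarrow> runs ?loop t (\<lambda>t. \<forall>k<n. t weight_array (of_nat k) = v' k)) s"
    unfolding set_var_def using \<theta> by (simp del: val.simps(2))
qed

lemma run_swap_prog:
  assumes s: "all_short s" "round_state \<pi> m s" "s best_var 0 = of_nat b" and b: "b \<le> m"
  shows "runs swap_prog s (order_stored (\<pi> \<circ> Transposition.transpose b m))"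
proof (rule run_wp[OF s(1)])
  have "short (of_nat (\<pi> x))" if "x < n" for x
    using \<pi>_less[OF that] counts_le(1) by (intro short_of_nat) linarith
  then show "wp bit_bound swap_prog (order_stored (\<pi> \<circ> Transposition.transpose b m)) s"
    using s(2,3) m b unfolding swap_prog_def set_var_def round_state_def order_stored_def
    by (auto simp: Transposition.transpose_def)
qed

end

end

context valid_coflow_instance
begin

definition order_found :: "nat \<Rightarrow> memory \<Rightarrow> bool" where
  "order_found t s \<longleftrightarrow> (\<exists>\<pi> v. reduced t \<pi> v \<and> order_stored \<pi> s \<and>
     (\<forall>k<n. s weight_array (of_nat k) = v k))"

lemma order_foundI:
  assumes "reduced t \<pi> v" "order_stored \<pi> s" "\<And>k. k < n \<Longrightarrow> s weight_array (of_nat k) = v k"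
  shows "order_found t s"
  using assms unfolding order_found_def by blast

lemma run_reduce_swap_prog:
  assumes s: "all_short s" "round_state \<pi> m s" "s peak_port_var 0 = of_nat p"
    "s best_var 0 = of_nat b"
    and weight: "\<And>k. k < n \<Longrightarrow> s weight_array (of_nat k) = v k"
    and reduced: "reduced t \<pi> v" and m: "n - t = Suc m" and b: "b \<le> m" and p: "p < 2 * N"
    and peak_port: "(\<Sum>k\<in>\<pi> ` {..<Suc m}. port_load I p k) = peak (\<pi> ` {..<Suc m})"
    and min: "min_ratio (\<lambda>x. v (\<pi> x)) (\<lambda>x. port_load I p (\<pi> x)) b (Suc m)"
  shows "runs (Seq reduce_prog swap_prog) s (order_found (Suc t))"
proof -
  interpret coflow_order I \<pi> by unfold_locales (rule reduced_bij[OF reduced])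
  define \<theta> where "\<theta> = v (\<pi> b) / of_nat (port_load I p (\<pi> b))"
  define v' where "v' k =
    (if k \<in> \<pi> ` {..<Suc m} then v k - \<theta> * of_nat (port_load I p k) else v k)" for k
  note residual = short_residual[OF reduced m b p peak_port min, folded \<theta>_def, folded v'_def]
  have m': "m < n" using m by simp
  show ?thesis
  proof (rule run_Seq[OF run_reduce_prog[OF m' s p b weight \<theta>_def residual(1) v'_def residual(2)]])
    fix r assume r: "all_short r" "same_outside (writes reduce_prog) s r"
      "\<forall>k<n. r weight_array (of_nat k) = v' k"
    have state: "round_state \<pi> m r" using s(2) r(2) by (rule round_state_frame) simp
    have best: "r best_var 0 = of_nat b" using same_outsideD[OF r(2)] s(4) by simp
    show "runs swap_prog r (order_found (Suc t))"
    proof (rule run_conseq[OF run_swap_prog[OF m' r(1) state best b]])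
      fix r' assume r': "same_outside (writes swap_prog) r r'"
        "order_stored (\<pi> \<circ> Transposition.transpose b m) r'"
      show "order_found (Suc t) r'"
        using reduced_Suc[OF reduced m b p peak_port min, folded \<theta>_def, folded v'_def] r'(2)
      proof (rule order_foundI)
        show "r' weight_array (of_nat k) = v' k" if "k < n" for k
          using that r(3) same_outsideD[OF r'(1)] by simp
      qed
    qed
  qed
qed

lemma run_peak_select_reduce_swap_prog:
  assumes s: "all_short s" "round_state \<pi> m s"
    and weight: "\<And>k. k < n \<Longrightarrow> s weight_array (of_nat k) = v k"
    and reduced: "reduced t \<pi> v" and m: "n - t = Suc m"
  shows "runs (Seq peak_prog (Seq select_prog (Seq reduce_prog swap_prog))) s (order_found (Suc t))"
proof -
  interpret coflow_order I \<pi> by unfold_locales (rule reduced_bij[OF reduced])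
  have m': "m < n" using m by simp
  show ?thesis
  proof (rule run_Seq[OF run_peak_prog[OF m' s]])
    fix r assume r: "all_short r" "same_outside (writes peak_prog) s r" "best_port m (2 * N) r"
    obtain p where p: "p < 2 * N" "r peak_port_var 0 = of_nat p"
      "(\<Sum>k\<in>\<pi> ` {..<Suc m}. port_load I p k) = peak (\<pi> ` {..<Suc m})"
      using best_port_peak[OF m' r(3)] by blast
    have state: "round_state \<pi> m r" using s(2) r(2) by (rule round_state_frame) simp
    have weight_r: "r weight_array (of_nat k) = v k" if "k < n" for k
      using same_outsideD[OF r(2)] weight[OF that] by simp
    have nonneg: "0 \<le> v (\<pi> x)" if "x \<le> m" for x using reducedD(1)[OF reduced] that m by simp
    show "runs (Seq select_prog (Seq reduce_prog swap_prog)) r (order_found (Suc t))"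
    proof (rule run_Seq[OF run_select_prog[OF m' r(1) state p(2) weight_r p(1) nonneg]])
      fix r' assume r': "all_short r'" "same_outside (writes select_prog) r r'"
        "best_position m v p (Suc m) r'"
      obtain b where b: "b \<le> m" "r' best_var 0 = of_nat b"
        "min_ratio (\<lambda>x. v (\<pi> x)) (\<lambda>x. port_load I p (\<pi> x)) b (Suc m)"
        using r'(3) unfolding best_position_def[OF m'] by blast
      have "round_state \<pi> m r'" using state r'(2) by (rule round_state_frame) simp
      moreover have "r' weight_array = r weight_array" "r' peak_port_var 0 = of_nat p"
        using same_outsideD[OF r'(2)] p(2) by simp_all
      ultimately show "runs (Seq reduce_prog swap_prog) r' (order_found (Suc t))"
        using weight_r
        by (intro run_reduce_swap_prog[OF r'(1) _ _ b(2) _ reduced m b(1) p(1,3) b(3)]) auto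
    qed auto
  qed
qed

lemma run_round_prog:
  assumes s: "all_short s" "indexed_input s" "loads_stored s" "s round_var 0 = of_nat t"
    and t: "t < n" and found: "order_found t s"
  shows "runs round_prog s (order_found (Suc t))"
  unfolding round_prog_def
proof (rule run_Seq_wp[OF s(1)])
  define m where "m = n - Suc t"
  obtain \<pi> v where reduced: "reduced t \<pi> v" and order: "order_stored \<pi> s"
    and weight: "\<And>k. k < n \<Longrightarrow> s weight_array (of_nat k) = v k"
    using found unfolding order_found_def by blast
  let ?tail = "Seq peak_prog (Seq select_prog (Seq reduce_prog swap_prog))"
  let ?r = "s(last_var := (s last_var)(0 := of_nat m))"
  have "round_state \<pi> m ?r"
    using s(2,3) order loaded_input_frame[of s "{last_var}" ?r]
    unfolding round_state_def order_stored_def by (simp add: same_outside_def)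
  then have "runs ?tail ?r (order_found (Suc t))" if "all_short ?r"
    using that weight t m_def
    by (intro run_peak_select_reduce_swap_prog[OF _ _ _ reduced]) auto
  moreover have "m \<le> n" unfolding m_def by simp
  then have "short (of_nat m)" using counts_le(1) by (intro short_of_nat) linarith
  moreover have "rat_of_nat n - of_nat t - 1 = of_nat m"
    using t unfolding m_def by (simp add: of_nat_diff)
  ultimately show "wp bit_bound (set_var last_var (Sub (Sub Coflows (Var round_var)) (Const 1)))
      (\<lambda>r. all_short r \<longrightarrow> runs ?tail r (order_found (Suc t))) s"
    using indexed_inputD(2)[OF s(2)] s(4) unfolding set_var_def by simp
qed

lemma run_order_prog:
  assumes s: "all_short s" "indexed_input s" "loads_stored s"
    and weight: "\<And>k. k < n \<Longrightarrow> s weight_array (of_nat k) = weight I k"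
  shows "runs order_prog s (order_found n)"
  unfolding order_prog_def
proof (rule run_Seq[OF run_init_order_prog[OF s(1,2)]])
  fix t assume t: "all_short t" "same_outside (writes init_order_prog) s t" "order_stored id t"
  let ?P = "\<lambda>r. indexed_input r \<and> loads_stored r"
  have "?P s" using s(2,3) by simp
  then have stored: "?P t" using t(2) by (rule loaded_input_frame) simp
  show "runs (For round_var Coflows round_prog) t (order_found n)"
  proof (rule run_conseq)
    show "runs (For round_var Coflows round_prog) t (\<lambda>r. ?P r \<and> order_found n r)"
    proof (rule run_For[OF t(1)])
      show "order_found 0 t"
        using reduced_init t(3) weight same_outsideD[OF t(2)] by (intro order_foundI) auto
      show "?P r" if "same_outside (insert round_var (writes round_prog)) t r" for r
        using stored that by (rule loaded_input_frame) simp
      show "runs round_prog r (order_found (Suc k))"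
        if "k < n" "all_short r" "?P r" "r round_var 0 = of_nat k" "order_found k r" for k r
        using that by (intro run_round_prog) auto
    qed (use loop_bounds(1) counts_le(1) in
        \<open>auto simp: indexed_inputD(2) order_found_def order_stored_def
          intro: le_two_power_bit_boundI\<close>)
  qed simp
qed

end


subsection \<open>Computing the schedule\<close>

abbreviation Release :: exp where "Release \<equiv> Cell release_array (Cell coflow_array (Var flow_var))"
abbreviation Left :: exp where "Left \<equiv> Cell left_array (Var flow_var)"
abbreviation Stamp :: exp where "Stamp \<equiv> Add (Var event_var) (Const 1)"
abbreviation Slot :: exp where
  "Slot \<equiv> Add (Mul (Var event_var) (Var flow_count_var)) (Var flow_var)"
abbreviation Interval_count :: exp where
  "Interval_count \<equiv> Mul (Mul (Const 2) (Var flow_count_var)) (Var flow_count_var)"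
abbreviation Amount :: exp where "Amount \<equiv> Mul (Cell active_array (Var flow_var)) (Var gap_var)"

definition build_step :: prog where
  "build_step = Seq
     (Assign coflow_array (Var flow_var) (Cell order_array (Cell pos_array (Var flow_var))))
     (Assign left_array (Var flow_var) (Cell demand_array
       (Add (Mul (Add (Mul (Cell coflow_array (Var flow_var)) Ports) Source_port) Ports)
         (Cell dst_array (Var flow_var)))))"

definition build_prog :: prog where
  "build_prog = For flow_var (Var flow_count_var) build_step"

definition shorten_gap :: "exp \<Rightarrow> prog" where
  "shorten_gap e = IfLess (Const 0) (Var gap_var)
     (IfLess e (Var gap_var) (set_var gap_var e) Skip) (set_var gap_var e)"

text \<open>A port is busy if it carries the number of the current event as a stamp.\<close>

definition activate :: prog where
  "activate = Seq (Assign active_array (Var flow_var) (Const 1))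
     (Seq (Assign stamp_array Source_port Stamp)
     (Seq (Assign stamp_array Destination_port Stamp) (shorten_gap Left)))"

definition choose_step :: prog where
  "choose_step = Seq (Assign active_array (Var flow_var) (Const 0))
     (IfLess (Const 0) Left
       (IfLess (Var time_var) Release (shorten_gap (Sub Release (Var time_var)))
         (IfLess (Cell stamp_array Source_port) Stamp
           (IfLess (Cell stamp_array Destination_port) Stamp activate Skip) Skip))
       Skip)"

definition choose_prog :: prog where
  "choose_prog = Seq (set_var gap_var (Const 0)) (For flow_var (Var flow_count_var) choose_step)"

definition emit_step :: prog where
  "emit_step = Seq (Assign out_source_array Slot Source_port)
     (Seq (Assign out_destination_array Slot (Cell dst_array (Var flow_var)))
     (Seq (Assign out_coflow_array Slot (Cell coflow_array (Var flow_var)))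
     (Seq (Assign out_start_array Slot (Var time_var))
     (Seq (Assign out_end_array Slot (Add (Var time_var) Amount))
       (Assign left_array (Var flow_var) (Sub Left Amount))))))"

definition event_prog :: prog where
  "event_prog = Seq choose_prog (Seq (For flow_var (Var flow_count_var) emit_step)
     (set_var time_var (Add (Var time_var) (Var gap_var))))"

definition simulate_prog :: prog where
  "simulate_prog = Seq (set_var out_count_var Interval_count)
     (For event_var (Mul (Const 2) (Var flow_count_var)) event_prog)"

lemma writes_schedule_progs [simp]:
  "writes build_step = {coflow_array, left_array}"
  "writes build_prog = {flow_var, coflow_array, left_array}"
  "writes choose_step = {stamp_array, active_array, gap_var}"
  "writes choose_prog = {flow_var, stamp_array, active_array, gap_var}"
  "writes emit_step = {out_source_array, out_destination_array, out_coflow_array, out_start_array,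
     out_end_array, left_array}"
  "writes event_prog = {out_source_array, out_destination_array, out_coflow_array, out_start_array,
     out_end_array, left_array, flow_var, stamp_array, active_array, time_var, gap_var}"
  "writes simulate_prog = {out_count_var, out_source_array, out_destination_array, out_coflow_array,
     out_start_array, out_end_array, left_array, flow_var, stamp_array, active_array, event_var,
     time_var, gap_var}"
  by (auto simp: build_step_def build_prog_def shorten_gap_def activate_def choose_step_def
      choose_prog_def emit_step_def event_prog_def simulate_prog_def)

lemma wp_shorten_gap:
  assumes "s gap_var 0 = g" "val e s = v" "fits h v"
    and "Q (s(gap_var := (s gap_var)(0 := if 0 < g \<and> g \<le> v then g else v)))"
  shows "wp h (shorten_gap e) Q s"
proof -
  have "s(gap_var := (s gap_var)(0 := g)) = s" using assms(1) by auto
  then show ?thesis using assms unfolding shorten_gap_def set_var_def by auto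
qed

context coflow_order
begin

lemma size_of_le: "z < flows \<Longrightarrow> size_of z \<le> 2 ^ \<beta>"
  unfolding size_of_def by (intro demand_le src_less dst_less cof_less)

lemma release_of_le: "z < flows \<Longrightarrow> release_of z \<le> 2 ^ \<beta>"
  unfolding release_of_def by (intro release_le cof_less)

lemma time_le_two_power:
  assumes "e \<le> 2 * flows"
  shows "time e \<le> 2 ^ (3 * \<beta> + 2)"
proof -
  have "1 + e \<le> 2 ^ (2 * \<beta> + 1)"
    using assms flows_le_input_bits less_exp[of "2 * \<beta> + 1"] by linarith
  then have "rat_of_nat (1 + e) \<le> of_nat (2 ^ (2 * \<beta> + 1))" by (simp only: of_nat_le_iff)
  then have events: "1 + rat_of_nat e \<le> 2 ^ (2 * \<beta> + 1)" by simp
  have "time e \<le> 2 ^ \<beta> + of_nat (e * 2 ^ \<beta>)"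
    using release_of_le size_of_le by (intro time_bound) auto
  also have "\<dots> = (1 + of_nat e) * 2 ^ \<beta>" by (simp add: algebra_simps)
  also have "\<dots> \<le> 2 ^ (2 * \<beta> + 1) * 2 ^ \<beta>" by (rule mult_right_mono[OF events]) simp
  also have "\<dots> = 2 ^ (3 * \<beta> + 1)"
    unfolding power_add[symmetric] by (rule arg_cong[of _ _ "power 2"]) simp
  also have "\<dots> \<le> 2 ^ (3 * \<beta> + 2)" by (rule two_power_mono) simp
  finally show ?thesis .
qed

lemma short_time: "e \<le> 2 * flows \<Longrightarrow> short (time e)"
    and short_left: "z < flows \<Longrightarrow> short (left e z)"
    and short_wait: "z < flows \<Longrightarrow> time e < release_of z \<Longrightarrow> short (release_of z - time e)"
proof -
  obtain D where D: "0 < D" "D \<le> 2 ^ \<beta>" "\<And>k. k \<in> {..<n} \<Longrightarrow> release I k * of_int D \<in> \<int>"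
    by (rule common_denominator[OF _ input_bits_parts(5)]) auto
  have release: "release_of z * of_int D \<in> \<int>" if "z < flows" for z
    unfolding release_of_def using D(3) cof_less[OF that] by simp
  note multiples = time_left_multiples[OF release, of e]
  have short: "short x" if "x * of_int D \<in> \<int>" "0 \<le> x" "x \<le> 2 ^ (3 * \<beta> + 2)" for x
  proof (rule fits_mono)
    show "fits (\<beta> + (3 * \<beta> + 2)) x"
      by (rule fits_if_common_denominator[OF that(1) D(1,2)]) (use that in simp)
    show "\<beta> + (3 * \<beta> + 2) \<le> bit_bound" by (simp add: bit_bound_def power2_eq_square algebra_simps)
  qed
  have small: "x \<le> 2 ^ (3 * \<beta> + 2)" if "x \<le> 2 ^ \<beta>" for x :: rat
    using that two_power_mono[of \<beta> "3 * \<beta> + 2", where 'a=rat] by simp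
  show "short (time e)" if "e \<le> 2 * flows" using multiples time_nonneg time_le_two_power[OF that]
    by (intro short) auto
  show "short (left e z)" if "z < flows"
  proof (rule short[OF _ left_nonneg small])
    have "rat_of_nat (size_of z) \<le> of_nat (2 ^ \<beta>)" using size_of_le[OF that]
      by (simp only: of_nat_le_iff)
    then show "left e z \<le> 2 ^ \<beta>"
      using left_le[of e z] unfolding of_nat_power of_nat_numeral by linarith
  qed (use multiples in blast)
  show "short (release_of z - time e)" if "z < flows" "time e < release_of z"
  proof (rule short[OF _ _ small])
    show "(release_of z - time e) * of_int D \<in> \<int>"
      using release[OF that(1)] multiples by (simp add: left_diff_distrib)
    show "release_of z - time e \<le> 2 ^ \<beta>" using release_of_le[OF that(1)] time_nonneg[of e]
      by linarith
  qed (use that in simp)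
qed

lemma short_cof: "z < flows \<Longrightarrow> short (of_nat (cof z))"
  using cof_less[of z] counts_le(1) by (intro short_of_nat) linarith

definition prioritized :: "memory \<Rightarrow> bool" where
  "prioritized s \<longleftrightarrow> indexed_input s \<and> (\<forall>y<flows. s coflow_array (of_nat y) = of_nat (cof y))"

lemma prioritized_determined_by: "determined_by prioritized
    {header_array, demand_array, release_array, pos_array, src_array, dst_array, coflow_array,
     flow_count_var}"
  by (simp add: determined_by_def prioritized_def indexed_input_def input_kept_def indexed_def)

lemmas prioritized_frame = determined_by_frame[OF prioritized_determined_by]

lemma prioritizedD:
  assumes "prioritized s"
  shows "s header_array 1 = of_nat N" "s flow_count_var 0 = of_nat flows"
    "z < flows \<Longrightarrow> s src_array (of_nat z) = of_nat (src z)"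
    "z < flows \<Longrightarrow> s dst_array (of_nat z) = of_nat (dst z)"
    "z < flows \<Longrightarrow> s coflow_array (of_nat z) = of_nat (cof z)"
    "z < flows \<Longrightarrow> s release_array (of_nat (cof z)) = release_of z"
  using assms indexed_inputD[of s] cof_less[of z] unfolding prioritized_def release_of_def by auto

lemma run_build_prog:
  assumes s: "all_short s" "indexed_input s" "order_stored \<pi> s"
  shows "runs build_prog s (\<lambda>t. prioritized t \<and> (\<forall>y<flows. t left_array (of_nat y) = left 0 y))"
  unfolding build_prog_def
proof (rule run_conseq)
  let ?P = "\<lambda>t. indexed_input t \<and> order_stored \<pi> t"
  let ?Inv = "\<lambda>z t. \<forall>y<z. t coflow_array (of_nat y) = of_nat (cof y) \<and>
    t left_array (of_nat y) = left 0 y"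
  show "runs (For flow_var (Var flow_count_var) build_step) s (\<lambda>t. ?P t \<and> ?Inv flows t)"
  proof (rule run_For_flows[where R = ?P and Inv = ?Inv, OF s(1)])
    show "?P t" if "same_outside (insert flow_var (writes build_step)) s t" for t
      using indexed_input_frame[OF s(2) that] s(3) same_outsideD[OF that]
      unfolding order_stored_def by simp
    show "runs build_step t (?Inv (Suc z))" if z: "z < flows" and t: "all_short t" "?P t"
      "t flow_var 0 = of_nat z" "?Inv z t" for z t
    proof (rule run_wp[OF t(1)])
      have parts: "pos (flow_number (cof z) (src z) (dst z)) = cof z"
        "src (flow_number (cof z) (src z) (dst z)) = src z"
        "dst (flow_number (cof z) (src z) (dst z)) = dst z"
        "flow_number (cof z) (src z) (dst z) < flows"
        using cof_less[OF z] src_less dst_less by (simp_all add: flow_number_parts flow_number_less)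
      have "t demand_array (of_nat (flow_number (cof z) (src z) (dst z))) = of_nat (size_of z)"
        using indexed_inputD(4)[OF conjunct1[OF t(2)] parts(4)] parts unfolding size_of_def by simp
      moreover have "t order_array (of_nat (pos z)) = of_nat (cof z)"
        using t(2) pos_less[OF z] unfolding order_stored_def cof_def by simp
      moreover have "short (of_nat (size_of z))"
        using size_of_le[OF z] two_power_input_bits_le by (intro short_of_nat) linarith
      ultimately show "wp bit_bound build_step (?Inv (Suc z)) t"
        using t(3,4) indexed_inputD(1,6-8)[OF conjunct1[OF t(2)]] z short_cof[OF z]
        unfolding build_step_def flow_number_def by (auto simp: less_Suc_eq)
    qed
  qed auto
qed (auto simp: prioritized_def)

definition at_event :: "nat \<Rightarrow> memory \<Rightarrow> bool" where
  "at_event e s \<longleftrightarrow> prioritized s \<and> s event_var 0 = of_nat e \<and> s time_var 0 = time e \<and>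
     (\<forall>y<flows. s left_array (of_nat y) = left e y)"

lemma at_event_determined_by: "determined_by (at_event e)
    {header_array, demand_array, release_array, pos_array, src_array, dst_array, coflow_array,
     left_array, flow_count_var, event_var, time_var}"
  by (simp add: determined_by_def at_event_def prioritized_def indexed_input_def input_kept_def
      indexed_def)

lemmas at_event_frame = determined_by_frame[OF at_event_determined_by]

abbreviation chosen_at :: "nat \<Rightarrow> nat \<Rightarrow> nat set" where
  "chosen_at e \<equiv> chosen (ready (time e) (left e))"
abbreviation gap_at :: "nat \<Rightarrow> nat \<Rightarrow> rat" where
  "gap_at e \<equiv> gap (time e) (left e)"

definition stamped :: "nat \<Rightarrow> nat set \<Rightarrow> (rat \<Rightarrow> rat) \<Rightarrow> bool" where
  "stamped e A b \<longleftrightarrow> (\<forall>p<2 * N. b (of_nat p) \<le> of_nat (Suc e) \<and>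
     (b (of_nat p) < of_nat (Suc e) \<longleftrightarrow> (\<forall>y\<in>A. p \<notin> ports_of y)))"

lemma stamped_insert:
  assumes "stamped e A b"
  shows "stamped e (insert y A)
    (b(of_nat (src y) := of_nat (Suc e), of_nat (N + dst y) := of_nat (Suc e)))"
  using assms unfolding stamped_def ports_of_def flow_ports_def
  by (auto simp del: of_nat_Suc of_nat_add)

definition choosing :: "nat \<Rightarrow> nat \<Rightarrow> memory \<Rightarrow> bool" where
  "choosing e q s \<longleftrightarrow> s gap_var 0 = gap_at e q \<and>
     (\<forall>y<q. s active_array (of_nat y) = of_bool (y \<in> active e)) \<and>
     stamped e (chosen_at e q) (s stamp_array)"

lemma active_iff_chosen_Suc: "q < flows \<Longrightarrow> q \<in> active e \<longleftrightarrow> q \<in> chosen_at e (Suc q)"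
  unfolding active_def by (rule chosen_stable) auto

lemma choosing_Suc_inactive:
  assumes "choosing e q s" "q < flows"
    and "\<not> (ready (time e) (left e) q \<and> (\<forall>y\<in>chosen_at e q. ports_of y \<inter> ports_of q = {}))"
    and "t active_array = (s active_array)(of_nat q := 0)" "t stamp_array = s stamp_array"
      "t gap_var 0 = gap_at e (Suc q)"
  shows "choosing e (Suc q) t"
proof -
  have same: "chosen_at e (Suc q) = chosen_at e q" using assms(3) by auto
  then have "q \<notin> active e" using chosenD[of q _ q] active_iff_chosen_Suc[OF assms(2)] by auto
  then show ?thesis
    using assms(1,4-6) unfolding choosing_def same by (auto simp: less_Suc_eq)
qed

lemma choosing_Suc_active:
  assumes "choosing e q s" "q < flows"
    and "ready (time e) (left e) q" "\<forall>y\<in>chosen_at e q. ports_of y \<inter> ports_of q = {}"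
    and "t active_array = (s active_array)(of_nat q := 1)"
      "t stamp_array = (s stamp_array)
        (of_nat (src q) := of_nat (Suc e), of_nat (N + dst q) := of_nat (Suc e))"
      "t gap_var 0 = gap_at e (Suc q)"
  shows "choosing e (Suc q) t"
proof -
  have insert: "chosen_at e (Suc q) = insert q (chosen_at e q)" using assms(3,4) by simp
  then have "q \<in> active e" unfolding active_iff_chosen_Suc[OF assms(2)] by simp
  then show ?thesis
    using assms(1,5-7) stamped_insert unfolding choosing_def insert by (auto simp: less_Suc_eq)
qed

context
  fixes e q :: nat and s :: memory
  assumes at_event: "at_event e s" and flow: "s flow_var 0 = of_nat q" "q < flows"
    and choosing: "choosing e q s"
begin

lemma choosing_cells:
  "s event_var 0 = of_nat e" "s time_var 0 = time e" "s left_array (of_nat q) = left e q"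
  "s gap_var 0 = gap_at e q" "s header_array 1 = of_nat N" "s src_array (of_nat q) = of_nat (src q)"
  "s dst_array (of_nat q) = of_nat (dst q)" "s coflow_array (of_nat q) = of_nat (cof q)"
  "s release_array (of_nat (cof q)) = release_of q"
  using at_event choosing prioritizedD[of s] flow(2) unfolding at_event_def choosing_def by auto

lemma stamp_less_iff:
  "p < 2 * N \<Longrightarrow> s stamp_array (of_nat p) < of_nat e + 1 \<longleftrightarrow> (\<forall>y\<in>chosen_at e q. p \<notin> ports_of y)"
  using choosing unfolding choosing_def stamped_def by (simp add: add.commute)

lemma wp_choose_step_iff:
  "wp h choose_step Q s \<longleftrightarrow>
    (let t = s(active_array := (s active_array)(of_nat q := 0)) in
     if 0 < left e q then
       if time e < release_of q then wp h (shorten_gap (Sub Release (Var time_var))) Q t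
       else if \<forall>y\<in>chosen_at e q. ports_of y \<inter> ports_of q = {} then wp h activate Q t else Q t
     else Q t)"
proof -
  have "(\<forall>y\<in>chosen_at e q. src q \<notin> ports_of y) \<and> (\<forall>y\<in>chosen_at e q. N + dst q \<notin> ports_of y)
      \<longleftrightarrow> (\<forall>y\<in>chosen_at e q. ports_of y \<inter> ports_of q = {})"
    unfolding ports_of_def[of q] flow_ports_def by auto
  then show ?thesis
    using flow(1) choosing_cells stamp_less_iff[of "src q"] stamp_less_iff[of "N + dst q"]
      src_less[of q] dst_less[of q]
    unfolding choose_step_def Let_def by auto
qed

lemma wp_wait_for_release:
  assumes "0 < left e q" "time e < release_of q"
  shows "wp bit_bound (shorten_gap (Sub Release (Var time_var))) (choosing e (Suc q))
    (s(active_array := (s active_array)(of_nat q := 0)))" (is "wp _ _ _ ?t")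
proof (rule wp_shorten_gap)
  show "choosing e (Suc q) (?t(gap_var := (?t gap_var)(0 :=
      if 0 < gap_at e q \<and> gap_at e q \<le> release_of q - time e then gap_at e q
      else release_of q - time e)))"
    using assms gap_Suc_unreleased[of "left e" q "time e"]
    by (intro choosing_Suc_inactive[OF choosing flow(2)]) (simp_all add: ready_def)
qed (use flow choosing_cells short_wait[OF flow(2) assms(2)] in auto)

lemma wp_activate:
  assumes "0 < left e q" "release_of q \<le> time e"
    and free: "\<forall>y\<in>chosen_at e q. ports_of y \<inter> ports_of q = {}" and e: "e < 2 * flows"
  shows "wp bit_bound activate (choosing e (Suc q))
    (s(active_array := (s active_array)(of_nat q := 0)))"
proof -
  let ?t = "s(active_array := (s active_array)(of_nat q := 1), stamp_array := (s stamp_array)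
    (of_nat (src q) := of_nat (Suc e), of_nat (N + dst q) := of_nat (Suc e)))"
  have "wp bit_bound (shorten_gap Left) (choosing e (Suc q)) ?t"
  proof (rule wp_shorten_gap)
    show "choosing e (Suc q) (?t(gap_var := (?t gap_var)(0 :=
        if 0 < gap_at e q \<and> gap_at e q \<le> left e q then gap_at e q else left e q)))"
      using assms gap_Suc_chosen[of "left e" q "time e"]
      by (intro choosing_Suc_active[OF choosing flow(2)]) (simp_all add: ready_def)
  qed (use flow choosing_cells short_left[OF flow(2)] in auto)
  moreover have "Suc e \<le> 2 ^ (3 * \<beta> + 2)" using e counts_le(3) by linarith
  then have "short (of_nat (Suc e))" by (rule short_of_nat)
  ultimately show ?thesis
    using flow choosing_cells unfolding activate_def by (simp add: add.commute)
qed

lemma run_choose_step: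
  assumes s: "all_short s" and e: "e < 2 * flows"
  shows "runs choose_step s (choosing e (Suc q))"
proof (rule run_wp[OF s])
  have "choosing e (Suc q) (s(active_array := (s active_array)(of_nat q := 0)))"
    if "\<not> 0 < left e q \<or> release_of q \<le> time e \<and> \<not> (\<forall>y\<in>chosen_at e q. ports_of y \<inter> ports_of q = {})"
    using that choosing_cells(4)
    by (intro choosing_Suc_inactive[OF choosing flow(2)])
      (auto simp: ready_def gap_Suc_skip)
  then show "wp bit_bound choose_step (choosing e (Suc q)) s"
    unfolding wp_choose_step_iff Let_def using wp_wait_for_release wp_activate[OF _ _ _ e]
    by (simp add: not_less)
qed

end

lemma run_choose_prog:
  assumes s: "all_short s" "at_event e s" and e: "e < 2 * flows"
    and old: "\<forall>p<2 * N. s stamp_array (of_nat p) \<le> of_nat e"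
  shows "runs choose_prog s (\<lambda>t. at_event e t \<and> choosing e flows t)"
  unfolding choose_prog_def
proof (rule run_Seq_wp[OF s(1)])
  let ?loop = "For flow_var (Var flow_count_var) choose_step"
  let ?t = "s(gap_var := (s gap_var)(0 := 0))"
  have "at_event e ?t"
    by (rule at_event_frame[OF s(2), of "{gap_var}"]) (auto simp: same_outside_def)
  then have frame: "at_event e t" if "same_outside (insert flow_var (writes choose_step)) ?t t"
    for t
    using that by (rule at_event_frame) simp
  have "x < of_nat (Suc e)" if "x \<le> of_nat e" for x :: rat
    using that by (simp add: order_le_less_trans)
  then have init: "choosing e 0 ?t"
    using old unfolding choosing_def stamped_def by (auto simp del: of_nat_Suc intro: less_imp_le)
  have "runs ?loop ?t (\<lambda>t. at_event e t \<and> choosing e flows t)" if short: "all_short ?t"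
  proof (rule run_For_flows[OF short])
    show "runs choose_step t (choosing e (Suc q))" if "q < flows" "all_short t" "at_event e t"
      "t flow_var 0 = of_nat q" "choosing e q t" for q t
      using that e by (intro run_choose_step)
  qed (use init frame in \<open>auto simp: choosing_def at_event_def prioritized_def\<close>)
  then show "wp bit_bound (set_var gap_var (Const 0))
      (\<lambda>t. all_short t \<longrightarrow> runs ?loop t (\<lambda>t. at_event e t \<and> choosing e flows t)) s"
    unfolding set_var_def by simp
qed

definition intervals_stored :: "nat \<Rightarrow> memory \<Rightarrow> bool" where
  "intervals_stored L s \<longleftrightarrow> (\<forall>l<L. let e = l div flows; z = l mod flows in
     s out_source_array (of_nat l) = of_nat (src z) \<and>
     s out_destination_array (of_nat l) = of_nat (dst z) \<and>
     s out_coflow_array (of_nat l) = of_nat (cof z) \<and> s out_start_array (of_nat l) = time e \<and>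
     s out_end_array (of_nat l) = (if z \<in> active e then time (Suc e) else time e))"

definition schedule_stored :: "memory \<Rightarrow> bool" where
  "schedule_stored s \<longleftrightarrow> s out_count_var 0 = of_nat (2 * flows * flows) \<and>
     intervals_stored (2 * flows * flows) s"

definition emitting :: "nat \<Rightarrow> nat \<Rightarrow> memory \<Rightarrow> bool" where
  "emitting e q s \<longleftrightarrow> intervals_stored (e * flows + q) s \<and>
     (\<forall>y<flows. s left_array (of_nat y) = (if y < q then left (Suc e) y else left e y))"

definition emission_state :: "nat \<Rightarrow> memory \<Rightarrow> bool" where
  "emission_state e s \<longleftrightarrow> prioritized s \<and> s event_var 0 = of_nat e \<and> s time_var 0 = time e \<and>
     s gap_var 0 = len e \<and> (\<forall>y<flows. s active_array (of_nat y) = of_bool (y \<in> active e))"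

lemma emission_state_determined_by: "determined_by (emission_state e)
    {header_array, demand_array, release_array, pos_array, src_array, dst_array, coflow_array,
     active_array, flow_count_var, event_var, time_var, gap_var}"
  by (simp add: determined_by_def emission_state_def prioritized_def indexed_input_def
      input_kept_def indexed_def)

lemmas emission_state_frame = determined_by_frame[OF emission_state_determined_by]

lemma run_emit_step:
  assumes s: "all_short s" "emission_state e s" "s flow_var 0 = of_nat q" "emitting e q s"
    and e: "e < 2 * flows" and q: "q < flows"
  shows "runs emit_step s (emitting e (Suc q))"
proof (rule run_wp[OF s(1)])
  define l where "l = e * flows + q"
  have l: "l div flows = e" "l mod flows = q" using q unfolding l_def by simp_all
  have cells: "prioritized s" "s event_var 0 = of_nat e" "s time_var 0 = time e"
    "s gap_var 0 = len e"
    "s active_array (of_nat q) = of_bool (q \<in> active e)"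
    using s(2) q unfolding emission_state_def by auto
  have slot: "of_nat e * of_nat flows + of_nat q = (of_nat l :: rat)" unfolding l_def by simp
  have left: "s left_array (of_nat q) = left e q" using s(4) q unfolding emitting_def by simp
  have "short (time e)" "short (time (Suc e))" using e by (auto intro: short_time)
  then show "wp bit_bound emit_step (emitting e (Suc q)) s"
    using s(3,4) cells left prioritizedD[OF cells(1)] q short_flow_parts[of q] short_cof[OF q]
      short_left[OF q, of "Suc e"]
    unfolding emit_step_def emitting_def intervals_stored_def
    by (auto simp: slot less_Suc_eq l Let_def time_Suc left_Suc simp flip: l_def)
qed

lemma run_emit_loop:
  assumes s: "all_short s" "emission_state e s" "emitting e 0 s" and e: "e < 2 * flows"
  shows "runs (For flow_var (Var flow_count_var) emit_step) s
    (\<lambda>t. emission_state e t \<and> emitting e flows t)"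
proof (rule run_For_flows[OF s(1)])
  show "emission_state e t" if "same_outside (insert flow_var (writes emit_step)) s t" for t
    using s(2) that by (rule emission_state_frame) simp
  show "runs emit_step t (emitting e (Suc q))" if "q < flows" "all_short t" "emission_state e t"
    "t flow_var 0 = of_nat q" "emitting e q t" for q t
    using that e by (intro run_emit_step)
qed (use s(3) in \<open>auto simp: emitting_def intervals_stored_def emission_state_def prioritized_def\<close>)

definition event_inv :: "nat \<Rightarrow> memory \<Rightarrow> bool" where
  "event_inv e s \<longleftrightarrow> s time_var 0 = time e \<and> (\<forall>y<flows. s left_array (of_nat y) = left e y) \<and>
     intervals_stored (e * flows) s \<and> (\<forall>p<2 * N. s stamp_array (of_nat p) \<le> of_nat e)"

lemma run_event_prog:
  assumes s: "all_short s" "prioritized s" "s event_var 0 = of_nat e" "event_inv e s"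
    and e: "e < 2 * flows"
  shows "runs event_prog s (event_inv (Suc e))"
  unfolding event_prog_def
proof (rule run_Seq[OF run_choose_prog[OF s(1) _ e]])
  show "at_event e s" using s unfolding at_event_def event_inv_def by simp
  show "\<forall>p<2 * N. s stamp_array (of_nat p) \<le> of_nat e" using s(4) unfolding event_inv_def by simp
  fix t assume t: "all_short t" "same_outside (writes choose_prog) s t"
    "at_event e t \<and> choosing e flows t"
  have kept: "t out_source_array = s out_source_array"
    "t out_destination_array = s out_destination_array"
    "t out_coflow_array = s out_coflow_array" "t out_start_array = s out_start_array"
    "t out_end_array = s out_end_array" "t left_array = s left_array"
    using same_outsideD[OF t(2)] by auto
  have state: "emission_state e t"
    using t(3) unfolding at_event_def choosing_def emission_state_def len_def by simp
  have stamps: "t stamp_array (of_nat p) \<le> of_nat (Suc e)" if "p < 2 * N" for p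
    using t(3) that unfolding choosing_def stamped_def by blast
  let ?loop = "For flow_var (Var flow_count_var) emit_step"
  let ?advance = "set_var time_var (Add (Var time_var) (Var gap_var))"
  show "runs (Seq ?loop ?advance) t (event_inv (Suc e))"
  proof (rule run_Seq[OF run_emit_loop[OF t(1) state _ e]])
    show "emitting e 0 t"
      using s(4) kept unfolding event_inv_def emitting_def intervals_stored_def by simp
    fix r assume r: "all_short r" "same_outside (writes ?loop) t r"
      "emission_state e r \<and> emitting e flows r"
    have "r stamp_array = t stamp_array" using same_outsideD[OF r(2)] by simp
    moreover have "short (time (Suc e))" using e by (intro short_time) simp
    ultimately show "runs ?advance r (event_inv (Suc e))"
      using r(3) stamps
      by (intro run_wp[OF r(1)])
        (auto simp: set_var_def event_inv_def emitting_def intervals_stored_def emission_state_def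
          time_Suc add.commute)
  qed
qed

lemma run_simulate_prog:
  assumes s: "all_short s" "prioritized s" "\<forall>y<flows. s left_array (of_nat y) = left 0 y"
    "s time_var 0 = 0" "\<And>q. s stamp_array q = 0"
  shows "runs simulate_prog s schedule_stored"
  unfolding simulate_prog_def
proof (rule run_Seq_wp[OF s(1)])
  let ?loop = "For event_var (Mul (Const 2) (Var flow_count_var)) event_prog"
  let ?t = "s(out_count_var := (s out_count_var)(0 := of_nat (2 * flows * flows)))"
  have "runs ?loop ?t schedule_stored" if short: "all_short ?t"
  proof (rule run_conseq)
    let ?P = "\<lambda>t. prioritized t \<and> t out_count_var 0 = of_nat (2 * flows * flows)"
    show "runs ?loop ?t (\<lambda>t. ?P t \<and> event_inv (2 * flows) t)"
    proof (rule run_For[OF short])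
      have "prioritized ?t"
        by (rule prioritized_frame[OF s(2), of "{out_count_var}"]) (auto simp: same_outside_def)
      then show "?P t" if "same_outside (insert event_var (writes event_prog)) ?t t" for t
        using prioritized_frame[OF _ that] same_outsideD[OF that, of out_count_var] by simp
      show "event_inv 0 ?t" using s(3-5) unfolding event_inv_def intervals_stored_def by simp
      show "2 * flows \<le> 2 ^ bit_bound" using counts_le(3) by (rule le_two_power_bit_boundI)
      show "runs event_prog t (event_inv (Suc e))" if "e < 2 * flows" "all_short t" "?P t"
        "t event_var 0 = of_nat e" "event_inv e t" for e t
        using that by (intro run_event_prog) auto
    qed (use loop_bounds(4) in \<open>auto simp: prioritizedD event_inv_def intervals_stored_def\<close>)
  qed (simp add: event_inv_def schedule_stored_def)
  then show "wp bit_bound (set_var out_count_var Interval_count)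
      (\<lambda>t. all_short t \<longrightarrow> runs ?loop t schedule_stored) s"
    using short_of_nat[OF counts_le(4)] prioritizedD(2)[OF s(2)] unfolding set_var_def by simp
qed

end


subsection \<open>The algorithm\<close>

lemma ex_less_mult_iff:
  fixes a b :: nat
  shows "(\<exists>l<a * b. Q (l div b) (l mod b)) \<longleftrightarrow> (\<exists>x<a. \<exists>y<b. Q x y)"
proof
  assume "\<exists>l<a * b. Q (l div b) (l mod b)"
  then obtain l where l: "l < a * b" "Q (l div b) (l mod b)" by blast
  then have "0 < b" by (cases b) auto
  then show "\<exists>x<a. \<exists>y<b. Q x y"
    using l
    by (intro exI[of _ "l div b"] conjI exI[of _ "l mod b"]) (auto simp: div_less_iff_less_mult)
next
  assume "\<exists>x<a. \<exists>y<b. Q x y"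
  then obtain x y where xy: "x < a" "y < b" "Q x y" by blast
  have "Suc x * b \<le> a * b" using xy(1) by (intro mult_le_mono1) simp
  then show "\<exists>l<a * b. Q (l div b) (l mod b)"
    using xy by (intro exI[of _ "x * b + y"]) simp
qed

context coflow_order
begin

lemma outputs_sched:
  assumes s: "\<And>q. s out_core_array q = 0" "schedule_stored s"
  shows "outputs I s sched"
proof -
  let ?transmitted = "\<lambda>i j k t l. s out_source_array (of_nat l) = of_nat i \<and>
    s out_destination_array (of_nat l) = of_nat j \<and> s out_coflow_array (of_nat l) = of_nat k \<and>
    real_of_rat (s out_start_array (of_nat l)) \<le> t \<and> t < real_of_rat (s out_end_array (of_nat l))"
  let ?L = "2 * flows * flows"
  have "(\<exists>l::nat. of_nat l < s out_count_var 0 \<and> ?transmitted i j k t l)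
    \<longleftrightarrow> (\<exists>z<flows. src z = i \<and> dst z = j \<and> cof z = k \<and> transmitting z t)" for i j k t
  proof -
    let ?Q = "\<lambda>e z. src z = i \<and> dst z = j \<and> cof z = k \<and> z \<in> active e \<and> \<tau> e \<le> t \<and> t < \<tau> (Suc e)"
    have count: "of_nat l < s out_count_var 0 \<longleftrightarrow> l < ?L" for l
      using s(2) unfolding schedule_stored_def by (simp only: of_nat_less_iff)
    have "?transmitted i j k t l \<longleftrightarrow> ?Q (l div flows) (l mod flows)" if "l < ?L" for l
      using s(2) that unfolding schedule_stored_def intervals_stored_def Let_def \<tau>_def by auto
    then have "(\<exists>l. of_nat l < s out_count_var 0 \<and> ?transmitted i j k t l)
        \<longleftrightarrow> (\<exists>l<?L. ?Q (l div flows) (l mod flows))"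
      unfolding count by blast
    also have "\<dots> \<longleftrightarrow> (\<exists>e<2 * flows. \<exists>z<flows. ?Q e z)" by (rule ex_less_mult_iff)
    also have "\<dots> \<longleftrightarrow> (\<exists>z<flows. src z = i \<and> dst z = j \<and> cof z = k \<and> transmitting z t)"
      unfolding transmitting_def by blast
    finally show ?thesis .
  qed
  then show ?thesis unfolding outputs_def sched_def using s(1) by simp
qed

end

definition near_optimal_output :: "coflow_instance \<Rightarrow> memory \<Rightarrow> bool" where
  "near_optimal_output I s \<longleftrightarrow> (\<exists>S. outputs I s S \<and> feasible I S \<and>
     objective I S \<le> (4 * real (cores I) + 1) * optimum I)"

lemma (in coflow_order) run_build_simulate_prog:
  assumes s: "all_short s" "indexed_input s" "order_stored \<pi> s"
    and zero: "\<And>a. a \<in> {out_core_array, stamp_array, time_var} \<Longrightarrow> s a = (\<lambda>_. 0)"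
    and inv: "local_ratio_inv 0 \<pi> v"
  shows "runs (Seq build_prog simulate_prog) s (near_optimal_output I)"
proof (rule run_Seq[OF run_build_prog[OF s]])
  fix t assume t: "all_short t" "same_outside (writes build_prog) s t"
    "prioritized t \<and> (\<forall>y<flows. t left_array (of_nat y) = left 0 y)"
  have zero': "t a = (\<lambda>_. 0)" if "a \<in> {out_core_array, stamp_array, time_var}" for a
    using that zero same_outsideD[OF t(2), of a] by auto
  have "runs simulate_prog t schedule_stored"
    using t zero' by (intro run_simulate_prog) auto
  then show "runs simulate_prog t (near_optimal_output I)"
  proof (rule run_conseq)
    fix r assume r: "same_outside (writes simulate_prog) t r" "schedule_stored r"
    have "r out_core_array q = 0" for q using same_outsideD[OF r(1), of out_core_array] zero'
      by simp
    then have "outputs I r sched" using r(2) by (intro outputs_sched) auto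
    then show "near_optimal_output I r"
      unfolding near_optimal_output_def using feasible_sched objective_sched_le_optimum[OF inv]
      by blast
  qed
qed

definition algorithm :: prog where
  "algorithm = Seq index_prog (Seq load_prog (Seq order_prog (Seq build_prog simulate_prog)))"

lemma (in valid_coflow_instance) run_algorithm:
  "runs algorithm (encode I) (near_optimal_output I)"
  unfolding algorithm_def
proof (rule run_Seq[OF run_index_prog])
  fix s assume s: "all_short s" "same_outside (writes index_prog) (encode I) s" "indexed_input s"
  have load_zero: "s load_array q = 0" for q
    using same_outsideD[OF s(2), of load_array] encode_other by simp
  show "runs (Seq load_prog (Seq order_prog (Seq build_prog simulate_prog))) s
    (near_optimal_output I)"
  proof (rule run_Seq[OF run_load_prog[OF s(1,3) load_zero]])
    fix t assume t: "all_short t" "same_outside (writes load_prog) s t"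
      "indexed_input t \<and> loads_stored t"
    have "t weight_array = encode I weight_array"
      using same_outsideD[OF t(2)] same_outsideD[OF s(2)] by simp
    then have order: "runs order_prog t (order_found n)"
      using t encode_weight by (intro run_order_prog) auto
    show "runs (Seq order_prog (Seq build_prog simulate_prog)) t (near_optimal_output I)"
    proof (rule run_Seq[OF order])
      fix r assume r: "all_short r" "same_outside (writes order_prog) t r" "order_found n r"
      obtain \<pi> v where found: "reduced n \<pi> v" "order_stored \<pi> r"
        using r(3) unfolding order_found_def by blast
      interpret coflow_order I \<pi> by unfold_locales (rule reduced_bij[OF found(1)])
      have "indexed_input r" using conjunct1[OF t(3)] r(2) by (rule indexed_input_frame) simp
      moreover have "r a = (\<lambda>_. 0)" if "a \<in> {out_core_array, stamp_array, time_var}" for a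
        using that same_outsideD[OF r(2), of a] same_outsideD[OF t(2), of a]
          same_outsideD[OF s(2), of a] encode_other[of a] by auto
      moreover have "local_ratio_inv 0 \<pi> (\<lambda>k. real_of_rat (v k))"
        using found(1) unfolding reduced_def by simp
      ultimately show "runs (Seq build_prog simulate_prog) r (near_optimal_output I)"
        using r(1) found(2) by (intro run_build_simulate_prog)
    qed
  qed
qed

lemma poly_nat_mono:
  fixes p :: "nat poly"
  assumes "x \<le> y"
  shows "poly p x \<le> poly p y"
  by (induction p) (use assms in \<open>auto intro!: add_mono mult_mono\<close>)

lemma exec_algorithm:
  assumes "valid_instance I"
  obtains u b s where "exec algorithm (encode I) u b s"
    "u \<le> poly (ops_poly algorithm) (2 * input_count I)"
    "b \<le> prog_factor algorithm * ((input_bits I + 4)\<^sup>2 + 1) *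
      poly (ops_poly algorithm) (2 * input_bits I)"
    "near_optimal_output I s"
proof -
  interpret valid_coflow_instance I by unfold_locales (rule assms)
  obtain u b s
    where exec: "exec algorithm (encode I) u b s" "u \<le> poly (ops_poly algorithm) loop_bound"
    "b \<le> prog_factor algorithm * (bit_bound + 1) * u" "near_optimal_output I s"
    using run_algorithm by (rule runE)
  have "u \<le> poly (ops_poly algorithm) (2 * input_bits I)"
    using exec(2) poly_nat_mono[of loop_bound "2 * input_bits I" "ops_poly algorithm"]
      input_count_le_input_bits unfolding loop_bound_def by linarith
  then have "prog_factor algorithm * (bit_bound + 1) * u
      \<le> prog_factor algorithm * (bit_bound + 1) * poly (ops_poly algorithm) (2 * input_bits I)"
    by (intro mult_left_mono) auto
  then show thesis
    using that[OF exec(1) _ _ exec(4)] exec(2,3) unfolding loop_bound_def bit_bound_def by linarith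
qed

lemma poly_pcompose_double: "poly (pcompose p [:0, 2:]) x = poly p (2 * x)" for x :: nat
  by (simp add: poly_pcompose mult.commute)

lemma combinatorial_algorithm: "combinatorial algorithm"
  unfolding combinatorial_def
proof (rule exI, intro allI impI)
  fix I assume "valid_instance I"
  then obtain u b s where "exec algorithm (encode I) u b s"
    "u \<le> poly (ops_poly algorithm) (2 * input_count I)"
    by (rule exec_algorithm)
  then show "\<exists>u b s. exec algorithm (encode I) u b s \<and>
      u \<le> poly (pcompose (ops_poly algorithm) [:0, 2:]) (input_count I)"
    unfolding poly_pcompose_double by blast
qed

lemma polynomial_time_algorithm: "polynomial_time algorithm"
  unfolding polynomial_time_def
proof (rule exI, intro allI impI)
  let ?factor = "[:prog_factor algorithm:] * ([:4, 1:]\<^sup>2 + 1)"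
  fix I assume "valid_instance I"
  then obtain u b s where "exec algorithm (encode I) u b s"
    "b \<le> prog_factor algorithm * ((input_bits I + 4)\<^sup>2 + 1) *
      poly (ops_poly algorithm) (2 * input_bits I)"
    by (rule exec_algorithm)
  moreover have "poly (?factor * pcompose (ops_poly algorithm) [:0, 2:]) x
      = prog_factor algorithm * ((x + 4)\<^sup>2 + 1) * poly (ops_poly algorithm) (2 * x)" for x
    by (simp only: poly_mult poly_pcompose_double) (simp add: poly_power add.commute)
  ultimately show "\<exists>u b s. exec algorithm (encode I) u b s \<and>
      b \<le> poly (?factor * pcompose (ops_poly algorithm) [:0, 2:]) (input_bits I)"
    by (metis (no_types, lifting))
qed

lemma approximation_ratio_algorithm:
  "approximation_ratio algorithm (\<lambda>I. 4 * real (cores I) + 1)"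
  unfolding approximation_ratio_def
proof (intro allI impI)
  fix I assume "valid_instance I"
  then obtain u b s where "exec algorithm (encode I) u b s" "near_optimal_output I s"
    by (rule exec_algorithm)
  then show "\<exists>u b s S. exec algorithm (encode I) u b s \<and> outputs I s S \<and> feasible I S \<and>
      objective I S \<le> (4 * real (cores I) + 1) * optimum I"
    unfolding near_optimal_output_def by blast
qed

theorem theorem3:
  "\<exists>A :: prog. combinatorial A \<and> polynomial_time A \<and>
     approximation_ratio A (\<lambda>I. 4 * real (cores I) + 1)"
  using combinatorial_algorithm polynomial_time_algorithm approximation_ratio_algorithm by blast

end
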